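(* Let $M$ be a $(\varphi,\nabla)$-module over $\mathcal{E}$ of rank $n$, and let $\lambda_1(M)\le\dots\le\lambda_n(M)$ be the slopes (with multiplicity) of its log-growth Newton polygon. Then $\lambda_{i+1}(M)-\lambda_i(M)\le1$ for $i=1,\dots,n-1$.
   Context: $K$: complete discretely valued field of characteristic $0$, residue field of characteristic $p$, $|p|=p^{-1}$; $q$ a power of $p$; $\varphi_K$ isometric endomorphism lifting the $q$-power map. $\mathcal{E}$: Laurent series over $K$ with bounded coefficients and $|a_i|\to0$ as $i\to-\infty$, Gauss norm $|\cdot|_0$. Fix $s\in\mathcal{E}$ converging on some annulus $e^{-r}\le|t|<1$, $|s-t^q|_0<1$, $\varphi(\sum a_it^i)=\sum\varphi_K(a_i)s^i$. $(\varphi,\nabla)$-module over $\mathcal{E}$: finite-dimensional $M$, semilinear $\varphi_M$ of bijective linearization, $D_M$ Leibniz for $d/dt$, $D_M\varphi_M=(ds/dt)\varphi_MD_M$. Log-growth filtration: with $\tau(f)=\sum\frac1{n!}f^{(n)}(X-t)^n$, $\mathrm{Sol}_\lambda(M)$ is the space of horizontal $\mathcal{E}[\![X-t]\!]_0$-linear maps $\tau^*M\to$ power series $\sum a_n(X-t)^n$ over $\mathcal{E}$ with $|a_n|_0=O(n^\lambda)$ ($0$ for $\lambda<0$); $M^\lambda$ is the unique $(\varphi,\nabla)$-submodule with $\mathrm{Sol}_\lambda(M)=\mathrm{Sol}(M/M^\lambda)$. The log-growth Newton polygon of $M$ has slope multiset consisting of each $\lambda$ with multiplicity $m(\lambda)=\lim_{\varepsilon\to0+}\dim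 M^{\lambda-\varepsilon}-\lim_{\varepsilon\to0+}\dim M^{\lambda+\varepsilon}$ (these multiplicities sum to $n$). *)

theory Defs
  imports Complex_Main "HOL-Library.Function_Algebras" "HOL-Library.Multiset"
    "HOL-Computational_Algebra.Primes"
begin

definition nonarch_abs :: "('k::field \<Rightarrow> real) \<Rightarrow> bool" where
  "nonarch_abs nv \<longleftrightarrow> (\<forall>a. 0 \<le> nv a) \<and> (\<forall>a. nv a = 0 \<longleftrightarrow> a = 0)
     \<and> (\<forall>a b. nv (a * b) = nv a * nv b) \<and> (\<forall>a b. nv (a + b) \<le> max (nv a) (nv b))"

definition discretely_valued :: "('k::field \<Rightarrow> real) \<Rightarrow> bool" where
  "discretely_valued nv \<longleftrightarrow> (\<exists>\<pi>. 0 < nv \<pi> \<and> nv \<pi> < 1 \<and>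
      (\<forall>a. a \<noteq> 0 \<longrightarrow> (\<exists>k::int. nv a = nv \<pi> powi k)))"

definition nv_complete :: "('k::field \<Rightarrow> real) \<Rightarrow> bool" where
  "nv_complete nv \<longleftrightarrow> (\<forall>X::nat \<Rightarrow> 'k.
      (\<forall>\<epsilon>>0. \<exists>N. \<forall>m\<ge>N. \<forall>n\<ge>N. nv (X m - X n) < \<epsilon>) \<longrightarrow>
      (\<exists>L. (\<lambda>n. nv (X n - L)) \<longlonglongrightarrow> 0))"

text \<open>Complete discretely valued field (char 0 comes from the type class),
  with |p| = 1/p (hence residue characteristic p).\<close>
definition base_field :: "('k::field_char_0 \<Rightarrow> real) \<Rightarrow> nat \<Rightarrow> bool" where
  "base_field nv p \<longleftrightarrow> nonarch_abs nv \<and> discretely_valued nv \<and> nv_complete nv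
     \<and> prime p \<and> nv (of_nat p) = 1 / real p"

definition frob_lift :: "('k::field \<Rightarrow> real) \<Rightarrow> nat \<Rightarrow> ('k \<Rightarrow> 'k) \<Rightarrow> bool" where
  "frob_lift nv q phiK \<longleftrightarrow> (\<forall>a b. phiK (a + b) = phiK a + phiK b)
     \<and> (\<forall>a b. phiK (a * b) = phiK a * phiK b) \<and> phiK 1 = 1
     \<and> (\<forall>a. nv (phiK a) = nv a)
     \<and> (\<forall>a. nv a \<le> 1 \<longrightarrow> nv (phiK a - a ^ q) < 1)"

definition kHasSum :: "('k::field \<Rightarrow> real) \<Rightarrow> ('i \<Rightarrow> 'k) \<Rightarrow> 'k \<Rightarrow> bool" where
  "kHasSum nv f L \<longleftrightarrow> (\<forall>\<epsilon>>0. \<exists>F0. finite F0 \<and>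
      (\<forall>F. finite F \<and> F0 \<subseteq> F \<longrightarrow> nv (sum f F - L) < \<epsilon>))"

definition kSum :: "('k::field \<Rightarrow> real) \<Rightarrow> ('i \<Rightarrow> 'k) \<Rightarrow> 'k" where
  "kSum nv f = (THE L. kHasSum nv f L)"

section \<open>The ring \<E> of Laurent series (coefficient functions int => K)\<close>

type_synonym 'k lau = "int \<Rightarrow> 'k"

definition inE :: "('k::field \<Rightarrow> real) \<Rightarrow> 'k lau \<Rightarrow> bool" where
  "inE nv a \<longleftrightarrow> bdd_above (range (\<lambda>i. nv (a i))) \<and> ((\<lambda>i. nv (a i)) \<longlongrightarrow> 0) at_bot"

definition gnorm :: "('k::field \<Rightarrow> real) \<Rightarrow> 'k lau \<Rightarrow> real" where
  "gnorm nv a = (SUP i. nv (a i))"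

definition emul :: "('k::field \<Rightarrow> real) \<Rightarrow> 'k lau \<Rightarrow> 'k lau \<Rightarrow> 'k lau" where
  "emul nv a b = (\<lambda>n. kSum nv (\<lambda>i::int. a i * b (n - i)))"

definition eone :: "'k::field lau" where
  "eone = (\<lambda>n. if n = 0 then 1 else 0)"

definition tvar :: "'k::field lau" where
  "tvar = (\<lambda>n. if n = 1 then 1 else 0)"

definition epow :: "('k::field \<Rightarrow> real) \<Rightarrow> 'k lau \<Rightarrow> nat \<Rightarrow> 'k lau" where
  "epow nv a k = (emul nv a ^^ k) eone"

definition einv :: "('k::field \<Rightarrow> real) \<Rightarrow> 'k lau \<Rightarrow> 'k lau" where
  "einv nv a = (THE b. inE nv b \<and> emul nv a b = eone)"

definition epowi :: "('k::field \<Rightarrow> real) \<Rightarrow> 'k lau \<Rightarrow> int \<Rightarrow> 'k lau" where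
  "epowi nv a i = (if 0 \<le> i then epow nv a (nat i) else epow nv (einv nv a) (nat (- i)))"

definition ederiv :: "'k::field lau \<Rightarrow> 'k lau" where
  "ederiv a = (\<lambda>n. of_int (n + 1) * a (n + 1))"

definition frob_param :: "('k::field \<Rightarrow> real) \<Rightarrow> nat \<Rightarrow> 'k lau \<Rightarrow> bool" where
  "frob_param nv q s \<longleftrightarrow> inE nv s \<and>
     (\<exists>r>0. \<forall>\<rho>. exp (- r) \<le> \<rho> \<and> \<rho> < 1 \<longrightarrow>
        ((\<lambda>i. nv (s i) * \<rho> powr of_int i) \<longlongrightarrow> 0) at_top \<and>
        ((\<lambda>i. nv (s i) * \<rho> powr of_int i) \<longlongrightarrow> 0) at_bot)
     \<and> gnorm nv (s - epow nv tvar q) < 1"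

text \<open>phi(sum a_i t^i) = sum phiK(a_i) s^i, computed coefficientwise.\<close>
definition ephi :: "('k::field \<Rightarrow> real) \<Rightarrow> ('k \<Rightarrow> 'k) \<Rightarrow> 'k lau \<Rightarrow> 'k lau \<Rightarrow> 'k lau" where
  "ephi nv phiK s a = (\<lambda>n. kSum nv (\<lambda>i::int. phiK (a i) * epowi nv s i n))"

section \<open>(phi,nabla)-modules of rank n, in a basis: M = \<E>^n\<close>

type_synonym 'k vec = "nat \<Rightarrow> 'k lau"

definition inEvec :: "('k::field \<Rightarrow> real) \<Rightarrow> nat \<Rightarrow> 'k vec \<Rightarrow> bool" where
  "inEvec nv n v \<longleftrightarrow> (\<forall>i<n. inE nv (v i)) \<and> (\<forall>i\<ge>n. v i = 0)"

definition smul :: "('k::field \<Rightarrow> real) \<Rightarrow> 'k lau \<Rightarrow> 'k vec \<Rightarrow> 'k vec" where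
  "smul nv c v = (\<lambda>i. emul nv c (v i))"

definition matvec :: "('k::field \<Rightarrow> real) \<Rightarrow> nat \<Rightarrow> (nat \<Rightarrow> nat \<Rightarrow> 'k lau) \<Rightarrow> 'k vec \<Rightarrow> 'k vec" where
  "matvec nv n A v = (\<lambda>i. if i < n then (\<Sum>j<n. emul nv (A i j) (v j)) else 0)"

definition phiM :: "('k::field \<Rightarrow> real) \<Rightarrow> ('k \<Rightarrow> 'k) \<Rightarrow> 'k lau \<Rightarrow> nat
    \<Rightarrow> (nat \<Rightarrow> nat \<Rightarrow> 'k lau) \<Rightarrow> 'k vec \<Rightarrow> 'k vec" where
  "phiM nv phiK s n A v = matvec nv n A (\<lambda>j. ephi nv phiK s (v j))"

definition DM :: "('k::field \<Rightarrow> real) \<Rightarrow> nat \<Rightarrow> (nat \<Rightarrow> nat \<Rightarrow> 'k lau) \<Rightarrow> 'k vec \<Rightarrow> 'k vec" where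
  "DM nv n G v = (\<lambda>i. if i < n then ederiv (v i) + (\<Sum>j<n. emul nv (G i j) (v j)) else 0)"

definition phi_nabla_module :: "('k::field \<Rightarrow> real) \<Rightarrow> ('k \<Rightarrow> 'k) \<Rightarrow> 'k lau \<Rightarrow> nat
    \<Rightarrow> (nat \<Rightarrow> nat \<Rightarrow> 'k lau) \<Rightarrow> (nat \<Rightarrow> nat \<Rightarrow> 'k lau) \<Rightarrow> bool" where
  "phi_nabla_module nv phiK s n A G \<longleftrightarrow>
     (\<forall>i<n. \<forall>j<n. inE nv (A i j) \<and> inE nv (G i j))
     \<and> (\<forall>w. inEvec nv n w \<longrightarrow> (\<exists>!v. inEvec nv n v \<and> matvec nv n A v = w))
     \<and> (\<forall>v. inEvec nv n v \<longrightarrow>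
          DM nv n G (phiM nv phiK s n A v) = smul nv (ederiv s) (phiM nv phiK s n A (DM nv n G v)))"

definition is_submod :: "('k::field \<Rightarrow> real) \<Rightarrow> ('k \<Rightarrow> 'k) \<Rightarrow> 'k lau \<Rightarrow> nat
    \<Rightarrow> (nat \<Rightarrow> nat \<Rightarrow> 'k lau) \<Rightarrow> (nat \<Rightarrow> nat \<Rightarrow> 'k lau) \<Rightarrow> 'k vec set \<Rightarrow> bool" where
  "is_submod nv phiK s n A G N \<longleftrightarrow> N \<subseteq> {v. inEvec nv n v} \<and> 0 \<in> N
     \<and> (\<forall>v\<in>N. \<forall>w\<in>N. v + w \<in> N)
     \<and> (\<forall>c v. inE nv c \<and> v \<in> N \<longrightarrow> smul nv c v \<in> N)
     \<and> (\<forall>v\<in>N. phiM nv phiK s n A v \<in> N) \<and> (\<forall>v\<in>N. DM nv n G v \<in> N)"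

definition e_indep :: "('k::field \<Rightarrow> real) \<Rightarrow> 'k vec set \<Rightarrow> bool" where
  "e_indep nv S \<longleftrightarrow> (\<forall>c. (\<forall>v\<in>S. inE nv (c v)) \<and> (\<Sum>v\<in>S. smul nv (c v) v) = 0
       \<longrightarrow> (\<forall>v\<in>S. c v = 0))"

definition dimE :: "('k::field \<Rightarrow> real) \<Rightarrow> 'k vec set \<Rightarrow> nat" where
  "dimE nv N = Max {card S | S. finite S \<and> S \<subseteq> N \<and> e_indep nv S}"

text \<open>power series in Y = X - t with coefficients in \<E>\<close>
type_synonym 'k eps = "nat \<Rightarrow> 'k lau"

definition tau :: "'k::field_char_0 lau \<Rightarrow> 'k eps" where
  "tau f = (\<lambda>m j. (ederiv ^^ m) f j / of_nat (fact m))"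

definition psmul :: "('k::field \<Rightarrow> real) \<Rightarrow> 'k eps \<Rightarrow> 'k eps \<Rightarrow> 'k eps" where
  "psmul nv f g = (\<lambda>m. \<Sum>k\<le>m. emul nv (f k) (g (m - k)))"

definition psderiv :: "'k::field eps \<Rightarrow> 'k eps" where
  "psderiv f = (\<lambda>m j. of_nat (Suc m) * f (Suc m) j)"

definition growth :: "('k::field \<Rightarrow> real) \<Rightarrow> real \<Rightarrow> 'k eps \<Rightarrow> bool" where
  "growth nv lam f \<longleftrightarrow> (\<forall>m. inE nv (f m)) \<and>
     (if lam < 0 then f = 0 else (\<exists>C. \<forall>m\<ge>1. gnorm nv (f m) \<le> C * real m powr lam))"

text \<open>A horizontal map Phi : tau^*M -> \<E>[[X-t]] is given by y_j = Phi(1 (x) e_j);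
  horizontality: d/dX Phi(1(x)e_j) = Phi(nabla(1(x)e_j)) = sum_i tau(G_ij) y_i.\<close>
definition horizontal :: "('k::field_char_0 \<Rightarrow> real) \<Rightarrow> nat
    \<Rightarrow> (nat \<Rightarrow> nat \<Rightarrow> 'k lau) \<Rightarrow> (nat \<Rightarrow> 'k eps) \<Rightarrow> bool" where
  "horizontal nv n G y \<longleftrightarrow> (\<forall>j\<ge>n. y j = 0) \<and> (\<forall>j<n. \<forall>m. inE nv (y j m))
     \<and> (\<forall>j<n. psderiv (y j) = (\<Sum>i<n. psmul nv (tau (G i j)) (y i)))"

definition Sol_lam :: "('k::field_char_0 \<Rightarrow> real) \<Rightarrow> nat
    \<Rightarrow> (nat \<Rightarrow> nat \<Rightarrow> 'k lau) \<Rightarrow> real \<Rightarrow> (nat \<Rightarrow> 'k eps) set" where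
  "Sol_lam nv n G lam = {y. horizontal nv n G y \<and> (\<forall>j<n. growth nv lam (y j))}"

text \<open>Sol(M/N): horizontal maps tau^*M -> \<E>[[X-t]] vanishing on tau^*N,
  where Phi(1 (x) v) = sum_j tau(v_j) y_j.\<close>
definition Sol_quot :: "('k::field_char_0 \<Rightarrow> real) \<Rightarrow> nat
    \<Rightarrow> (nat \<Rightarrow> nat \<Rightarrow> 'k lau) \<Rightarrow> 'k vec set \<Rightarrow> (nat \<Rightarrow> 'k eps) set" where
  "Sol_quot nv n G N = {y. horizontal nv n G y \<and>
      (\<forall>v\<in>N. (\<Sum>j<n. psmul nv (tau (v j)) (y j)) = 0)}"

definition Mlam :: "('k::field_char_0 \<Rightarrow> real) \<Rightarrow> ('k \<Rightarrow> 'k) \<Rightarrow> 'k lau \<Rightarrow> nat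
    \<Rightarrow> (nat \<Rightarrow> nat \<Rightarrow> 'k lau) \<Rightarrow> (nat \<Rightarrow> nat \<Rightarrow> 'k lau) \<Rightarrow> real \<Rightarrow> 'k vec set" where
  "Mlam nv phiK s n A G lam =
     (THE N. is_submod nv phiK s n A G N \<and> Sol_lam nv n G lam = Sol_quot nv n G N)"

definition lg_mult :: "('k::field_char_0 \<Rightarrow> real) \<Rightarrow> ('k \<Rightarrow> 'k) \<Rightarrow> 'k lau \<Rightarrow> nat
    \<Rightarrow> (nat \<Rightarrow> nat \<Rightarrow> 'k lau) \<Rightarrow> (nat \<Rightarrow> nat \<Rightarrow> 'k lau) \<Rightarrow> real \<Rightarrow> real" where
  "lg_mult nv phiK s n A G lam =
     Lim (at_right 0) (\<lambda>\<epsilon>. real (dimE nv (Mlam nv phiK s n A G (lam - \<epsilon>))))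
   - Lim (at_right 0) (\<lambda>\<epsilon>. real (dimE nv (Mlam nv phiK s n A G (lam + \<epsilon>))))"

end

theory Submission
  imports Defs "HOL-Computational_Algebra.Formal_Power_Series"
begin

text \<open>
  A horizontal map is determined by its value at \<open>X = t\<close>, a linear functional \<open>x\<close> on \<open>M\<close>, and its
  coefficients are \<open>x (D\<^sup>m v / m!)\<close>; so \<open>Sol\<^sub>\<lambda>(M)\<close> is a space \<open>W \<lambda>\<close> of functionals, stable under the dual
  connection and the dual Frobenius, and \<open>M\<^sup>\<lambda>\<close> is its annihilator.

  If \<open>N = M\<^sup>\<lambda>\<close> is nonzero, it carries a nonzero functional that is bounded on all \<open>D\<^sup>m v / m!\<close>: the
  lattices spanned by the images of a basis under high powers of Frobenius are contracted by any
  given \<open>D\<^sup>m / m!\<close>, because \<open>D \<phi> = s' \<phi> D\<close> and \<open>s'\<close> has norm less than 1, and completeness yields the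
  functional. Extend it to \<open>M\<close>. By variation of constants, and since
  \<open>k! l! / (k + l + 1)!\<close> has absolute value at most \<open>k + l + 1\<close>, the extension has growth at most
  \<open>\<lambda> + 1\<close>, and it does not vanish on \<open>N\<close>. Hence \<open>M\<^bsup>\<lambda>+1\<^esup>\<close> is strictly smaller than \<open>M\<^sup>\<lambda>\<close>, while a gap of
  length greater than 1 between slopes would make them equal.
\<close>

section \<open>Unconditional summation in a complete non-archimedean field\<close>

text \<open>A fixed lattice need not be stable under all the operators \<open>D^m / m!\<close>: the
  division by m! costs more and more as m grows, while the t-th Frobenius lattice offers one fixed
  gain \<open>\<delta> t\<close>. The functional is therefore taken bounded on the module of vectors
  that lie in the t-th lattice, scaled by \<open>M t\<close>, for all large t, where the threshold
  may depend on m. The scale \<open>M t\<close> is normalised by a basis of N, so the module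
  contains every \<open>D^m / m!\<close> of that basis and still misses a multiple of some basis
  vector; how the scales for different t compare never matters. The 1 of the theorem is the beta
  factor: with |p| = 1/p it costs one power of m. \<open>Mlam\<close> is a definite description, so
  existence and uniqueness of the submodule have to be proved. The delicate point is stability of
  the annihilator under Frobenius, which needs the dual Frobenius images to span
  \<open>W lam\<close>, not merely to lie in it. Products and Frobenius on E are unconditional sums,
  so E has to be established as a complete field, and discreteness of the valuation is what makes
  nonzero series invertible.\<close>

definition vanishing :: "('k::field \<Rightarrow> real) \<Rightarrow> ('i \<Rightarrow> 'k) \<Rightarrow> bool" where
  "vanishing nv f \<longleftrightarrow> (\<forall>\<epsilon>>0. finite {i. \<epsilon> \<le> nv (f i)})"

locale complete_dvf =
  fixes nv :: "'k::field_char_0 \<Rightarrow> real" and p :: nat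
  assumes base: "base_field nv p"
begin

lemma nv_ge0 [simp]: "0 \<le> nv a"
  and nv_eq0 [simp]: "nv a = 0 \<longleftrightarrow> a = 0"
  and nv_mult: "nv (a * b) = nv a * nv b"
  and nv_add_max: "nv (a + b) \<le> max (nv a) (nv b)"
  using base unfolding base_field_def nonarch_abs_def by auto

lemma nv_0 [simp]: "nv 0 = 0" by simp

lemma nv_1 [simp]: "nv 1 = 1"
  using nv_mult[of 1 1] nv_eq0[of 1] by simp

lemma nv_minus [simp]: "nv (- a) = nv a"
proof -
  have "nv (-1) * nv (-1) = 1" using nv_mult[of "-1" "-1"] by simp
  hence "nv (-1) = 1"
    by (metis abs_of_nonneg nv_ge0 power2_eq_square real_sqrt_abs real_sqrt_one)
  thus ?thesis using nv_mult[of "-1" a] by simp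
qed

lemma nv_add: "nv a \<le> B \<Longrightarrow> nv b \<le> B \<Longrightarrow> nv (a + b) \<le> B"
  using nv_add_max[of a b] by linarith

lemma nv_diff: "nv a \<le> B \<Longrightarrow> nv b \<le> B \<Longrightarrow> nv (a - b) \<le> B"
  using nv_add[of a B "- b"] by simp

lemma nv_diff_less: "nv a < e \<Longrightarrow> nv b < e \<Longrightarrow> nv (a - b) < e"
  using nv_add_max[of a "- b"] by simp

lemma nv_diff_commute: "nv (a - b) = nv (b - a)"
  by (metis minus_diff_eq nv_minus)

lemma nv_sum: "0 \<le> B \<Longrightarrow> (\<And>i. i \<in> A \<Longrightarrow> nv (f i) \<le> B) \<Longrightarrow> nv (sum f A) \<le> B"
  by (induction A rule: infinite_finite_induct) (auto intro: nv_add)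

lemma nv_power: "nv (a ^ k) = nv a ^ k"
  by (induction k) (auto simp: nv_mult)

lemma nv_inverse: "nv (inverse a) = inverse (nv a)"
proof (cases "a = 0")
  case False
  hence "nv a * nv (inverse a) = 1" using nv_mult[of a "inverse a"] by simp
  thus ?thesis by (metis inverse_unique)
qed simp

lemma nv_divide: "nv (a / b) = nv a / nv b"
  by (simp add: divide_inverse nv_mult nv_inverse)

section \<open>Absolute values of integers\<close>

lemma nv_of_nat_le1: "nv (of_nat k) \<le> 1"
  by (induction k) (auto intro: nv_add)

lemma nv_of_int_le1: "nv (of_int k) \<le> 1"
  by (cases k rule: int_cases2) (auto simp: nv_of_nat_le1)

lemma p_prime: "prime p" and nv_p: "nv (of_nat p) = 1 / real p"
  using base unfolding base_field_def by auto

text \<open>Bezout: 1 = u p + v k, and the first summand has absolute value below 1, so the second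
  has absolute value at least 1.\<close>

lemma nv_of_nat_coprime:
  assumes "\<not> p dvd k" shows "nv (of_nat k) = 1"
proof (rule antisym[OF nv_of_nat_le1])
  have "coprime (int p) (int k)"
    using assms p_prime by (simp add: prime_imp_coprime)
  then obtain u v where uv: "u * int p + v * int k = 1"
    by (metis bezout_int coprime_imp_gcd_eq_1)
  have "1 = nv (of_int (u * int p + v * int k))" unfolding uv by simp
  also have "\<dots> = nv (of_int u * of_nat p + of_int v * of_nat k)" by simp
  also have "\<dots> \<le> max (nv (of_int u * of_nat p)) (nv (of_int v * of_nat k))"
    by (rule nv_add_max)
  finally have 1: "1 \<le> max (nv (of_int u * of_nat p)) (nv (of_int v * of_nat k))" .
  have "p \<ge> 2" using p_prime prime_ge_2_nat by blast
  hence "nv (of_int u * of_nat p) < 1"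
    using nv_of_int_le1[of u] mult_mono[of "nv (of_int u)" 1 "1 / real p" "1 / real p"]
    by (simp add: nv_mult nv_p field_simps)
  hence "1 \<le> nv (of_int v) * nv (of_nat k)" using 1 by (simp add: nv_mult)
  thus "1 \<le> nv (of_nat k)"
    using mult_right_mono[OF nv_of_int_le1[of v] nv_ge0[of "of_nat k"]] by linarith
qed

text \<open>Each factor p divides k by p and, since |p| = 1/p, its absolute value by p as well; the
  remaining factor is prime to p and has absolute value 1. This bound is the source of the exponent
  1 lost in \<open>extension_growth\<close>.\<close>

lemma nv_of_nat_lower:
  "k > 0 \<Longrightarrow> 1 / real k \<le> nv (of_nat k)"
proof (induction k rule: less_induct)
  case (less k)
  show ?case
  proof (cases "p dvd k")
    case True
    then obtain m where m: "k = p * m" by blast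
    have p2: "p \<ge> 2" using p_prime prime_ge_2_nat by blast
    have "m > 0" "m < k" using less.prems m p2 by (auto intro: Suc_lessI)
    hence "1 / real m \<le> nv (of_nat m)" by (rule less.IH[rotated])
    hence "1 / real p * (1 / real m) \<le> 1 / real p * nv (of_nat m)"
      by (rule mult_left_mono) simp
    thus ?thesis by (simp add: m nv_mult nv_p)
  next
    case False
    thus ?thesis using less.prems by (simp add: nv_of_nat_coprime)
  qed
qed

section \<open>Sums over arbitrary index sets\<close>

lemma kHasSum_unique:
  assumes "kHasSum nv f L" "kHasSum nv f L'" shows "L = L'"
proof (rule ccontr)
  assume "L \<noteq> L'"
  define e where "e = nv (L - L')"
  have e: "e > 0" using \<open>L \<noteq> L'\<close> nv_ge0[of "L - L'"] nv_eq0[of "L - L'"]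
    unfolding e_def by (metis eq_iff_diff_eq_0 order_le_less)
  obtain F where F: "finite F" "\<And>H. finite H \<Longrightarrow> F \<subseteq> H \<Longrightarrow> nv (sum f H - L) < e"
    using assms(1) e unfolding kHasSum_def by metis
  obtain F' where F': "finite F'" "\<And>H. finite H \<Longrightarrow> F' \<subseteq> H \<Longrightarrow> nv (sum f H - L') < e"
    using assms(2) e unfolding kHasSum_def by metis
  have a: "nv (sum f (F \<union> F') - L) < e" "nv (sum f (F \<union> F') - L') < e"
    using F F' by auto
  have "nv (L - L') \<le> max (nv (sum f (F \<union> F') - L')) (nv (-(sum f (F \<union> F') - L)))"
    using nv_add_max[of "sum f (F \<union> F') - L'" "-(sum f (F \<union> F') - L)"] by simp
  thus False using a unfolding e_def by (simp del: minus_diff_eq)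
qed

lemma kSum_eqI: "kHasSum nv f L \<Longrightarrow> kSum nv f = L"
  unfolding kSum_def using kHasSum_unique by blast

lemma limit_exists:
  assumes "\<And>\<epsilon>. \<epsilon> > 0 \<Longrightarrow> \<exists>N. \<forall>m\<ge>N. \<forall>n\<ge>N. nv (X m - X n) < \<epsilon>"
  shows "\<exists>L. (\<lambda>n. nv (X n - L)) \<longlonglongrightarrow> 0"
  using base assms unfolding base_field_def nv_complete_def by blast

lemma limit_bound:
  assumes "(\<lambda>n. nv (X n - L)) \<longlonglongrightarrow> 0" "\<And>n. n \<ge> N \<Longrightarrow> nv (X n - a) \<le> B" "0 \<le> B"
  shows "nv (L - a) \<le> B"
proof (rule field_le_epsilon)
  fix e :: real assume "e > 0"
  hence "eventually (\<lambda>n. nv (X n - L) < e) sequentially"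
    using assms(1) by (simp add: order_tendstoD(2))
  then obtain n where n: "n \<ge> N" "nv (X n - L) < e"
    unfolding eventually_sequentially by (meson linorder_le_cases order_trans)
  have "nv ((X n - a) - (X n - L)) \<le> B + e"
    using n assms(2)[OF n(1)] assms(3) \<open>e > 0\<close> by (intro nv_diff[of "X n - a"]) auto
  thus "nv (L - a) \<le> B + e" by simp
qed

lemma kHasSum_tail:
  assumes "kHasSum nv f L" "finite F" "\<And>i. i \<notin> F \<Longrightarrow> nv (f i) \<le> B" "0 \<le> B"
  shows "nv (L - sum f F) \<le> B"
proof (rule field_le_epsilon)
  fix e :: real assume e: "e > 0"
  obtain F' where F': "finite F'" "\<And>H. finite H \<Longrightarrow> F' \<subseteq> H \<Longrightarrow> nv (sum f H - L) < e"
    using assms(1) e unfolding kHasSum_def by metis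
  have a: "nv (sum f (F \<union> F') - L) < e" using F' assms(2) by auto
  have "sum f (F \<union> F') = sum f F + sum f (F' - F)"
    using assms(2) F'(1) by (metis Un_Diff_cancel finite_Diff sum.union_disjoint Diff_disjoint)
  hence eq: "L - sum f F = sum f (F' - F) - (sum f (F \<union> F') - L)" by simp
  have "nv (sum f (F' - F)) \<le> B" using assms(3,4) by (intro nv_sum) auto
  thus "nv (L - sum f F) \<le> B + e"
    unfolding eq using a assms(4) e by (intro nv_diff[of "sum f (F' - F)"]) auto
qed

text \<open>Terms tending to 0 along the cofinite filter suffice for summability. By the ultrametric
  inequality any finite set containing the level set \<open>F N\<close> has its sum within 1/(N+1)
  of the sum over \<open>F N\<close>; this gives both the Cauchy property and convergence along all
  finite sets.\<close>

lemma vanishing_has_kSum: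
  assumes v: "vanishing nv f"
  shows "kHasSum nv f (kSum nv f)"
proof -
  define F where "F n = {i. 1 / real (Suc n) \<le> nv (f i)}" for n
  have fin: "finite (F n)" for n using v unfolding vanishing_def F_def by simp
  have mono: "F m \<subseteq> F n" if "m \<le> n" for m n
  proof -
    have "1 / real (Suc n) \<le> 1 / real (Suc m)" using that by (simp add: frac_le)
    thus ?thesis unfolding F_def by auto
  qed
  have out: "nv (f i) \<le> 1 / real (Suc N)" if "i \<notin> F N" for i N
    using that unfolding F_def by auto
  have split: "nv (sum f H - sum f (F N)) \<le> 1 / real (Suc N)" if "finite H" "F N \<subseteq> H" for H N
  proof -
    have "sum f H - sum f (F N) = sum f (H - F N)" using sum_diff[OF that, of f] by simp
    also have "nv \<dots> \<le> 1 / real (Suc N)" using out by (intro nv_sum) auto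
    finally show ?thesis .
  qed
  have small: "\<exists>N. 1 / real (Suc N) < \<epsilon>" if "\<epsilon> > 0" for \<epsilon>
    using that reals_Archimedean[of \<epsilon>] by (auto simp: inverse_eq_divide)
  obtain L where L: "(\<lambda>n. nv (sum f (F n) - L)) \<longlonglongrightarrow> 0"
  proof -
    have "\<exists>N. \<forall>m\<ge>N. \<forall>n\<ge>N. nv (sum f (F m) - sum f (F n)) < \<epsilon>" if e: "\<epsilon> > 0" for \<epsilon>
    proof -
      obtain N where N: "1 / real (Suc N) < \<epsilon>" using small[OF e] by blast
      have "nv (sum f (F m) - sum f (F n)) < \<epsilon>" if "m \<ge> N" "n \<ge> N" for m n
      proof -
        have "nv ((sum f (F m) - sum f (F N)) - (sum f (F n) - sum f (F N))) \<le> 1 / real (Suc N)"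
          using that by (intro nv_diff split fin mono)
        thus ?thesis using N by simp
      qed
      thus ?thesis by blast
    qed
    from limit_exists[OF this] that show ?thesis by blast
  qed
  have "kHasSum nv f L" unfolding kHasSum_def
  proof (intro allI impI)
    fix e :: real assume "e > 0"
    then obtain N where N: "1 / real (Suc N) < e" using small by blast
    have LN: "nv (L - sum f (F N)) \<le> 1 / real (Suc N)"
      by (rule limit_bound[OF L, of N]) (auto intro!: split fin mono simp del: of_nat_Suc)
    have "nv (sum f H - L) < e" if "finite H" "F N \<subseteq> H" for H
    proof -
      have "nv ((sum f H - sum f (F N)) - (L - sum f (F N))) \<le> 1 / real (Suc N)"
        using that by (intro nv_diff split LN)
      thus ?thesis using N by simp
    qed
    thus "\<exists>F0. finite F0 \<and> (\<forall>F. finite F \<and> F0 \<subseteq> F \<longrightarrow> nv (sum f F - L) < e)"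
      using fin by blast
  qed
  thus ?thesis using kSum_eqI[of f L] by simp
qed

lemma kSum_tail:
  assumes "vanishing nv f" "finite F" "\<And>i. i \<notin> F \<Longrightarrow> nv (f i) \<le> B" "0 \<le> B"
  shows "nv (kSum nv f - sum f F) \<le> B"
  using kHasSum_tail[OF vanishing_has_kSum] assms by blast

lemma kSum_bound:
  assumes "vanishing nv f" "\<And>i. nv (f i) \<le> B"
  shows "nv (kSum nv f) \<le> B"
  using kSum_tail[OF assms(1), of "{}" B] assms(2) order_trans[OF nv_ge0 assms(2)] by auto

lemma kHasSumI:
  assumes "\<And>\<epsilon>. \<epsilon> > 0 \<Longrightarrow> \<exists>F0. finite F0 \<and> (\<forall>F. finite F \<and> F0 \<subseteq> F \<longrightarrow> nv (sum f F - L) \<le> \<epsilon>)"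
  shows "kHasSum nv f L"
  unfolding kHasSum_def
proof (intro allI impI)
  fix e :: real assume "e > 0"
  then obtain F0 where "finite F0" "\<forall>F. finite F \<and> F0 \<subseteq> F \<longrightarrow> nv (sum f F - L) \<le> e / 2"
    using assms[of "e / 2"] by auto
  moreover have "e / 2 < e" using \<open>e > 0\<close> by simp
  ultimately show "\<exists>F0. finite F0 \<and> (\<forall>F. finite F \<and> F0 \<subseteq> F \<longrightarrow> nv (sum f F - L) < e)"
    by (meson le_less_trans)
qed

lemma kSum_add:
  assumes "vanishing nv f" "vanishing nv g"
  shows "kSum nv (\<lambda>i. f i + g i) = kSum nv f + kSum nv g"
proof (rule kSum_eqI, rule kHasSumI)
  fix e :: real assume e: "e > 0"
  obtain F where F: "finite F" "\<And>H. finite H \<Longrightarrow> F \<subseteq> H \<Longrightarrow> nv (sum f H - kSum nv f) < e"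
    using vanishing_has_kSum[OF assms(1)] e unfolding kHasSum_def by metis
  obtain F' where F': "finite F'" "\<And>H. finite H \<Longrightarrow> F' \<subseteq> H \<Longrightarrow> nv (sum g H - kSum nv g) < e"
    using vanishing_has_kSum[OF assms(2)] e unfolding kHasSum_def by metis
  have "nv (sum (\<lambda>i. f i + g i) H - (kSum nv f + kSum nv g)) \<le> e"
    if "finite H" "F \<union> F' \<subseteq> H" for H
  proof -
    have "sum (\<lambda>i. f i + g i) H - (kSum nv f + kSum nv g)
       = (sum f H - kSum nv f) + (sum g H - kSum nv g)" by (simp add: sum.distrib)
    also have "nv \<dots> \<le> e" using F(2)[of H] F'(2)[of H] that by (intro nv_add) (auto intro: less_imp_le)
    finally show ?thesis .
  qed
  thus "\<exists>F0. finite F0 \<and> (\<forall>F. finite F \<and> F0 \<subseteq> F \<longrightarrow>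
      nv (sum (\<lambda>i. f i + g i) F - (kSum nv f + kSum nv g)) \<le> e)"
    using F(1) F'(1) by (intro exI[of _ "F \<union> F'"]) auto
qed

lemma kHasSum_cmult:
  assumes "kHasSum nv f L" shows "kHasSum nv (\<lambda>i. c * f i) (c * L)"
proof (rule kHasSumI)
  fix e :: real assume e: "e > 0"
  have pos: "e / (nv c + 1) > 0" using e nv_ge0[of c] by (simp add: add_nonneg_pos)
  obtain F where F: "finite F" "\<And>H. finite H \<Longrightarrow> F \<subseteq> H \<Longrightarrow> nv (sum f H - L) < e / (nv c + 1)"
    using assms pos unfolding kHasSum_def by metis
  have "nv (sum (\<lambda>i. c * f i) H - c * L) \<le> e" if "finite H" "F \<subseteq> H" for H
  proof -
    have "nv (sum (\<lambda>i. c * f i) H - c * L) = nv c * nv (sum f H - L)"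
      by (simp add: sum_distrib_left[symmetric] right_diff_distrib[symmetric] nv_mult)
    also have "\<dots> \<le> nv c * (e / (nv c + 1))"
      using F(2)[OF that] by (intro mult_left_mono) auto
    also have "\<dots> \<le> e" using e nv_ge0[of c]
      by (simp add: divide_simps add_nonneg_pos)
    finally show ?thesis .
  qed
  thus "\<exists>F0. finite F0 \<and> (\<forall>F. finite F \<and> F0 \<subseteq> F \<longrightarrow> nv (sum (\<lambda>i. c * f i) F - c * L) \<le> e)"
    using F(1) by blast
qed

lemma kSum_cmult:
  "vanishing nv f \<Longrightarrow> kSum nv (\<lambda>i. c * f i) = c * kSum nv f"
  by (rule kSum_eqI[OF kHasSum_cmult[OF vanishing_has_kSum]])

lemma kHasSum_finite:
  assumes "finite F" "\<And>i. i \<notin> F \<Longrightarrow> f i = 0"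
  shows "kHasSum nv f (sum f F)"
proof (rule kHasSumI)
  fix e :: real assume "e > 0"
  have "sum f H = sum f F" if "finite H" "F \<subseteq> H" for H
    using that assms by (intro sum.mono_neutral_right) auto
  hence "nv (sum f H - sum f F) \<le> e" if "finite H" "F \<subseteq> H" for H
    using \<open>e > 0\<close> that by (metis diff_self less_imp_le nv_0)
  thus "\<exists>F0. finite F0 \<and> (\<forall>H. finite H \<and> F0 \<subseteq> H \<longrightarrow> nv (sum f H - sum f F) \<le> e)"
    using assms(1) by blast
qed

lemma kSum_finite:
  "finite F \<Longrightarrow> (\<And>i. i \<notin> F \<Longrightarrow> f i = 0) \<Longrightarrow> kSum nv f = sum f F"
  by (rule kSum_eqI[OF kHasSum_finite])

lemma kSum_single: "(\<And>i. i \<noteq> j \<Longrightarrow> f i = 0) \<Longrightarrow> kSum nv f = f j"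
  using kSum_finite[of "{j}" f] by simp

lemma kSum_0 [simp]: "kSum nv (\<lambda>i. 0) = 0"
  using kSum_finite[of "{}" "\<lambda>i. 0"] by simp

lemma vanishing_reindex:
  assumes "vanishing nv f" "inj h" shows "vanishing nv (\<lambda>i. f (h i))"
  unfolding vanishing_def
proof (intro allI impI)
  fix e :: real assume "e > 0"
  hence "finite (h -` {i. e \<le> nv (f i)})"
    using assms unfolding vanishing_def by (blast intro: finite_vimageI)
  thus "finite {i. e \<le> nv (f (h i))}" by (simp add: vimage_def)
qed

lemma kSum_reindex:
  assumes "vanishing nv f" "bij h" shows "kSum nv (\<lambda>i. f (h i)) = kSum nv f"
proof (rule kSum_eqI, rule kHasSumI)
  fix e :: real assume e: "e > 0"
  obtain F where F: "finite F" "\<And>H. finite H \<Longrightarrow> F \<subseteq> H \<Longrightarrow> nv (sum f H - kSum nv f) < e"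
    using vanishing_has_kSum[OF assms(1)] e unfolding kHasSum_def by metis
  have inj: "inj h" and surj: "surj h" using assms(2) by (auto simp: bij_def)
  have "nv (sum (\<lambda>i. f (h i)) H - kSum nv f) \<le> e" if "finite H" "h -` F \<subseteq> H" for H
  proof -
    have "sum (\<lambda>i. f (h i)) H = sum f (h ` H)"
      using inj by (simp add: sum.reindex inj_on_subset)
    moreover have "F \<subseteq> h ` H" using that(2) surj by (metis image_mono surj_image_vimage_eq)
    ultimately show ?thesis using F(2)[of "h ` H"] that by simp
  qed
  thus "\<exists>F0. finite F0 \<and> (\<forall>H. finite H \<and> F0 \<subseteq> H \<longrightarrow> nv (sum (\<lambda>i. f (h i)) H - kSum nv f) \<le> e)"
    using F(1) inj by (intro exI[of _ "h -` F"]) (auto intro: finite_vimageI)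
qed

text \<open>Outside a finite set \<open>F\<close> of pairs all terms are at most e. In each row the
  error against the slice of \<open>F\<close> is at most e, and the ultrametric inequality keeps the
  total error at e however many rows are added.\<close>

lemma kSum_Fubini:
  assumes v: "vanishing nv f"
  shows "kSum nv (\<lambda>i. kSum nv (\<lambda>j. f (i, j))) = kSum nv f"
proof (rule kSum_eqI, rule kHasSumI)
  fix e :: real assume e: "e > 0"
  define F where "F = {x. e \<le> nv (f x)}"
  have F: "finite F" using v e unfolding vanishing_def F_def by blast
  have out: "nv (f x) \<le> e" if "x \<notin> F" for x using that unfolding F_def by auto
  have vi: "vanishing nv (\<lambda>j. f (i, j))" for i
    using vanishing_reindex[OF v, of "\<lambda>j. (i, j)"] by (auto simp: inj_def)
  have t: "nv (kSum nv f - sum f F) \<le> e" using kSum_tail[OF v F out] e by simp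
  have "nv ((\<Sum>i\<in>I. kSum nv (\<lambda>j. f (i, j))) - kSum nv f) \<le> e"
    if I: "finite I" "fst ` F \<subseteq> I" for I
  proof -
    define S where "S i = snd ` {x\<in>F. fst x = i}" for i
    have finS: "finite (S i)" for i unfolding S_def using F by auto
    have inS: "j \<in> S i \<longleftrightarrow> (i, j) \<in> F" for i j unfolding S_def by force
    have "F = Sigma I S"
    proof (rule set_eqI)
      fix x show "x \<in> F \<longleftrightarrow> x \<in> Sigma I S"
        using I(2) by (cases x) (force simp: inS)
    qed
    hence "sum f F = (\<Sum>i\<in>I. \<Sum>j\<in>S i. f (i, j))"
      using I(1) finS by (simp add: sum.Sigma)
    hence eq: "(\<Sum>i\<in>I. kSum nv (\<lambda>j. f (i, j))) - kSum nv f
      = (\<Sum>i\<in>I. kSum nv (\<lambda>j. f (i, j)) - (\<Sum>j\<in>S i. f (i, j))) - (kSum nv f - sum f F)"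
      by (simp add: sum_subtractf)
    have "nv (kSum nv (\<lambda>j. f (i, j)) - (\<Sum>j\<in>S i. f (i, j))) \<le> e" for i
      using e by (intro kSum_tail vi finS out) (auto simp: inS)
    thus ?thesis unfolding eq using e by (intro nv_diff[OF nv_sum t]) auto
  qed
  thus "\<exists>F0. finite F0 \<and> (\<forall>I. finite I \<and> F0 \<subseteq> I \<longrightarrow>
      nv ((\<Sum>i\<in>I. kSum nv (\<lambda>j. f (i, j))) - kSum nv f) \<le> e)"
    using F by (intro exI[of _ "fst ` F"]) auto
qed

lemma kSum_swap:
  assumes v: "vanishing nv (\<lambda>(i, j). f i j)"
  shows "kSum nv (\<lambda>i. kSum nv (\<lambda>j. f i j)) = kSum nv (\<lambda>j. kSum nv (\<lambda>i. f i j))"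
proof -
  have b: "bij prod.swap" by (simp add: bij_def)
  have v': "vanishing nv (\<lambda>x. (\<lambda>(i, j). f i j) (prod.swap x))"
    using vanishing_reindex[OF v, of prod.swap] b by (simp add: bij_def)
  have "kSum nv (\<lambda>j. kSum nv (\<lambda>i. f i j)) = kSum nv (\<lambda>x. (\<lambda>(i, j). f i j) (prod.swap x))"
    using kSum_Fubini[OF v'] by simp
  also have "\<dots> = kSum nv (\<lambda>(i, j). f i j)" by (rule kSum_reindex[OF v b])
  finally show ?thesis using kSum_Fubini[OF v] by simp
qed

end

section \<open>The field of bounded Laurent series\<close>

text \<open>Products and Frobenius are defined by sums of families and obey the usual laws only on
  elements of E; hence additivity is assumed only on a domain \<open>P\<close>.\<close>

lemma sum_hom:
  fixes f :: "'i \<Rightarrow> 'a::comm_monoid_add" and h :: "'a \<Rightarrow> 'b::comm_monoid_add"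
  assumes "P 0" "\<And>a b. P a \<Longrightarrow> P b \<Longrightarrow> P (a + b)" "h 0 = 0"
    "\<And>a b. P a \<Longrightarrow> P b \<Longrightarrow> h (a + b) = h a + h b" "\<And>x. x \<in> A \<Longrightarrow> P (f x)"
  shows "P (sum f A)" "h (sum f A) = (\<Sum>x\<in>A. h (f x))"
proof -
  have "P (sum f A) \<and> h (sum f A) = (\<Sum>x\<in>A. h (f x))"
    using assms(5) by (induction A rule: infinite_finite_induct) (auto simp: assms(1-4))
  thus "P (sum f A)" "h (sum f A) = (\<Sum>x\<in>A. h (f x))" by auto
qed

text \<open>Unification may eta-expand coefficient functions, and the simplifier then works pointwise under
  the abstraction; these rules restore the operations on functions.\<close>
lemma lau_fold:
  fixes f g :: "'k::field lau"
  shows "(\<lambda>a::int. 0::'k) = 0" "(\<lambda>a. f a + g a) = f + g" "(\<lambda>a. f a - g a) = f - g" "(\<lambda>a. - f a) = - f"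
  by (auto simp: fun_eq_iff)

definition ksc :: "'k::field \<Rightarrow> 'k lau \<Rightarrow> 'k lau" where
  "ksc c a = (\<lambda>i. c * a i)"

lemma ksc_simps [simp]:
  "ksc 0 a = 0" "ksc 1 a = a" "ksc c 0 = 0" "ksc c (ksc d a) = ksc (c * d) a"
  by (auto simp: ksc_def fun_eq_iff)

lemma ksc_add: "ksc c (a + b) = ksc c a + ksc c b" "ksc (c + d) a = ksc c a + ksc d a"
  by (auto simp: ksc_def fun_eq_iff algebra_simps)

lemma ksc_minus: "ksc c (- a) = - ksc c a" "ksc (- c) a = - ksc c a"
  by (auto simp: ksc_def fun_eq_iff)

lemma fun_sum_apply: "(sum f A) i = (\<Sum>x\<in>A. f x i)"
  by (induction A rule: infinite_finite_induct) auto

lemma ksc_sum: "ksc c (sum f A) = (\<Sum>x\<in>A. ksc c (f x))"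
  by (auto simp: ksc_def fun_eq_iff fun_sum_apply sum_distrib_left)

lemma ksc_cancel: "c \<noteq> 0 \<Longrightarrow> ksc c a = ksc c b \<longleftrightarrow> a = b"
  by (auto simp: ksc_def fun_eq_iff)

lemma ederiv_add: "ederiv (a + b) = ederiv a + ederiv b"
  and ederiv_diff: "ederiv (a - b) = ederiv a - ederiv b"
  and ederiv_ksc: "ederiv (ksc c a) = ksc c (ederiv a)"
  and ederiv_0 [simp]: "ederiv 0 = 0"
  by (auto simp: ederiv_def ksc_def fun_eq_iff algebra_simps)

lemma ederiv_sum: "ederiv (sum f A) = (\<Sum>x\<in>A. ederiv (f x))"
  using sum_hom(2)[of "\<lambda>_. True" ederiv A f] by (simp add: ederiv_add)

lemma ederiv_eone [simp]: "ederiv (eone :: 'k::field lau) = 0"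
proof
  fix n
  show "ederiv (eone :: 'k lau) n = 0 n"
    unfolding ederiv_def eone_def by (cases "n + 1 = 0") (simp_all only: of_int_0, simp_all)
qed

lemma tau_0 [simp]: "tau a 0 = a"
  by (simp add: tau_def)

lemma ederiv_tau: "ederiv (tau a m) = ksc (of_nat (Suc m)) (tau a (Suc m))"
proof
  fix j
  have "of_nat (Suc m) * (x / (of_nat (Suc m) * y)) = x / y" for x y :: 'a
    using of_nat_neq_0[of m, where 'a = 'a]
    by (metis mult_divide_mult_cancel_left times_divide_eq_right)
  thus "ederiv (tau a m) j = ksc (of_nat (Suc m)) (tau a (Suc m)) j"
    by (simp add: ederiv_def tau_def ksc_def del: of_nat_Suc)
qed

text \<open>The factor is (j+1)...(j+m) / m!, a binomial coefficient. Divided derivatives therefore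
  do not increase the Gauss norm in spite of the division by m!.\<close>

lemma tau_coeff: "\<exists>z::int. tau a m j = of_int z * a (j + int m)"
proof -
  have "(ederiv ^^ m) a j = pochhammer (of_int (j + 1)) m * a (j + int m)" for j
    by (induction m arbitrary: j) (simp_all add: ederiv_def pochhammer_rec algebra_simps)
  moreover have "(fact m :: int) dvd pochhammer (j + 1) m"
    by (rule fact_dvd_pochhammer)
  then obtain z where "pochhammer (j + 1) m = fact m * z" by auto
  hence "(pochhammer (of_int (j + 1)) m :: 'a) = of_nat (fact m) * of_int z"
    by (metis of_int_mult of_int_fact of_nat_fact pochhammer_of_int)
  ultimately show ?thesis by (auto simp: tau_def)
qed

context complete_dvf
begin

section \<open>The Gauss norm and the product of series\<close>

abbreviation gn :: "'k lau \<Rightarrow> real" where "gn \<equiv> gnorm nv"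

abbreviation emult :: "'k lau \<Rightarrow> 'k lau \<Rightarrow> 'k lau"  (infixl "\<odot>" 70)
  where "a \<odot> b \<equiv> emul nv a b"

lemma inE_iff:
  "inE nv a \<longleftrightarrow> (\<exists>B. \<forall>i. nv (a i) \<le> B) \<and> (\<forall>\<epsilon>>0. \<exists>c. \<forall>i<c. nv (a i) < \<epsilon>)"
proof -
  have "((\<lambda>i. nv (a i)) \<longlongrightarrow> 0) at_bot \<longleftrightarrow> (\<forall>\<epsilon>>0. \<exists>c. \<forall>i<c. nv (a i) < \<epsilon>)"
    unfolding tendsto_iff eventually_at_bot_dense by simp
  thus ?thesis unfolding inE_def bdd_above_def by auto
qed

lemma inEI:
  assumes "\<And>i. nv (a i) \<le> B" "\<And>\<epsilon>. \<epsilon> > 0 \<Longrightarrow> \<exists>c. \<forall>i<c. nv (a i) < \<epsilon>"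
  shows "inE nv a"
  using assms unfolding inE_iff by blast

lemma inE_tail: "inE nv a \<Longrightarrow> \<epsilon> > 0 \<Longrightarrow> \<exists>c. \<forall>i<c. nv (a i) < \<epsilon>"
  unfolding inE_iff by blast

lemma nv_le_gn: "inE nv a \<Longrightarrow> nv (a i) \<le> gn a"
  unfolding inE_def gnorm_def by (auto intro: cSUP_upper)

lemma gn_le: "(\<And>i. nv (a i) \<le> B) \<Longrightarrow> gn a \<le> B"
  unfolding gnorm_def by (rule cSUP_least) auto

lemma gn_ge0 [simp]: "inE nv a \<Longrightarrow> 0 \<le> gn a"
  using order_trans[OF nv_ge0 nv_le_gn] by blast

lemma gn_0 [simp]: "gn 0 = 0"
  by (simp add: gnorm_def)

lemma gn_eq0: "inE nv a \<Longrightarrow> gn a = 0 \<Longrightarrow> a = 0"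
  using nv_le_gn[of a] by (metis antisym ext nv_eq0 nv_ge0 zero_fun_apply)

lemma inE_0 [simp]: "inE nv 0"
  by (rule inEI[of _ 0]) auto

text \<open>The shift \<open>k\<close> lets one criterion serve scalar multiples, truncations,
  derivatives and divided derivatives.\<close>

lemma inE_mono:
  assumes "inE nv a" "\<And>i. nv (b i) \<le> C * nv (a (i + k))"
  shows "inE nv b"
proof (rule inEI)
  define C' where "C' = max C 1"
  have C': "nv (b i) \<le> C' * nv (a (i + k))" "C' > 0" for i
    using assms(2)[of i] mult_right_mono[of C C' "nv (a (i + k))"] unfolding C'_def by auto
  show "nv (b i) \<le> C' * gn a" for i
    using C'(1)[of i] mult_left_mono[OF nv_le_gn[OF assms(1), of "i + k"], of C'] C'(2) by linarith
  fix e :: real assume "e > 0"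
  then obtain c where c: "\<forall>i<c. nv (a i) < e / C'"
    using inE_tail[OF assms(1), of "e / C'"] C'(2) by auto
  have "nv (b i) < e" if "i < c - k" for i
  proof -
    have "C' * nv (a (i + k)) < e" using c that C'(2) by (simp add: field_simps)
    thus ?thesis using C'(1)[of i] by linarith
  qed
  thus "\<exists>c. \<forall>i<c. nv (b i) < e" by blast
qed

lemma inE_add [simp]: assumes "inE nv a" "inE nv b" shows "inE nv (a + b)"
proof (rule inEI)
  show "nv ((a + b) i) \<le> max (gn a) (gn b)" for i
    using nv_le_gn[OF assms(1), of i] nv_le_gn[OF assms(2), of i]
    by (auto intro: nv_add)
  fix e :: real assume "e > 0"
  then obtain c d where "\<forall>i<c. nv (a i) < e" "\<forall>i<d. nv (b i) < e"
    using inE_tail assms by meson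
  hence "\<forall>i<min c d. nv ((a + b) i) < e"
    by (auto intro!: le_less_trans[OF nv_add_max])
  thus "\<exists>c. \<forall>i<c. nv ((a + b) i) < e" by blast
qed

lemma inE_minus [simp]: "inE nv a \<Longrightarrow> inE nv (- a)"
  by (rule inE_mono[of a _ 1 0]) auto

lemma inE_diff [simp]: "inE nv a \<Longrightarrow> inE nv b \<Longrightarrow> inE nv (a - b)"
  using inE_add[of a "- b"] by simp

lemma inE_ksc [simp]: "inE nv a \<Longrightarrow> inE nv (ksc c a)"
  by (rule inE_mono[of a _ "nv c" 0]) (auto simp: ksc_def nv_mult)

lemma inE_sum [simp]: "(\<And>x. x \<in> A \<Longrightarrow> inE nv (f x)) \<Longrightarrow> inE nv (sum f A)"
  by (induction A rule: infinite_finite_induct) auto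

lemma inE_sum_less [simp]: "(\<And>i. i < m \<Longrightarrow> inE nv (f i)) \<Longrightarrow> inE nv (sum f {..<m::nat})"
  by (rule inE_sum) auto

lemma inE_finite_support:
  assumes "\<And>i. i \<notin> F \<Longrightarrow> a i = 0" "finite F" shows "inE nv a"
proof (rule inEI)
  show "nv (a i) \<le> (\<Sum>i\<in>F. nv (a i))" for i
    using assms by (cases "i \<in> F") (auto intro: member_le_sum sum_nonneg)
  fix e :: real assume "e > 0"
  have "a i = 0" if "i < Min (insert 0 F)" for i
    using assms that Min_le[of "insert 0 F" i] by force
  thus "\<exists>c. \<forall>i<c. nv (a i) < e" using \<open>e > 0\<close> by force
qed

lemma inE_eone [simp]: "inE nv eone"
  by (rule inE_finite_support[of "{0}"]) (simp_all add: eone_def)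

lemma gn_eone [simp]: "gn eone = 1"
  by (rule antisym, rule gn_le) (use nv_le_gn[OF inE_eone, of 0] in \<open>auto simp: eone_def\<close>)

lemma eone_neq0 [simp]: "(eone :: 'k lau) \<noteq> 0"
  by (auto simp: eone_def fun_eq_iff)

lemma gn_ksc [simp]: assumes "inE nv a" shows "gn (ksc c a) = nv c * gn a"
proof (cases "c = 0")
  case False
  have 1: "gn (ksc c a) \<le> nv c * gn a" if "inE nv a" for c a
    using that by (intro gn_le) (auto simp: ksc_def nv_mult mult_left_mono nv_le_gn)
  have pos: "nv c > 0" using False by (metis nv_eq0 nv_ge0 order_le_less)
  have "gn (ksc (inverse c) (ksc c a)) \<le> nv (inverse c) * gn (ksc c a)"
    using assms by (intro 1) auto
  moreover have "inverse c * c = 1" using False by simp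
  ultimately have "gn a \<le> inverse (nv c) * gn (ksc c a)"
    by (simp only: nv_inverse ksc_simps)
  hence "nv c * gn a \<le> gn (ksc c a)" using pos by (simp add: field_simps)
  thus ?thesis using 1[OF assms, of c] by simp
qed auto

lemma gn_minus [simp]: "gn (- a) = gn a"
  by (simp add: gnorm_def)

lemma gn_add:
  assumes "inE nv a" "inE nv b" "gn a \<le> B" "gn b \<le> B" shows "gn (a + b) \<le> B"
  using order_trans[OF nv_le_gn[OF assms(1)] assms(3)] order_trans[OF nv_le_gn[OF assms(2)] assms(4)]
  by (intro gn_le) (auto intro!: nv_add)

lemma gn_diff:
  assumes "inE nv a" "inE nv b" "gn a \<le> B" "gn b \<le> B" shows "gn (a - b) \<le> B"
  using gn_add[of a "- b" B] assms by simp

lemma gn_sum: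
  "0 \<le> B \<Longrightarrow> (\<And>x. x \<in> A \<Longrightarrow> inE nv (f x)) \<Longrightarrow> (\<And>x. x \<in> A \<Longrightarrow> gn (f x) \<le> B) \<Longrightarrow> gn (sum f A) \<le> B"
  by (induction A rule: infinite_finite_induct) (auto intro: gn_add)

text \<open>Far to the left a coefficient is small and the other factor is bounded by its Gauss
  norm. For fixed i + j the two lower bounds leave finitely many pairs, which makes Cauchy products
  summable.\<close>

lemma coeff_prod_tail:
  assumes a: "inE nv a" and b: "inE nv b" and e: "\<epsilon> > 0"
  obtains c where "\<And>i j. \<epsilon> \<le> nv (a i) * nv (b j) \<Longrightarrow> i \<ge> c \<and> j \<ge> c"
proof -
  have pos: "\<epsilon> / (gn a + 1) > 0" "\<epsilon> / (gn b + 1) > 0"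
    using e gn_ge0[OF a] gn_ge0[OF b] by (auto simp: add_nonneg_pos)
  obtain c where c: "\<forall>i<c. nv (a i) < \<epsilon> / (gn b + 1)" using inE_tail[OF a pos(2)] by blast
  obtain d where d: "\<forall>i<d. nv (b i) < \<epsilon> / (gn a + 1)" using inE_tail[OF b pos(1)] by blast
  have "i \<ge> min c d \<and> j \<ge> min c d" if le: "\<epsilon> \<le> nv (a i) * nv (b j)" for i j
  proof (rule ccontr)
    assume "\<not> (i \<ge> min c d \<and> j \<ge> min c d)"
    hence "i < c \<or> j < d" by auto
    thus False
    proof
      assume "i < c"
      hence "nv (a i) * (gn b + 1) < \<epsilon>"
        using c gn_ge0[OF b] by (simp add: pos_less_divide_eq add_nonneg_pos)
      moreover have "nv (a i) * nv (b j) \<le> nv (a i) * (gn b + 1)"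
        using nv_le_gn[OF b, of j] by (intro mult_left_mono) auto
      ultimately show False using le by linarith
    next
      assume "j < d"
      hence "nv (b j) * (gn a + 1) < \<epsilon>"
        using d gn_ge0[OF a] by (simp add: pos_less_divide_eq add_nonneg_pos)
      moreover have "nv (b j) * nv (a i) \<le> nv (b j) * (gn a + 1)"
        using nv_le_gn[OF a, of i] by (intro mult_left_mono) auto
      ultimately show False using le by (simp add: mult.commute)
    qed
  qed
  thus ?thesis using that by blast
qed

lemma emul_vanishing:
  assumes "inE nv a" "inE nv b" shows "vanishing nv (\<lambda>i. a i * b (n - i))"
  unfolding vanishing_def
proof (intro allI impI)
  fix e :: real assume "e > 0"
  then obtain c where c: "\<And>i j. e \<le> nv (a i) * nv (b j) \<Longrightarrow> i \<ge> c \<and> j \<ge> c"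
    using coeff_prod_tail assms by metis
  hence "{i. e \<le> nv (a i * b (n - i))} \<subseteq> {c..n - c}"
    by (auto simp: nv_mult) (smt (verit))
  thus "finite {i. e \<le> nv (a i * b (n - i))}" by (rule finite_subset) simp
qed

lemma inE_emul [simp]: "inE nv a \<Longrightarrow> inE nv b \<Longrightarrow> inE nv (a \<odot> b)"
  and gn_emul_le: "inE nv a \<Longrightarrow> inE nv b \<Longrightarrow> gn (a \<odot> b) \<le> gn a * gn b"
proof -
  assume ab: "inE nv a" "inE nv b"
  have bd: "nv ((a \<odot> b) n) \<le> gn a * gn b" for n
    unfolding emul_def using ab
    by (intro kSum_bound emul_vanishing) (auto simp: nv_mult intro!: mult_mono nv_le_gn)
  thus "gn (a \<odot> b) \<le> gn a * gn b" by (rule gn_le)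
  show "inE nv (a \<odot> b)"
  proof (rule inEI[OF bd])
    fix e :: real assume e: "e > 0"
    hence "e / 2 > 0" by simp
    then obtain c where c: "\<And>i j. e / 2 \<le> nv (a i) * nv (b j) \<Longrightarrow> i \<ge> c \<and> j \<ge> c"
      using coeff_prod_tail ab by metis
    \<comment> \<open>Two indices whose sum is below 2c cannot both be at least c.\<close>
    have "nv ((a \<odot> b) n) < e" if "n < 2 * c" for n
    proof -
      have "nv (a i * b (n - i)) \<le> e / 2" for i
        using c[of i "n - i"] that unfolding nv_mult by linarith
      hence "nv ((a \<odot> b) n) \<le> e / 2"
        unfolding emul_def using ab by (intro kSum_bound emul_vanishing)
      thus ?thesis using e by simp
    qed
    thus "\<exists>c. \<forall>i<c. nv ((a \<odot> b) i) < e" by blast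
  qed
qed

lemma gn_emul_bound:
  assumes "inE nv a" "inE nv b" "gn a \<le> A" "gn b \<le> B" shows "gn (a \<odot> b) \<le> A * B"
  using gn_emul_le[OF assms(1,2)] mult_mono[OF assms(3,4)] gn_ge0[OF assms(1)] gn_ge0[OF assms(2)]
    assms(3) by linarith

lemma emul_comm: assumes "inE nv a" "inE nv b" shows "a \<odot> b = b \<odot> a"
proof
  fix n
  have "kSum nv (\<lambda>i. b (n - i) * a (n - (n - i))) = kSum nv (\<lambda>i. b i * a (n - i))"
    by (rule kSum_reindex[OF emul_vanishing[OF assms(2,1)]])
       (auto intro: bij_betw_byWitness[where f' = "\<lambda>i. n - i"])
  thus "(a \<odot> b) n = (b \<odot> a) n" by (simp add: emul_def mult.commute)
qed

lemma emul_add_left: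
  "inE nv a \<Longrightarrow> inE nv b \<Longrightarrow> inE nv c \<Longrightarrow> (a + b) \<odot> c = a \<odot> c + b \<odot> c"
  by (auto simp: emul_def fun_eq_iff distrib_right intro!: kSum_add emul_vanishing)

lemma emul_ksc_left: "inE nv a \<Longrightarrow> inE nv b \<Longrightarrow> ksc c a \<odot> b = ksc c (a \<odot> b)"
  using kSum_cmult[OF emul_vanishing] by (auto simp: emul_def ksc_def fun_eq_iff mult.assoc)

lemma emul_ksc_right: "inE nv a \<Longrightarrow> inE nv b \<Longrightarrow> a \<odot> ksc c b = ksc c (a \<odot> b)"
  by (metis emul_comm emul_ksc_left inE_ksc)

lemma emul_add_right:
  "inE nv a \<Longrightarrow> inE nv b \<Longrightarrow> inE nv c \<Longrightarrow> a \<odot> (b + c) = a \<odot> b + a \<odot> c"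
  by (metis emul_comm emul_add_left inE_add)

lemma emul_0_left [simp]: "0 \<odot> a = 0" and emul_0_right [simp]: "a \<odot> 0 = 0"
  by (auto simp: emul_def fun_eq_iff)

lemma emul_minus_left: "inE nv a \<Longrightarrow> inE nv b \<Longrightarrow> (- a) \<odot> b = - (a \<odot> b)"
  using emul_ksc_left[of a b "-1"] by (simp add: ksc_minus)

lemma emul_minus_right: "inE nv a \<Longrightarrow> inE nv b \<Longrightarrow> a \<odot> (- b) = - (a \<odot> b)"
  using emul_ksc_right[of a b "-1"] by (simp add: ksc_minus)

lemma emul_diff_left:
  "inE nv a \<Longrightarrow> inE nv b \<Longrightarrow> inE nv c \<Longrightarrow> (a - b) \<odot> c = a \<odot> c - b \<odot> c"
  using emul_add_left[of a "- b" c] by (simp add: emul_minus_left)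

lemma emul_diff_right:
  "inE nv a \<Longrightarrow> inE nv b \<Longrightarrow> inE nv c \<Longrightarrow> a \<odot> (b - c) = a \<odot> b - a \<odot> c"
  using emul_add_right[of a b "- c"] by (simp add: emul_minus_right)

lemma emul_sum_left:
  "(\<And>x. x \<in> A \<Longrightarrow> inE nv (f x)) \<Longrightarrow> inE nv b \<Longrightarrow> sum f A \<odot> b = (\<Sum>x\<in>A. f x \<odot> b)"
  by (induction A rule: infinite_finite_induct) (auto simp: emul_add_left)

lemma emul_sum_right:
  "inE nv b \<Longrightarrow> (\<And>x. x \<in> A \<Longrightarrow> inE nv (f x)) \<Longrightarrow> b \<odot> sum f A = (\<Sum>x\<in>A. b \<odot> f x)"
  by (induction A rule: infinite_finite_induct) (auto simp: emul_add_right)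

lemma emul_sum_right_less:
  "inE nv b \<Longrightarrow> (\<And>i. i < m \<Longrightarrow> inE nv (f i)) \<Longrightarrow> b \<odot> sum f {..<m::nat} = (\<Sum>i<m. b \<odot> f i)"
  by (rule emul_sum_right) auto

lemma emul_eone_left [simp]: "eone \<odot> a = a"
proof
  fix n show "(eone \<odot> a) n = a n"
    unfolding emul_def using kSum_single[of 0 "\<lambda>i. eone i * a (n - i)"] by (simp add: eone_def)
qed

lemma emul_eone_right [simp]: "a \<odot> eone = a"
proof
  fix n show "(a \<odot> eone) n = a n"
    unfolding emul_def using kSum_single[of n "\<lambda>i. a i * eone (n - i)"] by (simp add: eone_def)
qed

lemma emul_assoc:
  assumes a: "inE nv a" and b: "inE nv b" and c: "inE nv c"
  shows "(a \<odot> b) \<odot> c = a \<odot> (b \<odot> c)"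
proof
  fix n
  have v: "vanishing nv (\<lambda>(i, j). a j * b (i - j) * c (n - i))"
    unfolding vanishing_def
  proof (intro allI impI)
    fix e :: real assume e: "e > 0"
    obtain C where C: "C > 0" "\<And>i. nv (a i) \<le> C" "\<And>i. nv (c i) \<le> C"
    proof
      show "max (gn a) (gn c) + 1 > 0" using gn_ge0[OF a] by linarith
    qed (use nv_le_gn[OF a] nv_le_gn[OF c] in \<open>smt (verit)\<close>)+
    have "e / C > 0" using e C(1) by simp
    then obtain l m where l: "\<And>i j. e / C \<le> nv (a i) * nv (b j) \<Longrightarrow> i \<ge> l \<and> j \<ge> l"
      and m: "\<And>i j. e / C \<le> nv (b i) * nv (c j) \<Longrightarrow> i \<ge> m \<and> j \<ge> m"
      using coeff_prod_tail a b c by metis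
    \<comment> \<open>The three coefficient indices j, i - j and n - i have sum n. Large terms bound
      all of them from below, the first two through \<open>l\<close> and the last two through
      \<open>m\<close>, which confines (i, j) to a box.\<close>
    have "(i, j) \<in> {m + l .. n - m} \<times> {l .. n - m - l}"
      if *: "e \<le> nv (a j * b (i - j) * c (n - i))" for i j
    proof -
      have "e \<le> (nv (a j) * nv (b (i - j))) * C"
        using * mult_left_mono[OF C(3)[of "n - i"], of "nv (a j) * nv (b (i - j))"]
        by (simp add: nv_mult)
      hence 1: "j \<ge> l \<and> i - j \<ge> l" using l C(1) by (simp add: pos_divide_le_eq)
      have "e \<le> C * (nv (b (i - j)) * nv (c (n - i)))"
        using * mult_right_mono[OF C(2)[of j], of "nv (b (i - j)) * nv (c (n - i))"]
        by (simp add: nv_mult mult.assoc)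
      hence "e / C \<le> nv (b (i - j)) * nv (c (n - i))"
        using C(1) by (simp add: pos_divide_le_eq mult.commute)
      hence 2: "i - j \<ge> m \<and> n - i \<ge> m" by (rule m)
      show ?thesis using 1 2 by auto
    qed
    hence "{x. e \<le> nv (case x of (i, j) \<Rightarrow> a j * b (i - j) * c (n - i))}
        \<subseteq> {m + l .. n - m} \<times> {l .. n - m - l}" by auto
    thus "finite {x. e \<le> nv (case x of (i, j) \<Rightarrow> a j * b (i - j) * c (n - i))}"
      by (rule finite_subset) simp
  qed
  have "((a \<odot> b) \<odot> c) n = kSum nv (\<lambda>i. kSum nv (\<lambda>j. a j * b (i - j) * c (n - i)))"
    unfolding emul_def using kSum_cmult[OF emul_vanishing[OF a b]] by (simp add: mult.commute)
  also have "\<dots> = kSum nv (\<lambda>j. kSum nv (\<lambda>i. a j * b (i - j) * c (n - i)))"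
    by (rule kSum_swap[OF v])
  also have "\<dots> = kSum nv (\<lambda>j. a j * kSum nv (\<lambda>i. b i * c (n - j - i)))"
  proof (rule arg_cong[of _ _ "kSum nv"], rule ext)
    fix j
    have "kSum nv (\<lambda>i. (\<lambda>k. b k * c (n - j - k)) (i - j)) = kSum nv (\<lambda>k. b k * c (n - j - k))"
      by (rule kSum_reindex[OF emul_vanishing[OF b c]])
         (auto intro: bij_betw_byWitness[where f' = "\<lambda>i. i + j"])
    moreover have "kSum nv (\<lambda>i. a j * (b (i - j) * c (n - i)))
        = a j * kSum nv (\<lambda>i. b (i - j) * c (n - i))"
    proof (rule kSum_cmult)
      have "vanishing nv (\<lambda>i. (\<lambda>k. b k * c (n - j - k)) (i - j))"
        by (rule vanishing_reindex[OF emul_vanishing[OF b c]]) (auto simp: inj_def)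
      thus "vanishing nv (\<lambda>i. b (i - j) * c (n - i))" by simp
    qed
    ultimately show "kSum nv (\<lambda>i. a j * b (i - j) * c (n - i))
        = a j * kSum nv (\<lambda>i. b i * c (n - j - i))" by (simp add: mult.assoc)
  qed
  finally show "((a \<odot> b) \<odot> c) n = (a \<odot> (b \<odot> c)) n" by (simp add: emul_def)
qed

lemma emul_left_commute:
  "inE nv a \<Longrightarrow> inE nv b \<Longrightarrow> inE nv c \<Longrightarrow> b \<odot> (a \<odot> c) = a \<odot> (b \<odot> c)"
  by (metis emul_assoc emul_comm)

lemmas emul_ac = emul_assoc emul_comm emul_left_commute
lemmas emul_distribs = emul_add_left emul_add_right emul_diff_left emul_diff_right
  emul_minus_left emul_minus_right

lemma inE_ederiv [simp]: "inE nv a \<Longrightarrow> inE nv (ederiv a)"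
  and gn_ederiv: "inE nv a \<Longrightarrow> gn (ederiv a) \<le> gn a"
proof -
  assume a: "inE nv a"
  have le: "nv (ederiv a i) \<le> 1 * nv (a (i + 1))" for i
    unfolding ederiv_def nv_mult by (intro mult_right_mono nv_of_int_le1 nv_ge0)
  show "inE nv (ederiv a)" by (rule inE_mono[OF a le])
  show "gn (ederiv a) \<le> gn a"
    using le nv_le_gn[OF a] by (intro gn_le) (metis mult_1 order_trans)
qed

lemma inE_tau [simp]: "inE nv a \<Longrightarrow> inE nv (tau a m)"
  and gn_tau: "inE nv a \<Longrightarrow> gn (tau a m) \<le> gn a"
proof -
  assume a: "inE nv a"
  have le: "nv (tau a m i) \<le> 1 * nv (a (i + int m))" for i
    using tau_coeff[of a m i] mult_right_mono[OF nv_of_int_le1 nv_ge0] by (metis nv_mult)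
  show "inE nv (tau a m)" by (rule inE_mono[OF a le])
  show "gn (tau a m) \<le> gn a"
    using le nv_le_gn[OF a] by (intro gn_le) (metis mult_1 order_trans)
qed

text \<open>Inside the convolution the factor n + 1 splits as i + (n + 1 - i), one summand for each
  factor of the product.\<close>

lemma ederiv_emul:
  assumes a: "inE nv a" and b: "inE nv b"
  shows "ederiv (a \<odot> b) = ederiv a \<odot> b + a \<odot> ederiv b"
proof
  fix n
  have v1: "vanishing nv (\<lambda>i. of_int i * a i * b (n + 1 - i))"
  proof -
    define a' where "a' = (\<lambda>i. of_int i * a i)"
    have "inE nv a'"
      by (rule inE_mono[OF a, of _ 1 0])
         (auto simp: a'_def nv_mult intro: mult_left_le_one_le nv_of_int_le1)
    from emul_vanishing[OF this b, of "n + 1"] show ?thesis by (simp add: a'_def)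
  qed
  have v2: "vanishing nv (\<lambda>i. a i * ederiv b (n - i))"
    by (rule emul_vanishing) (use a b in auto)
  have "(ederiv a \<odot> b) n = kSum nv (\<lambda>i. (\<lambda>i. of_int i * a i * b (n + 1 - i)) (i + 1))"
    by (simp add: emul_def ederiv_def)
  also have "\<dots> = kSum nv (\<lambda>i. of_int i * a i * b (n + 1 - i))"
    by (rule kSum_reindex[OF v1]) (auto intro: bij_betw_byWitness[where f' = "\<lambda>i. i - 1"])
  finally have "(ederiv a \<odot> b + a \<odot> ederiv b) n
      = kSum nv (\<lambda>i. of_int i * a i * b (n + 1 - i) + a i * ederiv b (n - i))"
    using kSum_add[OF v1 v2] by (simp add: emul_def)
  also have "\<dots> = kSum nv (\<lambda>i. of_int (n + 1) * (a i * b (n + 1 - i)))"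
    by (simp add: ederiv_def algebra_simps)
  also have "\<dots> = ederiv (a \<odot> b) n"
    by (simp only: kSum_cmult[OF emul_vanishing[OF a b]]) (simp add: ederiv_def emul_def)
  finally show "ederiv (a \<odot> b) n = (ederiv a \<odot> b + a \<odot> ederiv b) n" by simp
qed

section \<open>Discreteness, completeness and inverses\<close>

lemma discrete_gap: "\<exists>\<theta>. 0 < \<theta> \<and> \<theta> < 1 \<and> (\<forall>x y. nv x < nv y \<longrightarrow> nv x \<le> \<theta> * nv y)"
proof -
  obtain \<pi> where pi: "0 < nv \<pi>" "nv \<pi> < 1" "\<And>a. a \<noteq> 0 \<Longrightarrow> \<exists>k::int. nv a = nv \<pi> powi k"
    using base unfolding base_field_def discretely_valued_def by blast
  \<comment> \<open>Nonzero values are integral powers of |\<pi>|, so a strictly smaller value is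
    smaller by at least this factor.\<close>
  have "nv x \<le> nv \<pi> * nv y" if "nv x < nv y" for x y
  proof (cases "x = 0")
    case False
    have "y \<noteq> 0" using that nv_ge0[of x] by (metis nv_0 not_less)
    then obtain k l :: int where k: "nv x = nv \<pi> powi k" and l: "nv y = nv \<pi> powi l"
      using pi(3) False by metis
    have "l < k"
    proof (rule ccontr)
      assume "\<not> l < k"
      hence "nv \<pi> powi l \<le> nv \<pi> powi k"
        using pi by (intro power_int_decreasing) auto
      thus False using that k l by simp
    qed
    hence "nv \<pi> powi k \<le> nv \<pi> powi (l + 1)" using pi by (intro power_int_decreasing) auto
    moreover have "nv \<pi> powi (l + 1) = nv \<pi> * nv \<pi> powi l"
      using pi(1) by (subst power_int_add) auto
    ultimately show ?thesis using k l by simp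
  qed simp
  thus ?thesis using pi by blast
qed

text \<open>A coefficient above \<theta> times the supremum is maximal, because a larger one would
  exceed it by the factor 1/\<theta> at least.\<close>

lemma gn_attained:
  assumes a: "inE nv a" "a \<noteq> 0"
  obtains k where "nv (a k) = gn a"
proof -
  obtain \<theta> where th: "0 < \<theta>" "\<theta> < 1" "\<And>x y. nv x < nv y \<Longrightarrow> nv x \<le> \<theta> * nv y"
    using discrete_gap by blast
  have pos: "gn a > 0" using gn_eq0[OF a(1)] a gn_ge0[OF a(1)] by linarith
  have "\<exists>k. \<theta> * gn a < nv (a k)"
  proof (rule ccontr)
    assume "\<nexists>k. \<theta> * gn a < nv (a k)"
    hence "gn a \<le> \<theta> * gn a" by (intro gn_le) (simp add: not_less)
    thus False using pos th by simp
  qed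
  then obtain k where k: "\<theta> * gn a < nv (a k)" by blast
  have "nv (a j) \<le> nv (a k)" for j
  proof (rule ccontr)
    assume "\<not> nv (a j) \<le> nv (a k)"
    hence "nv (a k) \<le> \<theta> * nv (a j)" by (intro th(3)) simp
    also have "\<dots> \<le> \<theta> * gn a" using nv_le_gn[OF a(1)] th(1) by simp
    finally show False using k by simp
  qed
  hence "gn a = nv (a k)" using nv_le_gn[OF a(1), of k] by (intro antisym gn_le)
  thus ?thesis using that by metis
qed

text \<open>Coefficients decay to the left, so only finitely many positions compete. The leftmost
  maximal coefficient acts as the leading one in \<open>E_inverse\<close>.\<close>

lemma gn_attained_first:
  assumes a: "inE nv a" "a \<noteq> 0"
  obtains k where "nv (a k) = gn a" "\<And>i. i < k \<Longrightarrow> nv (a i) < gn a"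
proof -
  obtain k0 where k0: "nv (a k0) = gn a" using gn_attained[OF a] by blast
  have pos: "gn a > 0" using gn_eq0[OF a(1)] a gn_ge0[OF a(1)] by linarith
  obtain c where c: "\<forall>i<c. nv (a i) < gn a" using inE_tail[OF a(1) pos] by blast
  define S where "S = {i \<in> {c..k0}. nv (a i) = gn a}"
  have fin: "finite S" unfolding S_def by (rule finite_subset[of _ "{c..k0}"]) auto
  have "c \<le> k0" using c k0 by (metis not_less order_less_irrefl)
  hence "k0 \<in> S" using k0 unfolding S_def by auto
  hence m: "Min S \<in> S" using fin by (intro Min_in) auto
  have "nv (a i) < gn a" if "i < Min S" for i
  proof (rule ccontr)
    assume "\<not> nv (a i) < gn a"
    hence e: "nv (a i) = gn a" using nv_le_gn[OF a(1), of i] by simp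
    have "c \<le> i" using c e by (metis not_less order_less_irrefl)
    hence "i \<in> S" using e that m unfolding S_def by auto
    thus False using that Min_le[OF fin] by fastforce
  qed
  thus ?thesis using that m unfolding S_def by blast
qed

definition econv :: "(nat \<Rightarrow> 'k lau) \<Rightarrow> 'k lau \<Rightarrow> bool" where
  "econv X L \<longleftrightarrow> (\<forall>\<epsilon>>0. \<exists>N. \<forall>n\<ge>N. gn (X n - L) \<le> \<epsilon>)"

lemma E_complete:
  assumes X: "\<And>n. inE nv (X n)"
    and C: "\<And>\<epsilon>. \<epsilon> > 0 \<Longrightarrow> \<exists>N. \<forall>m\<ge>N. \<forall>n\<ge>N. gn (X m - X n) \<le> \<epsilon>"
  obtains L where "inE nv L" "econv X L"
proof -
  have "\<exists>l. (\<lambda>n. nv (X n i - l)) \<longlonglongrightarrow> 0" for i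
  proof (rule limit_exists)
    fix e :: real assume e: "e > 0"
    then obtain N where N: "\<forall>m\<ge>N. \<forall>n\<ge>N. gn (X m - X n) \<le> e / 2" using C[of "e / 2"] by auto
    have "nv (X m i - X n i) < e" if "m \<ge> N" "n \<ge> N" for m n
      using nv_le_gn[OF inE_diff[OF X X], of m n i] N that e by force
    thus "\<exists>N. \<forall>m\<ge>N. \<forall>n\<ge>N. nv (X m i - X n i) < e" by blast
  qed
  then obtain L where L: "\<And>i. (\<lambda>n. nv (X n i - L i)) \<longlonglongrightarrow> 0" by metis
  have close: "nv (X n i - L i) \<le> e" if "e > 0" "\<forall>m\<ge>N. \<forall>n\<ge>N. gn (X m - X n) \<le> e" "n \<ge> N" for e N n i
  proof -
    have "nv (L i - X n i) \<le> e"
    proof (rule limit_bound[OF L, of N])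
      fix m assume "m \<ge> N"
      thus "nv (X m i - X n i) \<le> e"
        using nv_le_gn[OF inE_diff[OF X X], of m n i] that by force
    qed (use that in auto)
    thus ?thesis by (simp add: nv_diff_commute)
  qed
  have conv: "econv X L"
    unfolding econv_def using C close by (metis fun_diff_def gn_le)
  have LE: "inE nv L"
  proof -
    have *: "\<exists>N. \<forall>i. nv (X N i - L i) \<le> e" if "e > 0" for e
      using C[OF that] close[OF that] by blast
    obtain N where N: "\<And>i. nv (X N i - L i) \<le> 1" using *[of 1] by auto
    show ?thesis
    proof (rule inEI)
      show "nv (L i) \<le> max (gn (X N)) 1" for i
        using nv_diff[of "X N i" "max (gn (X N)) 1" "X N i - L i"] N[of i] nv_le_gn[OF X, of N i]
        by auto
      fix e :: real assume e: "e > 0"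
      then obtain M where M: "\<And>i. nv (X M i - L i) \<le> e / 2" using *[of "e / 2"] by auto
      obtain c where c: "\<forall>i<c. nv (X M i) < e / 2" using inE_tail[OF X, of "e / 2" M] e by auto
      have "nv (L i) < e" if "i < c" for i
        using nv_diff[of "X M i" "e / 2" "X M i - L i"] M[of i] c that e by force
      thus "\<exists>c. \<forall>i<c. nv (L i) < e" by blast
    qed
  qed
  show ?thesis using that LE conv by blast
qed

lemma small_gn_0:
  assumes "inE nv a" "\<And>\<epsilon>. \<epsilon> > 0 \<Longrightarrow> gn a \<le> \<epsilon>" shows "a = 0"
  using field_le_epsilon[of "gn a" 0] assms gn_eq0 gn_ge0[OF assms(1)] by force

lemma epow_0 [simp]: "epow nv a 0 = eone" and epow_Suc: "epow nv a (Suc k) = a \<odot> epow nv a k"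
  by (simp_all add: epow_def)

lemma inE_epow [simp]: "inE nv a \<Longrightarrow> inE nv (epow nv a k)"
  by (induction k) (auto simp: epow_Suc)

lemma gn_epow_le: "inE nv a \<Longrightarrow> gn (epow nv a k) \<le> gn a ^ k"
  by (induction k) (auto simp: epow_Suc intro!: gn_emul_bound)

lemma geometric_inverse:
  assumes w: "inE nv w" "gn w < 1"
  obtains v where "inE nv v" "(eone - w) \<odot> v = eone" "gn v \<le> 1"
proof -
  define X where "X n = (\<Sum>k<n. epow nv w k)" for n
  have X: "inE nv (X n)" for n unfolding X_def using w by simp
  have le1: "gn w ^ n \<le> 1" for n using w by (simp add: power_le_one)
  have small: "\<exists>N. gn w ^ N \<le> e" if "e > 0" for e
    using real_arch_pow_inv[OF that w(2)] by (auto intro: less_imp_le)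
  have tail: "gn (X n - X N) \<le> gn w ^ N" if "n \<ge> N" for n N
  proof -
    have "X n - X N = (\<Sum>k=N..<n. epow nv w k)"
      using that by (simp add: X_def sum_diff_nat_ivl atLeast0LessThan[symmetric])
    moreover have "gn (epow nv w k) \<le> gn w ^ N" if "k \<ge> N" for k
      using gn_epow_le[OF w(1), of k] power_decreasing[OF that, of "gn w"] w by simp
    ultimately show ?thesis using w by (auto intro!: gn_sum)
  qed
  have "\<exists>N. \<forall>m\<ge>N. \<forall>n\<ge>N. gn (X m - X n) \<le> e" if e: "e > 0" for e
  proof -
    obtain N where N: "gn w ^ N \<le> e" using small[OF e] by blast
    have "gn (X m - X n) \<le> e" if "m \<ge> N" "n \<ge> N" for m n
    proof -
      have "gn ((X m - X N) - (X n - X N)) \<le> e"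
        using tail[OF that(1)] tail[OF that(2)] N X by (intro gn_diff[of "X m - X N"]) auto
      thus ?thesis by simp
    qed
    thus ?thesis by blast
  qed
  then obtain v where v: "inE nv v" "econv X v" using E_complete[of X] X by metis
  have tele0: "(eone - w) \<odot> X 0 = eone - epow nv w 0" by (simp add: X_def)
  have tele1: "(eone - w) \<odot> X (Suc n) = eone - epow nv w (Suc n)"
    if "(eone - w) \<odot> X n = eone - epow nv w n" for n
  proof -
    have "X (Suc n) = X n + epow nv w n" by (simp add: X_def)
    thus ?thesis using that w X by (simp add: emul_distribs epow_Suc)
  qed
  have tele: "(eone - w) \<odot> X n = eone - epow nv w n" for n
    by (induction n) (fact tele0, fact tele1)
  have "(eone - w) \<odot> v - eone = 0"
  proof (rule small_gn_0)
    show "inE nv ((eone - w) \<odot> v - eone)" using v w by simp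
    fix e :: real assume e: "e > 0"
    obtain N where N: "\<forall>n\<ge>N. gn (X n - v) \<le> e" using v(2) e unfolding econv_def by blast
    obtain M where M: "gn w ^ M \<le> e" using small[OF e] by blast
    define n where "n = max N M"
    have 1: "gn (X n - v) \<le> e" using N n_def by auto
    have 2: "gn (epow nv w n) \<le> e"
      using gn_epow_le[OF w(1), of n] power_decreasing[of M n "gn w"] w M n_def by simp
    have 3: "gn (eone - w) \<le> 1" using w by (intro gn_diff) auto
    have "(eone - w) \<odot> (X n - v) = eone - epow nv w n - (eone - w) \<odot> v"
      using w v X by (simp add: emul_diff_right tele)
    hence "(eone - w) \<odot> v - eone = - ((eone - w) \<odot> (X n - v)) - epow nv w n" by simp
    moreover have "gn ((eone - w) \<odot> (X n - v)) \<le> 1 * e"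
      using w v X 1 3 by (intro gn_emul_bound) auto
    ultimately show "gn ((eone - w) \<odot> v - eone) \<le> e"
      using w v X 2 by (auto intro!: gn_diff simp del: minus_diff_eq)
  qed
  hence "(eone - w) \<odot> v = eone" by simp
  moreover have "gn v \<le> 1"
  proof -
    obtain N where N: "gn (X N - v) \<le> 1" using v(2) unfolding econv_def by (metis order_refl zero_less_one)
    have "gn (X N) \<le> 1" unfolding X_def
      using w gn_epow_le[OF w(1)] le1 by (intro gn_sum) (auto intro: order_trans)
    from gn_diff[OF X _ this N] show ?thesis using X v by simp
  qed
  ultimately show ?thesis using that v by blast
qed

definition tmon :: "int \<Rightarrow> 'k lau" where "tmon k = (\<lambda>n. if n = k then 1 else 0)"

lemma inE_tmon [simp]: "inE nv (tmon k)"
  by (rule inE_finite_support[of "{k}"]) (auto simp: tmon_def)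

lemma gn_tmon_le: "gn (tmon k) \<le> 1"
  by (rule gn_le) (simp add: tmon_def)

lemma tmon_emul: "tmon k \<odot> a = (\<lambda>n. a (n - k))"
proof
  fix n show "(tmon k \<odot> a) n = a (n - k)"
    unfolding emul_def using kSum_single[of k "\<lambda>i. tmon k i * a (n - i)"] by (simp add: tmon_def)
qed

lemma tmon_0: "tmon 0 = eone" and tvar_tmon: "tvar = tmon 1"
  by (auto simp: tmon_def eone_def tvar_def)

lemma tmon_add: "tmon k \<odot> tmon l = tmon (k + l)"
  by (auto simp: tmon_emul) (auto simp: tmon_def fun_eq_iff)

lemma epow_tvar: "epow nv tvar k = tmon (int k)"
  by (induction k) (auto simp: epow_Suc tvar_tmon tmon_0 tmon_add)

text \<open>The recursion for the inverse involves no division because the constant term is 1; its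
  coefficients thus stay in the valuation ring.\<close>

lemma power_series_inverse:
  assumes "f 0 = 1" "\<And>i. nv (f i) \<le> 1" "\<And>i. i < 0 \<Longrightarrow> f i = 0"
  obtains h where "inE nv h" "gn h \<le> 1" "f \<odot> h = eone"
proof -
  define F where "F = Abs_fps (\<lambda>n. f (int n))"
  define h where "h i = (if i \<ge> 0 then fps_nth (inverse F) (nat i) else 0)" for i
  have F0: "fps_nth F 0 = 1" by (simp add: F_def assms)
  have conv: "(\<Sum>i=0..n. f (int i) * fps_nth (inverse F) (n - i)) = (if n = 0 then 1 else 0)" for n
  proof -
    have "F * inverse F = 1" using F0 inverse_mult_eq_1'[of F] by simp
    hence "fps_nth (F * inverse F) n = (if n = 0 then 1 else 0)" by simp
    thus ?thesis by (simp add: fps_mult_nth F_def)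
  qed
  have bd: "nv (fps_nth (inverse F) n) \<le> 1" for n
  proof (induction n rule: less_induct)
    case (less n)
    show ?case
    proof (cases n)
      case 0 thus ?thesis using conv[of 0] assms(1) by simp
    next
      case (Suc m)
      have "(\<Sum>i=0..n. f (int i) * fps_nth (inverse F) (n - i))
        = fps_nth (inverse F) n + (\<Sum>i=1..n. f (int i) * fps_nth (inverse F) (n - i))"
        by (simp add: sum.atLeast_Suc_atMost assms(1))
      hence eq: "fps_nth (inverse F) n = - (\<Sum>i=1..n. f (int i) * fps_nth (inverse F) (n - i))"
        using conv[of n] Suc by (metis eq_neg_iff_add_eq_0 nat.distinct(1))
      have "nv (f (int i) * fps_nth (inverse F) (n - i)) \<le> 1" if "i \<in> {1..n}" for i
        using less.IH[of "n - i"] assms(2)[of "int i"] that unfolding nv_mult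
        by (intro mult_le_one) auto
      thus ?thesis unfolding eq by (simp only: nv_minus) (intro nv_sum, auto)
    qed
  qed
  have hb: "nv (h i) \<le> 1" for i using bd by (simp add: h_def)
  have hE: "inE nv h" by (rule inEI[OF hb], rule exI[of _ 0]) (auto simp: h_def)
  moreover have "gn h \<le> 1" by (rule gn_le[OF hb])
  moreover have "f \<odot> h = eone"
  proof
    fix n :: int
    have "(f \<odot> h) n = sum (\<lambda>i. f i * h (n - i)) {0..n}"
      unfolding emul_def by (rule kSum_finite) (use assms(3) in \<open>force simp: h_def\<close>)+
    also have "\<dots> = eone n"
    proof (cases "n \<ge> 0")
      case True
      then obtain m where m: "n = int m" using zero_le_imp_eq_int by blast
      have "sum (\<lambda>i. f i * h (n - i)) {0..n} = sum (\<lambda>i. f (int i) * h (n - int i)) {0..m}"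
        unfolding m by (rule sum.reindex_bij_witness[of _ int nat]) auto
      also have "\<dots> = (\<Sum>i=0..m. f (int i) * fps_nth (inverse F) (m - i))"
        unfolding m h_def by (intro sum.cong) (auto simp: nat_diff_distrib simp flip: of_nat_diff)
      finally show ?thesis unfolding conv m eone_def by simp
    qed (simp add: eone_def)
    finally show "(f \<odot> h) n = eone n" .
  qed
  ultimately show ?thesis using that by blast
qed

text \<open>After scaling and shifting, the leftmost coefficient of maximal size is 1 and sits at
  index 0. Then \<open>b = f + g\<close> with an integral power series \<open>f\<close> of constant
  term 1 and a part \<open>g\<close> in negative degrees, of norm at most \<theta> < 1 by
  discreteness. A power series \<open>h\<close> inverts \<open>f\<close>, and a geometric series
  inverts 1 + g h.\<close>

lemma E_inverse:
  assumes a: "inE nv a" "a \<noteq> 0"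
  obtains d where "inE nv d" "a \<odot> d = eone" "gn d \<le> 1 / gn a"
proof -
  obtain k where k: "nv (a k) = gn a" "\<And>i. i < k \<Longrightarrow> nv (a i) < gn a"
    using gn_attained_first[OF a] by blast
  have pos: "gn a > 0" using gn_eq0[OF a(1)] a gn_ge0[OF a(1)] by linarith
  hence ak: "a k \<noteq> 0" using k(1) by force
  obtain \<theta> where th: "0 < \<theta>" "\<theta> < 1" "\<And>x y. nv x < nv y \<Longrightarrow> nv x \<le> \<theta> * nv y"
    using discrete_gap by blast
  define b where "b = ksc (1 / a k) (tmon (- k) \<odot> a)"
  have bE: "inE nv b" unfolding b_def using a by simp
  have bi: "b i = a (i + k) / a k" for i by (simp add: b_def tmon_emul ksc_def)
  have b1: "nv (b i) \<le> 1" for i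
    using nv_le_gn[OF a(1), of "i + k"] k pos by (simp add: bi nv_divide)
  have b2: "nv (b i) \<le> \<theta>" if "i < 0" for i
    using th(3)[of "a (i + k)" "a k"] k(2)[of "i + k"] that k(1) pos by (simp add: bi nv_divide field_simps)
  define f where "f i = (if i \<ge> 0 then b i else 0)" for i
  define g where "g i = (if i < 0 then b i else 0)" for i
  have fE: "inE nv f" by (rule inE_mono[OF bE, of _ 1 0]) (auto simp: f_def)
  have gE: "inE nv g" by (rule inE_mono[OF bE, of _ 1 0]) (auto simp: g_def)
  have gth: "gn g \<le> \<theta>" by (rule gn_le) (use b2 th in \<open>auto simp: g_def\<close>)
  have bfg: "b = f + g" by (auto simp: f_def g_def fun_eq_iff)
  obtain h where h: "inE nv h" "gn h \<le> 1" "f \<odot> h = eone"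
  proof (rule power_series_inverse[of f])
    show "f 0 = 1" using ak by (simp add: f_def bi)
  qed (use b1 in \<open>auto simp: f_def\<close>)
  have "gn (- (g \<odot> h)) < 1"
    using gn_emul_bound[OF gE h(1) gth h(2)] th(2) by simp
  then obtain v where v: "inE nv v" "(eone - - (g \<odot> h)) \<odot> v = eone" "gn v \<le> 1"
    using geometric_inverse[of "- (g \<odot> h)"] gE h(1) by auto
  have "b \<odot> h = eone + g \<odot> h" unfolding bfg using fE gE h by (simp add: emul_add_left)
  hence bhv: "b \<odot> (h \<odot> v) = eone" using v bE h by (simp add: emul_assoc[symmetric])
  define d where "d = ksc (1 / a k) (tmon (- k) \<odot> (h \<odot> v))"
  have dE: "inE nv d" unfolding d_def using h v by simp
  moreover have "a \<odot> d = eone"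
  proof -
    have "a \<odot> d = ksc (1 / a k) (a \<odot> (tmon (- k) \<odot> (h \<odot> v)))"
      unfolding d_def using a h v by (simp add: emul_ksc_right)
    also have "\<dots> = ksc (1 / a k) ((tmon (- k) \<odot> a) \<odot> (h \<odot> v))"
      using a h v by (metis emul_assoc emul_comm inE_emul inE_tmon)
    also have "\<dots> = b \<odot> (h \<odot> v)"
      unfolding b_def using a h v by (simp add: emul_ksc_left)
    finally show ?thesis using bhv by simp
  qed
  moreover have "gn d \<le> 1 / gn a"
  proof -
    have "gn (tmon (- k) \<odot> (h \<odot> v)) \<le> 1 * (1 * 1)"
      using h v by (intro gn_emul_bound gn_tmon_le) auto
    hence "gn d \<le> nv (1 / a k) * 1"
      unfolding d_def using h v by (simp add: mult_left_le)
    thus ?thesis by (simp add: nv_divide k(1))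
  qed
  ultimately show ?thesis using that by blast
qed

text \<open>From b = d (a b), with d the inverse of a and |d| \<le> 1/|a|, follows |b| \<le> |a b| /
  |a|; the opposite inequality holds for any product.\<close>

lemma gn_emul: assumes a: "inE nv a" and b: "inE nv b" shows "gn (a \<odot> b) = gn a * gn b"
proof (cases "a = 0")
  case False
  obtain d where d: "inE nv d" "a \<odot> d = eone" "gn d \<le> 1 / gn a" using E_inverse[OF a False] .
  have pos: "gn a > 0" using gn_eq0[OF a] False gn_ge0[OF a] by linarith
  have "d \<odot> (a \<odot> b) = b" using d a b by (metis emul_assoc emul_comm emul_eone_left)
  hence "gn b \<le> 1 / gn a * gn (a \<odot> b)"
    using gn_emul_bound[OF d(1) inE_emul[OF a b] d(3) order_refl] by simp
  hence "gn a * gn b \<le> gn (a \<odot> b)" using pos by (simp add: field_simps)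
  thus ?thesis using gn_emul_le[OF a b] by simp
qed simp

lemma emul_eq_0: "inE nv a \<Longrightarrow> inE nv b \<Longrightarrow> a \<odot> b = 0 \<longleftrightarrow> a = 0 \<or> b = 0"
  using gn_emul[of a b] gn_eq0[of a] gn_eq0[of b] by auto

lemma emul_left_cancel:
  assumes "inE nv a" "inE nv b" "inE nv c" "a \<noteq> 0" "a \<odot> b = a \<odot> c" shows "b = c"
proof -
  have "a \<odot> (b - c) = 0" using assms by (simp add: emul_diff_right)
  thus ?thesis using assms by (simp add: emul_eq_0)
qed

lemma einv_props:
  assumes a: "inE nv a" "a \<noteq> 0"
  shows "inE nv (einv nv a)" "a \<odot> einv nv a = eone"
proof -
  obtain d where d: "inE nv d" "a \<odot> d = eone" using E_inverse[OF a] by metis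
  have "\<exists>!b. inE nv b \<and> a \<odot> b = eone"
    using d emul_left_cancel[OF a(1) _ _ a(2)] by (intro ex1I[of _ d]) auto
  from theI'[OF this] show "inE nv (einv nv a)" "a \<odot> einv nv a = eone"
    unfolding einv_def by auto
qed

lemma gn_einv: "inE nv a \<Longrightarrow> a \<noteq> 0 \<Longrightarrow> gn (einv nv a) = 1 / gn a"
  using gn_emul[of a "einv nv a"] einv_props[of a] gn_eq0[of a]
  by (metis gn_eone nonzero_eq_divide_eq mult.commute)

lemma gn_epow: "inE nv a \<Longrightarrow> gn (epow nv a k) = gn a ^ k"
  by (induction k) (auto simp: epow_Suc gn_emul)

lemma inE_epowi [simp]: "inE nv a \<Longrightarrow> a \<noteq> 0 \<Longrightarrow> inE nv (epowi nv a i)"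
  using einv_props by (simp add: epowi_def)

lemma epowi_Suc:
  assumes a: "inE nv a" "a \<noteq> 0"
  shows "epowi nv a (i + 1) = a \<odot> epowi nv a i"
proof (cases "i \<ge> 0")
  case True
  thus ?thesis by (simp add: epowi_def nat_add_distrib epow_Suc)
next
  case False
  hence "i = - int (Suc (nat (- i - 1)))" by simp
  then obtain m where m: "i = - int (Suc m)" by blast
  have "epowi nv a i = einv nv a \<odot> epow nv (einv nv a) m"
    by (simp add: m epowi_def del: of_nat_Suc) (simp add: epow_Suc)
  hence "a \<odot> epowi nv a i = (a \<odot> einv nv a) \<odot> epow nv (einv nv a) m"
    using emul_assoc[OF a(1) einv_props(1)[OF a] inE_epow[OF einv_props(1)[OF a]]] by simp
  also have "\<dots> = epow nv (einv nv a) m" by (simp add: einv_props(2)[OF a])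
  also have "\<dots> = epowi nv a (i + 1)" by (cases m) (simp_all add: m epowi_def nat_add_distrib)
  finally show ?thesis by simp
qed

lemma epowi_0 [simp]: "epowi nv a 0 = eone"
  by (simp add: epowi_def)

lemma gn_epowi: "inE nv a \<Longrightarrow> gn a = 1 \<Longrightarrow> gn (epowi nv a i) = 1"
  using einv_props[of a] by (cases "a = 0") (auto simp: epowi_def gn_epow gn_einv)

lemma epowi_add:
  assumes a: "inE nv a" "a \<noteq> 0"
  shows "epowi nv a (i + j) = epowi nv a i \<odot> epowi nv a j"
proof (induction i rule: int_induct[of _ 0])
  case (step1 i)
  have "epowi nv a (i + 1 + j) = a \<odot> epowi nv a (i + j)"
    using epowi_Suc[OF a, of "i + j"] by (simp add: ac_simps)
  thus ?case using step1 a by (simp add: epowi_Suc emul_assoc)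
next
  case (step2 i)
  have "a \<odot> epowi nv a (i - 1 + j) = a \<odot> (epowi nv a (i - 1) \<odot> epowi nv a j)"
    using epowi_Suc[OF a, of "i - 1 + j"] epowi_Suc[OF a, of "i - 1"] step2 a
    by (simp add: emul_assoc[symmetric] ac_simps)
  thus ?case using a by (auto intro: emul_left_cancel)
qed auto

end

section \<open>The Frobenius lift\<close>

locale frobenius_lift = complete_dvf nv p for nv :: "'k::field_char_0 \<Rightarrow> real" and p +
  fixes q :: nat and phiK :: "'k \<Rightarrow> 'k" and s :: "'k lau"
  assumes q_pow: "\<exists>k\<ge>1. q = p ^ k"
    and lift: "frob_lift nv q phiK"
    and param: "frob_param nv q s"
begin

lemma phiK_add: "phiK (a + b) = phiK a + phiK b"
  and phiK_mult: "phiK (a * b) = phiK a * phiK b"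
  and phiK_1 [simp]: "phiK 1 = 1"
  and nv_phiK [simp]: "nv (phiK a) = nv a"
  using lift unfolding frob_lift_def by auto

lemma phiK_0 [simp]: "phiK 0 = 0"
  using phiK_add[of 0 0] by simp

lemma phiK_minus: "phiK (- a) = - phiK a"
  using phiK_add[of a "- a"] by (simp add: eq_neg_iff_add_eq_0 add.commute)

lemma phiK_diff: "phiK (a - b) = phiK a - phiK b"
  using phiK_add[of a "- b"] by (simp add: phiK_minus)

lemma phiK_sum: "phiK (sum f A) = (\<Sum>x\<in>A. phiK (f x))"
  by (induction A rule: infinite_finite_induct) (auto simp: phiK_add)

lemma q_ge2: "q \<ge> 2" and nv_q: "nv (of_nat q) < 1"
proof -
  obtain k where k: "k \<ge> 1" "q = p ^ k" using q_pow by blast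
  have p2: "p \<ge> 2" using p_prime prime_ge_2_nat by blast
  have "p \<le> p ^ k" using k(1) p2 by (simp add: self_le_power)
  thus "q \<ge> 2" using p2 k by simp
  have "nv (of_nat q) = (1 / real p) ^ k" using k by (simp add: nv_power nv_p)
  also have "\<dots> < 1" using p2 k(1) by (intro power_Suc_less_one[of _ "k - 1", simplified] | simp add: power_less_one_iff)+
  finally show "nv (of_nat q) < 1" .
qed

lemma inE_s [simp]: "inE nv s"
  using param unfolding frob_param_def by auto

definition sdev :: "'k lau" where "sdev = s - tmon (int q)"

lemma inE_sdev [simp]: "inE nv sdev" and gn_sdev: "gn sdev < 1"
  using param unfolding frob_param_def sdev_def epow_tvar by auto

lemma gn_tmon [simp]: "gn (tmon k) = 1"
  using nv_le_gn[OF inE_tmon, of k k] gn_tmon_le[of k] by (simp add: tmon_def)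

lemma gn_s [simp]: "gn s = 1"
proof -
  have "gn (tmon (int q) + sdev) \<le> 1" using gn_sdev by (intro gn_add) auto
  hence 1: "gn s \<le> 1" by (simp add: sdev_def)
  have "1 \<le> max (gn s) (gn sdev)"
    using gn_diff[of s sdev "max (gn s) (gn sdev)"] by (simp add: sdev_def)
  thus ?thesis using 1 gn_sdev by simp
qed

lemma s_neq0 [simp]: "s \<noteq> 0"
  using gn_s by force

text \<open>s' is the derivative of t^q, which carries a factor q, plus the derivative of s - t^q,
  whose norm is below 1. This is the factor by which each Frobenius step contracts the
  connection.\<close>

lemma gn_s_deriv: "gn (ederiv s) < 1"
proof -
  have "ederiv s = ederiv (tmon (int q)) + ederiv sdev" by (simp add: sdev_def ederiv_diff)
  moreover have "gn (ederiv (tmon (int q))) \<le> nv (of_nat q)"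
  proof (rule gn_le)
    fix i show "nv (ederiv (tmon (int q)) i) \<le> nv (of_nat q)"
    proof (cases "i + 1 = int q")
      case True
      have "ederiv (tmon (int q)) i = of_int (i + 1)"
        unfolding ederiv_def tmon_def by (simp only: True) simp
      thus ?thesis by (simp only: True of_int_of_nat_eq order_refl)
    qed (simp add: ederiv_def tmon_def)
  qed
  moreover have "gn (ederiv sdev) \<le> gn sdev" by (intro gn_ederiv) auto
  ultimately have "gn (ederiv s) \<le> max (nv (of_nat q)) (gn sdev)"
    by (auto intro!: gn_add)
  thus ?thesis using nv_q gn_sdev by simp
qed

text \<open>Multiplication by \<open>1 + sdev/t\<^sup>q\<close> and by its inverse, a power series in \<open>sdev/t\<^sup>q\<close>,
  does not move the index below which the coefficients are smaller than \<open>\<epsilon>\<close>.\<close>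
lemma epowi_s_tail:
  assumes e: "\<epsilon> > 0"
  obtains c where "\<And>i m. \<epsilon> \<le> nv (epowi nv s i m) \<Longrightarrow> int q * i - c \<le> m"
proof -
  define w where "w = tmon (- int q) \<odot> sdev"
  have w: "inE nv w" "gn w < 1" unfolding w_def using gn_sdev by (auto simp: gn_emul)
  have s: "s = tmon (int q) \<odot> (eone + w)"
    by (simp add: w_def emul_add_right emul_assoc[symmetric] tmon_add tmon_0 sdev_def)
  obtain K where K: "gn w ^ K < \<epsilon>" using real_arch_pow_inv[OF e w(2)] by blast
  have big: "nv ((a \<odot> epow nv w k) m) < \<epsilon>" if "k \<ge> K" "inE nv a" "gn a \<le> 1" for a k m
  proof -
    have "nv ((a \<odot> epow nv w k) m) \<le> gn (a \<odot> epow nv w k)"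
      using w that by (intro nv_le_gn) auto
    also have "\<dots> \<le> 1 * gn w ^ k"
      using w that by (intro gn_emul_bound) (auto simp: gn_epow)
    also have "\<dots> \<le> gn w ^ K" using that(1) w by (simp add: power_decreasing)
    finally show ?thesis using K by simp
  qed
  have "\<exists>c. \<forall>k<n. \<forall>m<c. nv (epow nv w k m) < \<epsilon>" for n
  proof (induction n)
    case (Suc n)
    then obtain c where c: "\<forall>k<n. \<forall>m<c. nv (epow nv w k m) < \<epsilon>" by blast
    obtain d where "\<forall>m<d. nv (epow nv w n m) < \<epsilon>" using inE_tail[OF inE_epow[OF w(1)] e] by blast
    hence "\<forall>k<Suc n. \<forall>m<min c d. nv (epow nv w k m) < \<epsilon>" using c by (auto simp: less_Suc_eq)
    thus ?case by blast
  qed auto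
  then obtain c where c: "\<forall>k<K. \<forall>m<c. nv (epow nv w k m) < \<epsilon>" by blast
  \<comment> \<open>All powers of \<open>w\<close> belong to the invariant, since multiplication by
    1 + w mixes the powers k and k + 1.\<close>
  define T where "T a \<longleftrightarrow> inE nv a \<and> gn a \<le> 1 \<and> (\<forall>k. \<forall>m<c. nv ((a \<odot> epow nv w k) m) < \<epsilon>)" for a
  have T1: "T eone" unfolding T_def using c big[of _ eone] by (auto simp: not_less) (metis not_less)
  have Tup: "T ((eone + w) \<odot> a)" if "T a" for a
  proof -
    have aE: "inE nv a" "gn a \<le> 1" and a: "\<And>k m. m < c \<Longrightarrow> nv ((a \<odot> epow nv w k) m) < \<epsilon>"
      using that by (auto simp: T_def)
    have "((eone + w) \<odot> a) \<odot> epow nv w k = a \<odot> epow nv w k + a \<odot> epow nv w (Suc k)" for k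
      using aE w by (simp add: emul_add_left epow_Suc emul_assoc)
        (metis emul_left_commute inE_epow)
    moreover have "gn ((eone + w) \<odot> a) \<le> 1 * 1"
      using aE w by (intro gn_emul_bound gn_add) auto
    ultimately show ?thesis unfolding T_def using aE w a
      by (auto intro!: le_less_trans[OF nv_add_max])
  qed
  have Tdown: "T a" if "T ((eone + w) \<odot> a)" "inE nv a" "gn a \<le> 1" for a
  proof -
    have b: "\<And>k m. m < c \<Longrightarrow> nv ((((eone + w) \<odot> a) \<odot> epow nv w k) m) < \<epsilon>"
      using that by (auto simp: T_def)
    have eq: "a \<odot> epow nv w k = ((eone + w) \<odot> a) \<odot> epow nv w k - a \<odot> epow nv w (Suc k)" for k
      using that w by (simp add: emul_add_left epow_Suc emul_assoc)
        (metis emul_left_commute inE_epow)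
    have "nv ((a \<odot> epow nv w k) m) < \<epsilon>" if m: "m < c" for k m
    \<comment> \<open>For k \<ge> K the norm of w^k suffices; below K the identity \<open>eq\<close>
      descends from k + 1 to k.\<close>
    proof (induction "K - k" arbitrary: k)
      case 0 thus ?case using big that \<open>inE nv a\<close> \<open>gn a \<le> 1\<close> by simp
    next
      case (Suc d)
      have "nv ((a \<odot> epow nv w (Suc k)) m) < \<epsilon>" using Suc by (intro Suc(1)) simp
      moreover have "(a \<odot> epow nv w k) m
          = (((eone + w) \<odot> a) \<odot> epow nv w k) m - (a \<odot> epow nv w (Suc k)) m"
        by (subst eq) simp
      ultimately show ?case using b[OF m, of k] by (auto intro: nv_diff_less)
    qed
    thus ?thesis using that by (simp add: T_def)
  qed
  define S where "S i = tmon (- (int q * i)) \<odot> epowi nv s i" for i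
  have SE: "inE nv (S i)" "gn (S i) \<le> 1" for i
    by (auto simp: S_def gn_emul gn_epowi)
  have Sstep: "S (i + 1) = (eone + w) \<odot> S i" for i
  proof -
    have "S (i + 1) = tmon (- (int q * (i + 1))) \<odot> (tmon (int q) \<odot> ((eone + w) \<odot> epowi nv s i))"
      using w arg_cong[OF s, of "\<lambda>x. x \<odot> epowi nv s i"] by (simp add: S_def epowi_Suc emul_assoc)
    also have "\<dots> = tmon (- (int q * i)) \<odot> ((eone + w) \<odot> epowi nv s i)"
      using w by (simp add: emul_assoc[symmetric] tmon_add algebra_simps)
    finally show ?thesis using w by (simp add: S_def emul_left_commute)
  qed
  have "T (S i)" for i
  proof (induction i rule: int_induct[of _ 0])
    case base thus ?case using T1 by (simp add: S_def tmon_0)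
  next
    case (step1 i) thus ?case using Tup Sstep by simp
  next
    case (step2 i) thus ?case using Tdown[of "S (i - 1)"] Sstep[of "i - 1"] SE by simp
  qed
  hence *: "nv (S i m) < \<epsilon>" if "m < c" for i m
    using that unfolding T_def by (metis emul_eone_right epow_0)
  have "int q * i - (- c) \<le> m" if "\<epsilon> \<le> nv (epowi nv s i m)" for i m
  proof (rule ccontr)
    assume "\<not> int q * i - (- c) \<le> m"
    hence "nv (S i (m - int q * i)) < \<epsilon>" by (intro *) linarith
    thus False using that by (simp add: S_def tmon_emul)
  qed
  thus ?thesis using that by blast
qed

lemma nv_epowi_s: "nv (epowi nv s i m) \<le> 1"
  using nv_le_gn[of "epowi nv s i" m] by (simp add: gn_epowi)

lemma scaled_epowi_tail:
  assumes a: "inE nv a" and e: "\<epsilon> > 0"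
  obtains c d where "\<And>i j m. \<epsilon> \<le> nv (a i * epowi nv s j m) \<Longrightarrow> c \<le> i \<and> int q * j - d \<le> m"
proof -
  have pos: "\<epsilon> / (gn a + 1) > 0" using e gn_ge0[OF a] by (auto simp: add_nonneg_pos)
  obtain c where c: "\<forall>i<c. nv (a i) < \<epsilon>" using inE_tail[OF a e] by blast
  obtain d where d: "\<And>i m. \<epsilon> / (gn a + 1) \<le> nv (epowi nv s i m) \<Longrightarrow> int q * i - d \<le> m"
    using epowi_s_tail[OF pos] by blast
  have "c \<le> i \<and> int q * j - d \<le> m" if le: "\<epsilon> \<le> nv (a i * epowi nv s j m)" for i j m
  proof
    have "nv (a i) * nv (epowi nv s j m) \<le> nv (a i) * 1"
      by (intro mult_left_mono nv_epowi_s) auto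
    hence "\<epsilon> \<le> nv (a i)" using le by (simp add: nv_mult)
    thus "c \<le> i" using c by (meson not_less)
    have "nv (a i) * nv (epowi nv s j m) \<le> (gn a + 1) * nv (epowi nv s j m)"
      using nv_le_gn[OF a, of i] by (intro mult_right_mono) auto
    hence "\<epsilon> / (gn a + 1) \<le> nv (epowi nv s j m)"
      using le gn_ge0[OF a] by (simp add: nv_mult pos_divide_le_eq add_nonneg_pos mult.commute)
    thus "int q * j - d \<le> m" by (rule d)
  qed
  thus ?thesis using that by blast
qed

lemma inE_phiK: "inE nv a \<Longrightarrow> inE nv (\<lambda>i. phiK (a i))"
  by (rule inE_mono[of a _ 1 0]) auto

lemma index_bound: "int q * i \<le> x \<Longrightarrow> i \<le> \<bar>x\<bar>"
proof (cases "i \<ge> 0")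
  case True
  assume le: "int q * i \<le> x"
  have "1 * i \<le> int q * i" using True q_ge2 by (intro mult_right_mono) auto
  thus ?thesis using le by simp
qed auto

lemma ephi_vanishing:
  assumes a: "inE nv a" shows "vanishing nv (\<lambda>i. phiK (a i) * epowi nv s i n)"
  unfolding vanishing_def
proof (intro allI impI)
  fix e :: real assume e: "e > 0"
  obtain c d where cd: "\<And>i j m. e \<le> nv (phiK (a i) * epowi nv s j m) \<Longrightarrow> c \<le> i \<and> int q * j - d \<le> m"
    using scaled_epowi_tail[OF inE_phiK[OF a] e] by blast
  have "i \<in> {c..\<bar>n + d\<bar>}" if "e \<le> nv (phiK (a i) * epowi nv s i n)" for i
    using cd[OF that] index_bound[of i "n + d"] by auto
  hence "{i. e \<le> nv (phiK (a i) * epowi nv s i n)} \<subseteq> {c..\<bar>n + d\<bar>}" by blast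
  thus "finite {i. e \<le> nv (phiK (a i) * epowi nv s i n)}" by (rule finite_subset) simp
qed

abbreviation phi :: "'k lau \<Rightarrow> 'k lau" where "phi \<equiv> ephi nv phiK s"

lemma nv_phi_le: assumes "inE nv a" shows "nv (phi a n) \<le> gn a"
  unfolding ephi_def
proof (rule kSum_bound[OF ephi_vanishing[OF assms]])
  fix i show "nv (phiK (a i) * epowi nv s i n) \<le> gn a"
    using mult_mono[OF nv_le_gn[OF assms, of i] nv_epowi_s[of i n]] gn_ge0[OF assms]
    by (simp add: nv_mult)
qed

lemma inE_phi [simp]: assumes a: "inE nv a" shows "inE nv (phi a)"
proof (rule inEI[OF nv_phi_le[OF a]])
  fix e :: real assume e: "e > 0"
  hence e2: "e / 2 > 0" by simp
  obtain c d where cd: "\<And>i j m. e / 2 \<le> nv (phiK (a i) * epowi nv s j m) \<Longrightarrow> c \<le> i \<and> int q * j - d \<le> m"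
    using scaled_epowi_tail[OF inE_phiK[OF a] e2] by blast
  have "nv (phi a n) < e" if n: "n < int q * c - d" for n
  proof -
    have "nv (phiK (a i) * epowi nv s i n) \<le> e / 2" for i
    proof (rule ccontr)
      assume "\<not> nv (phiK (a i) * epowi nv s i n) \<le> e / 2"
      hence "c \<le> i \<and> int q * i - d \<le> n" using cd[of i i n] by simp
      moreover from this have "int q * c \<le> int q * i" by (simp add: mult_left_mono)
      ultimately show False using n by linarith
    qed
    hence "nv (phi a n) \<le> e / 2" unfolding ephi_def by (intro kSum_bound ephi_vanishing a)
    thus ?thesis using e by simp
  qed
  thus "\<exists>c. \<forall>i<c. nv (phi a i) < e" by blast
qed

lemma gn_phi: "inE nv a \<Longrightarrow> gn (phi a) \<le> gn a"
  by (intro gn_le nv_phi_le)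

lemma phi_add: "inE nv a \<Longrightarrow> inE nv b \<Longrightarrow> phi (a + b) = phi a + phi b"
  by (auto simp: ephi_def fun_eq_iff phiK_add distrib_right intro!: kSum_add ephi_vanishing)

lemma phi_0 [simp]: "phi 0 = 0"
  by (auto simp: ephi_def fun_eq_iff)

lemma phi_eone [simp]: "phi eone = eone"
proof
  fix n show "phi eone n = eone n"
    unfolding ephi_def
    using kSum_single[of 0 "\<lambda>i. phiK (eone i) * epowi nv s i n"] by (simp add: eone_def)
qed

lemma phi_sum: "(\<And>x. x \<in> A \<Longrightarrow> inE nv (f x)) \<Longrightarrow> phi (sum f A) = (\<Sum>x\<in>A. phi (f x))"
  using sum_hom(2)[of "inE nv" phi A f] by (simp add: phi_add)

text \<open>An exchange of the sum over the coefficients of \<open>a\<close> with the convolution.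
  The second factor is arbitrary because \<open>phi_emul\<close> uses the formula both for
  \<open>phi b\<close> and for powers of \<open>s\<close>.\<close>

lemma phi_mult_coeff:
  assumes a: "inE nv a" and y: "inE nv y"
  shows "(phi a \<odot> y) n = kSum nv (\<lambda>i. phiK (a i) * (epowi nv s i \<odot> y) n)"
proof -
  have v: "vanishing nv (\<lambda>(m, i). phiK (a i) * epowi nv s i m * y (n - m))"
    unfolding vanishing_def
  proof (intro allI impI)
    fix e :: real assume e: "e > 0"
    define A where "A = gn a + 1"
    define Y where "Y = gn y + 1"
    have A: "A > 0" "nv (a i) \<le> A" and Y: "Y > 0" "nv (y i) \<le> Y" for i
      using gn_ge0[OF a] gn_ge0[OF y] nv_le_gn[OF a, of i] nv_le_gn[OF y, of i]
      by (auto simp: A_def Y_def)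
    obtain c d where cd: "\<And>i j m. e / Y \<le> nv (phiK (a i) * epowi nv s j m) \<Longrightarrow> c \<le> i \<and> int q * j - d \<le> m"
      using scaled_epowi_tail[OF inE_phiK[OF a], of "e / Y"] e Y(1) by auto
    obtain l where l: "\<forall>i<l. nv (y i) < e / A" using inE_tail[OF y, of "e / A"] e A(1) by auto
    have "(m, i) \<in> {int q * c - d .. n - l} \<times> {c .. \<bar>n - l + d\<bar>}"
      if le: "e \<le> nv (phiK (a i) * epowi nv s i m * y (n - m))" for m i
    proof -
      have "nv (phiK (a i) * epowi nv s i m) * nv (y (n - m)) \<le> nv (phiK (a i) * epowi nv s i m) * Y"
        using Y by (intro mult_left_mono) auto
      hence "e / Y \<le> nv (phiK (a i) * epowi nv s i m)"
        using le Y(1) by (simp add: nv_mult pos_divide_le_eq)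
      from cd[OF this] have 1: "c \<le> i" "int q * i - d \<le> m" by auto
      have "nv (a i) * nv (epowi nv s i m) * nv (y (n - m)) \<le> (A * 1) * nv (y (n - m))"
        using A by (intro mult_right_mono mult_mono nv_epowi_s) auto
      hence "e / A \<le> nv (y (n - m))"
        using le A(1) by (simp add: nv_mult pos_divide_le_eq mult.commute)
      hence 2: "l \<le> n - m" using l by (meson not_less)
      have "int q * c \<le> int q * i" using 1(1) by (simp add: mult_left_mono)
      moreover have "i \<le> \<bar>n - l + d\<bar>" using 1 2 by (intro index_bound) simp
      ultimately show ?thesis using 1 2 by auto
    qed
    hence "{x. e \<le> nv (case x of (m, i) \<Rightarrow> phiK (a i) * epowi nv s i m * y (n - m))}
        \<subseteq> {int q * c - d .. n - l} \<times> {c .. \<bar>n - l + d\<bar>}" by auto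
    thus "finite {x. e \<le> nv (case x of (m, i) \<Rightarrow> phiK (a i) * epowi nv s i m * y (n - m))}"
      by (rule finite_subset) simp
  qed
  have "(phi a \<odot> y) n = kSum nv (\<lambda>m. kSum nv (\<lambda>i. phiK (a i) * epowi nv s i m * y (n - m)))"
    unfolding emul_def ephi_def using kSum_cmult[OF ephi_vanishing[OF a]] by (simp add: mult.commute)
  also have "\<dots> = kSum nv (\<lambda>i. kSum nv (\<lambda>m. phiK (a i) * epowi nv s i m * y (n - m)))"
    by (rule kSum_swap[OF v])
  also have "\<dots> = kSum nv (\<lambda>i. phiK (a i) * (epowi nv s i \<odot> y) n)"
    unfolding emul_def using y by (simp add: mult.assoc kSum_cmult[OF emul_vanishing])
  finally show ?thesis .
qed

lemma phiK_kSum: assumes "vanishing nv f" shows "phiK (kSum nv f) = kSum nv (\<lambda>i. phiK (f i))"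
proof -
  have "kHasSum nv (\<lambda>i. phiK (f i)) (phiK (kSum nv f))"
    using vanishing_has_kSum[OF assms] unfolding kHasSum_def
    by (simp add: phiK_sum[symmetric] phiK_diff[symmetric])
  thus ?thesis using kSum_eqI by metis
qed

text \<open>Both factors are expanded in powers of s; the substitution l = i + j and an exchange of
  sums then collect the coefficient of s^l, a convolution of \<open>phiK\<close>-images.\<close>

lemma phi_emul:
  assumes a: "inE nv a" and b: "inE nv b" shows "phi (a \<odot> b) = phi a \<odot> phi b"
proof
  fix n
  define A where "A i = phiK (a i)" for i
  define B where "B i = phiK (b i)" for i
  have AE: "inE nv A" and BE: "inE nv B" unfolding A_def B_def using a b by (auto intro: inE_phiK)
  have "(phi a \<odot> phi b) n = kSum nv (\<lambda>i. A i * (phi b \<odot> epowi nv s i) n)"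
    using phi_mult_coeff[OF a, of "phi b" n] a b by (simp add: emul_comm A_def)
  also have "\<dots> = kSum nv (\<lambda>i. A i * kSum nv (\<lambda>j. B j * epowi nv s (j + i) n))"
    using phi_mult_coeff[OF b] by (simp add: epowi_add B_def)
  also have "\<dots> = kSum nv (\<lambda>i. kSum nv (\<lambda>l. A i * B (l - i) * epowi nv s l n))"
  proof (rule arg_cong[of _ _ "kSum nv"], rule ext)
    fix i
    define g where "g l = B (l - i) * epowi nv s l n" for l
    have v: "vanishing nv g"
    proof -
      have bE: "inE nv (tmon i \<odot> b)" using b by simp
      have "g = (\<lambda>l. phiK ((tmon i \<odot> b) l) * epowi nv s l n)"
        by (simp add: fun_eq_iff tmon_emul g_def B_def)
      thus ?thesis using ephi_vanishing[OF bE, of n] by simp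
    qed
    have "kSum nv (\<lambda>j. g (j + i)) = kSum nv g"
      by (rule kSum_reindex[OF v]) (auto intro: bij_betw_byWitness[where f' = "\<lambda>l. l - i"])
    hence "kSum nv (\<lambda>j. B j * epowi nv s (j + i) n) = kSum nv g" by (simp add: g_def)
    thus "A i * kSum nv (\<lambda>j. B j * epowi nv s (j + i) n)
        = kSum nv (\<lambda>l. A i * B (l - i) * epowi nv s l n)"
      using kSum_cmult[OF v, of "A i"] by (simp add: g_def mult.assoc)
  qed
  also have "\<dots> = kSum nv (\<lambda>l. kSum nv (\<lambda>i. A i * B (l - i) * epowi nv s l n))"
  proof (rule kSum_swap, unfold vanishing_def, intro allI impI)
    fix e :: real assume e: "e > 0"
    obtain c where c: "\<And>i j. e \<le> nv (A i) * nv (B j) \<Longrightarrow> c \<le> i \<and> c \<le> j"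
      using coeff_prod_tail[OF AE BE e] by blast
    define C where "C = gn A * gn B + 1"
    have C: "C > 0" "nv (A i) * nv (B j) \<le> C" for i j
      using mult_mono[OF nv_le_gn[OF AE, of i] nv_le_gn[OF BE, of j]] gn_ge0[OF AE] gn_ge0[OF BE]
      by (auto simp: C_def add_nonneg_pos)
    obtain d where d: "\<And>i m. e / C \<le> nv (epowi nv s i m) \<Longrightarrow> int q * i - d \<le> m"
      using epowi_s_tail[of "e / C"] e C(1) by auto
    have "(i, l) \<in> {c .. \<bar>n + d\<bar> - c} \<times> {2 * c .. \<bar>n + d\<bar>}"
      if le: "e \<le> nv (A i * B (l - i) * epowi nv s l n)" for i l
    proof -
      have "nv (A i) * nv (B (l - i)) * nv (epowi nv s l n) \<le> nv (A i) * nv (B (l - i)) * 1"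
        by (intro mult_left_mono nv_epowi_s) auto
      hence 1: "c \<le> i" "c \<le> l - i" using c[of i "l - i"] le by (auto simp: nv_mult)
      have "nv (A i) * nv (B (l - i)) * nv (epowi nv s l n) \<le> C * nv (epowi nv s l n)"
        using C by (intro mult_right_mono) auto
      hence "e / C \<le> nv (epowi nv s l n)"
        using le C(1) by (simp add: nv_mult pos_divide_le_eq mult.commute)
      hence "l \<le> \<bar>n + d\<bar>" using d[of l n] by (intro index_bound) simp
      thus ?thesis using 1 by auto
    qed
    hence "{x. e \<le> nv (case x of (i, l) \<Rightarrow> A i * B (l - i) * epowi nv s l n)}
        \<subseteq> {c .. \<bar>n + d\<bar> - c} \<times> {2 * c .. \<bar>n + d\<bar>}" by auto
    thus "finite {x. e \<le> nv (case x of (i, l) \<Rightarrow> A i * B (l - i) * epowi nv s l n)}"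
      by (rule finite_subset) simp
  qed
  also have "\<dots> = kSum nv (\<lambda>l. kSum nv (\<lambda>i. A i * B (l - i)) * epowi nv s l n)"
    using kSum_cmult[OF emul_vanishing[OF AE BE]] by (simp add: mult.commute)
  also have "\<dots> = phi (a \<odot> b) n"
    unfolding ephi_def emul_def using phiK_kSum[OF emul_vanishing[OF a b]]
    by (simp add: A_def B_def phiK_mult)
  finally show "phi (a \<odot> b) n = (phi a \<odot> phi b) n" by simp
qed

end

section \<open>Linear algebra over the field of bounded Laurent series\<close>

text \<open>The functional with coordinates \<open>x\<close> in the dual basis, evaluated at
  \<open>v\<close>. Functionals and vectors share one type, so the same lemmas serve subspaces of M
  and of its dual.\<close>

definition pr :: "('k::field \<Rightarrow> real) \<Rightarrow> nat \<Rightarrow> 'k vec \<Rightarrow> 'k vec \<Rightarrow> 'k lau" where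
  "pr nv n x v = (\<Sum>i<n. emul nv (x i) (v i))"

definition ev :: "nat \<Rightarrow> 'k::field vec" where
  "ev j = (\<lambda>i. if i = j then eone else 0)"

context complete_dvf
begin

abbreviation scale :: "'k lau \<Rightarrow> 'k vec \<Rightarrow> 'k vec"  (infixr "\<bullet>" 75)
  where "c \<bullet> v \<equiv> smul nv c v"

abbreviation evec :: "nat \<Rightarrow> 'k vec \<Rightarrow> bool" where "evec \<equiv> inEvec nv"

lemma evec_inE: "evec n v \<Longrightarrow> inE nv (v i)"
  by (cases "i < n") (auto simp: inEvec_def)

lemma evec_0 [simp]: "evec n 0"
  by (simp add: inEvec_def)

lemma evec_add [simp]: "evec n v \<Longrightarrow> evec n w \<Longrightarrow> evec n (v + w)"
  by (simp add: inEvec_def)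

lemma evec_diff [simp]: "evec n v \<Longrightarrow> evec n w \<Longrightarrow> evec n (v - w)"
  by (simp add: inEvec_def)

lemma evec_smul [simp]: "inE nv c \<Longrightarrow> evec n v \<Longrightarrow> evec n (c \<bullet> v)"
  by (simp add: inEvec_def smul_def)

lemma evec_sum [simp]: "(\<And>x. x \<in> A \<Longrightarrow> evec n (f x)) \<Longrightarrow> evec n (sum f A)"
  using sum_hom(1)[of "evec n" id A f] by simp

lemma evec_ev [simp]: "j < n \<Longrightarrow> evec n (ev j)"
  by (simp add: inEvec_def ev_def)

lemma smul_apply: "(c \<bullet> v) i = c \<odot> v i"
  by (simp add: smul_def)

lemma smul_0_left [simp]: "0 \<bullet> v = 0" and smul_0_right [simp]: "c \<bullet> 0 = 0"
  and smul_eone [simp]: "eone \<bullet> v = v"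
  by (auto simp: smul_def fun_eq_iff)

lemma smul_add_left: "inE nv c \<Longrightarrow> inE nv d \<Longrightarrow> evec n v \<Longrightarrow> (c + d) \<bullet> v = c \<bullet> v + d \<bullet> v"
  by (intro ext) (simp add: smul_apply emul_add_left evec_inE)

lemma smul_add_right: "inE nv c \<Longrightarrow> evec n v \<Longrightarrow> evec n w \<Longrightarrow> c \<bullet> (v + w) = c \<bullet> v + c \<bullet> w"
  by (intro ext) (simp add: smul_apply emul_add_right evec_inE)

lemma smul_minus_left: "inE nv c \<Longrightarrow> evec n v \<Longrightarrow> (- c) \<bullet> v = - (c \<bullet> v)"
  by (intro ext) (simp add: smul_apply emul_minus_left evec_inE)

lemma smul_minus_right: "inE nv c \<Longrightarrow> evec n v \<Longrightarrow> c \<bullet> (- v) = - (c \<bullet> v)"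
  by (intro ext) (simp add: smul_apply emul_minus_right evec_inE)

lemma smul_smul: "inE nv c \<Longrightarrow> inE nv d \<Longrightarrow> evec n v \<Longrightarrow> c \<bullet> (d \<bullet> v) = (c \<odot> d) \<bullet> v"
  by (intro ext) (simp add: smul_apply emul_assoc evec_inE)

lemma smul_sum_right:
  "inE nv c \<Longrightarrow> (\<And>x. x \<in> A \<Longrightarrow> evec n (f x)) \<Longrightarrow> c \<bullet> sum f A = (\<Sum>x\<in>A. c \<bullet> f x)"
  using sum_hom(2)[of "evec n" "\<lambda>v. c \<bullet> v" A f] by (simp add: smul_add_right)

lemma smul_sum_left:
  "evec n v \<Longrightarrow> (\<And>x. x \<in> A \<Longrightarrow> inE nv (f x)) \<Longrightarrow> sum f A \<bullet> v = (\<Sum>x\<in>A. f x \<bullet> v)"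
  using sum_hom(2)[of "inE nv" "\<lambda>c. c \<bullet> v" A f] by (simp add: smul_add_left)

lemma comb_apply: "(\<Sum>j\<in>A. c j \<bullet> f j) i = (\<Sum>j\<in>A. c j \<odot> f j i)"
  by (simp add: fun_sum_apply smul_apply)

lemma sum_delta: "finite A \<Longrightarrow> i \<in> A \<Longrightarrow> (\<Sum>j\<in>A. c j \<odot> (if j = i then eone else 0)) = c i"
  by (simp add: if_distrib[of "\<lambda>y. _ \<odot> y"] cong: if_cong)

lemma evec_expand: "evec n v \<Longrightarrow> v = (\<Sum>j<n. v j \<bullet> ev j)"
proof
  fix i assume v: "evec n v"
  show "v i = (\<Sum>j<n. v j \<bullet> ev j) i"
  proof (cases "i < n")
    case True
    thus ?thesis using sum_delta[of "{..<n}" i v] by (simp add: comb_apply ev_def eq_commute)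
  next
    case False
    hence "(\<Sum>j<n. v j \<odot> ev j i) = 0" by (intro sum.neutral) (auto simp: ev_def)
    thus ?thesis using v False by (simp add: comb_apply inEvec_def)
  qed
qed

lemma inE_pr [simp]: "evec n x \<Longrightarrow> evec n v \<Longrightarrow> inE nv (pr nv n x v)"
  by (simp add: pr_def evec_inE)

lemma pr_add_right: "evec n x \<Longrightarrow> evec n v \<Longrightarrow> evec n w \<Longrightarrow> pr nv n x (v + w) = pr nv n x v + pr nv n x w"
  by (simp add: pr_def evec_inE emul_add_right sum.distrib)

lemma pr_comm: "evec n x \<Longrightarrow> evec n v \<Longrightarrow> pr nv n x v = pr nv n v x"
  unfolding pr_def by (intro sum.cong refl emul_comm) (auto simp: evec_inE)

lemma pr_0 [simp]: "pr nv n x 0 = 0" "pr nv n 0 x = 0"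
  by (simp_all add: pr_def)

lemma pr_smul_right: "inE nv c \<Longrightarrow> evec n x \<Longrightarrow> evec n v \<Longrightarrow> pr nv n x (c \<bullet> v) = c \<odot> pr nv n x v"
  by (simp add: pr_def evec_inE smul_apply emul_sum_right emul_left_commute)

lemma pr_add_left: "evec n x \<Longrightarrow> evec n y \<Longrightarrow> evec n v \<Longrightarrow> pr nv n (x + y) v = pr nv n x v + pr nv n y v"
  by (simp add: pr_comm[of n _ v] pr_add_right)

lemma pr_smul_left: "inE nv c \<Longrightarrow> evec n x \<Longrightarrow> evec n v \<Longrightarrow> pr nv n (c \<bullet> x) v = c \<odot> pr nv n x v"
  by (simp add: pr_comm[of n _ v] pr_smul_right)

lemma pr_diff_right: "evec n x \<Longrightarrow> evec n v \<Longrightarrow> evec n w \<Longrightarrow> pr nv n x (v - w) = pr nv n x v - pr nv n x w"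
  by (simp add: pr_def evec_inE emul_diff_right sum_subtractf)

lemma pr_sum_right:
  "evec n x \<Longrightarrow> (\<And>a. a \<in> A \<Longrightarrow> evec n (f a)) \<Longrightarrow> pr nv n x (sum f A) = (\<Sum>a\<in>A. pr nv n x (f a))"
  using sum_hom(2)[of "evec n" "pr nv n x" A f] by (simp add: pr_add_right)

lemma pr_sum_left:
  "evec n v \<Longrightarrow> (\<And>a. a \<in> A \<Longrightarrow> evec n (f a)) \<Longrightarrow> pr nv n (sum f A) v = (\<Sum>a\<in>A. pr nv n (f a) v)"
  using sum_hom(2)[of "evec n" "\<lambda>x. pr nv n x v" A f] by (simp add: pr_add_left)

lemma pr_ev: "j < n \<Longrightarrow> pr nv n x (ev j) = x j"
  using sum_delta[of "{..<n}" j x] by (simp add: pr_def ev_def eq_commute)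

section \<open>Subspaces, echelon bases and annihilators\<close>

definition esub :: "nat \<Rightarrow> 'k vec set \<Rightarrow> bool" where
  "esub n N \<longleftrightarrow> (\<forall>v\<in>N. evec n v) \<and> 0 \<in> N \<and> (\<forall>v\<in>N. \<forall>w\<in>N. v + w \<in> N)
     \<and> (\<forall>c v. inE nv c \<longrightarrow> v \<in> N \<longrightarrow> c \<bullet> v \<in> N)"

lemma esub_evec: "esub n N \<Longrightarrow> v \<in> N \<Longrightarrow> evec n v"
  and esub_0: "esub n N \<Longrightarrow> 0 \<in> N"
  and esub_add: "esub n N \<Longrightarrow> v \<in> N \<Longrightarrow> w \<in> N \<Longrightarrow> v + w \<in> N"
  and esub_smul: "esub n N \<Longrightarrow> inE nv c \<Longrightarrow> v \<in> N \<Longrightarrow> c \<bullet> v \<in> N"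
  by (auto simp: esub_def)

lemma esub_minus: "esub n N \<Longrightarrow> v \<in> N \<Longrightarrow> - v \<in> N"
  using esub_smul[of n N "- eone" v] smul_minus_left[of eone n v] by (simp add: esub_evec)

lemma esub_diff: "esub n N \<Longrightarrow> v \<in> N \<Longrightarrow> w \<in> N \<Longrightarrow> v - w \<in> N"
  using esub_add[of n N v "- w"] esub_minus by auto

lemma esub_sum: "esub n N \<Longrightarrow> (\<And>x. x \<in> A \<Longrightarrow> f x \<in> N) \<Longrightarrow> sum f A \<in> N"
  using sum_hom(1)[of "\<lambda>v. v \<in> N" id A f] esub_0[of n N] esub_add[of n N] by simp

text \<open>Reduced echelon vectors with pivot set \<open>J\<close>: the coefficients of a
  combination of the \<open>b j\<close> are its entries at \<open>J\<close>. Spanning is kept apart,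
  because partial families enter the maximality argument of \<open>echelon_exists\<close>.\<close>

definition echelon :: "nat \<Rightarrow> 'k vec set \<Rightarrow> nat set \<Rightarrow> (nat \<Rightarrow> 'k vec) \<Rightarrow> bool" where
  "echelon n N J b \<longleftrightarrow> J \<subseteq> {..<n} \<and> (\<forall>j\<in>J. b j \<in> N)
     \<and> (\<forall>i\<in>J. \<forall>j\<in>J. b j i = (if j = i then eone else 0))"

text \<open>When the \<open>b j\<close> span N, this is the projection onto N along the vectors that
  vanish at all pivots.\<close>

definition eproj :: "nat set \<Rightarrow> (nat \<Rightarrow> 'k vec) \<Rightarrow> 'k vec \<Rightarrow> 'k vec" where
  "eproj J b v = (\<Sum>j\<in>J. v j \<bullet> b j)"

lemma echelon_finite: "echelon n N J b \<Longrightarrow> finite J"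
  unfolding echelon_def by (meson finite_lessThan finite_subset)

lemma eproj_apply: "echelon n N J b \<Longrightarrow> i \<in> J \<Longrightarrow> eproj J b v i = v i"
  using sum_delta[OF echelon_finite, of n N J b i v] by (simp add: eproj_def comb_apply echelon_def)

lemma eproj_in: "esub n N \<Longrightarrow> echelon n N J b \<Longrightarrow> evec n v \<Longrightarrow> eproj J b v \<in> N"
  unfolding eproj_def by (intro esub_sum esub_smul) (auto simp: echelon_def evec_inE)

text \<open>Take a pivot set maximal under inclusion. If some v in N were not recovered from its
  pivot entries, the difference would have a nonzero entry outside \<open>J\<close>; normalised
  there, it would supply a further pivot.\<close>

lemma echelon_exists:
  assumes N: "esub n N"
  obtains J b where "echelon n N J b" "\<And>v. v \<in> N \<Longrightarrow> eproj J b v = v"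
proof -
  define \<J> where "\<J> = {J. \<exists>b. echelon n N J b}"
  have "finite \<J>" by (rule finite_subset[of _ "Pow {..<n}"]) (auto simp: \<J>_def echelon_def)
  moreover have "{} \<in> \<J>" by (auto simp: \<J>_def echelon_def)
  ultimately obtain J where J: "J \<in> \<J>" "\<And>J'. J' \<in> \<J> \<Longrightarrow> J \<subseteq> J' \<Longrightarrow> J = J'"
    using finite_has_maximal[of \<J>] by auto
  then obtain b where b: "echelon n N J b" by (auto simp: \<J>_def)
  have "eproj J b v = v" if v: "v \<in> N" for v
  proof (rule ccontr)
    assume ne: "eproj J b v \<noteq> v"
    define w where "w = v - eproj J b v"
    have wN: "w \<in> N" unfolding w_def by (intro esub_diff[OF N] eproj_in[OF N b] v esub_evec[OF N])
    have wJ: "w i = 0" if "i \<in> J" for i using eproj_apply[OF b that] by (simp add: w_def)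
    have "w \<noteq> 0" using ne by (simp add: w_def)
    then obtain i where i: "w i \<noteq> 0" by (metis ext zero_fun_apply)
    have wE: "evec n w" using esub_evec[OF N wN] .
    have inn: "i < n" using i wE by (metis inEvec_def not_less)
    have iJ: "i \<notin> J" using i wJ by auto
    obtain c where c: "inE nv c" "w i \<odot> c = eone" using E_inverse[OF evec_inE[OF wE] i] by metis
    define w' where "w' = c \<bullet> w"
    have w'N: "w' \<in> N" unfolding w'_def by (intro esub_smul[OF N] c wN)
    have w'i: "w' i = eone" using c wE by (simp add: w'_def smul_apply emul_comm evec_inE)
    have w'J: "w' j = 0" if "j \<in> J" for j using wJ[OF that] by (simp add: w'_def smul_apply)
    define b' where "b' j = (if j = i then w' else b j - b j i \<bullet> w')" for j
    have bE: "inE nv (b j k)" if "j \<in> J" for j k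
      using b that by (auto simp: echelon_def intro!: evec_inE esub_evec[OF N])
    have "echelon n N (insert i J) b'"
      unfolding echelon_def
    proof (intro conjI ballI)
      show "insert i J \<subseteq> {..<n}" using b inn by (auto simp: echelon_def)
      fix j assume j: "j \<in> insert i J"
      show "b' j \<in> N"
        using j b bE by (auto simp: b'_def echelon_def w'N intro!: esub_diff[OF N] esub_smul[OF N])
      fix k assume k: "k \<in> insert i J"
      have bd: "\<And>k j. k \<in> J \<Longrightarrow> j \<in> J \<Longrightarrow> b j k = (if j = k then eone else 0)"
        using b by (simp add: echelon_def)
      show "b' k j = (if k = j then eone else 0)"
        using j k iJ bd by (auto simp: b'_def smul_apply w'i w'J)
    qed
    hence "insert i J \<in> \<J>" by (auto simp: \<J>_def)
    hence "J = insert i J" by (rule J(2)) auto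
    thus False using iJ by auto
  qed
  thus ?thesis using that b by blast
qed

text \<open>The coordinate \<open>i \<notin> J\<close> of \<open>v - eproj J b v\<close> as a linear functional of \<open>v\<close>.\<close>
definition cofun :: "nat set \<Rightarrow> (nat \<Rightarrow> 'k vec) \<Rightarrow> nat \<Rightarrow> 'k vec" where
  "cofun J b i = ev i - (\<Sum>j\<in>J. b j i \<bullet> ev j)"

lemma evec_cofun:
  assumes N: "esub n N" and b: "echelon n N J b" and i: "i < n" shows "evec n (cofun J b i)"
proof -
  have "inE nv (b j i)" "j < n" if "j \<in> J" for j
    using b that by (auto simp: echelon_def intro!: evec_inE esub_evec[OF N])
  thus ?thesis unfolding cofun_def using i by auto
qed

lemma pr_cofun:
  assumes N: "esub n N" and b: "echelon n N J b" and i: "i < n" and v: "evec n v"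
  shows "pr nv n (cofun J b i) v = (v - eproj J b v) i"
proof -
  have J: "inE nv (b j i)" "j < n" if "j \<in> J" for j
    using b that by (auto simp: echelon_def intro!: evec_inE esub_evec[OF N])
  have "pr nv n v (cofun J b i) = v i - (\<Sum>j\<in>J. pr nv n v (b j i \<bullet> ev j))"
    unfolding cofun_def using J v i by (simp add: pr_diff_right pr_sum_right pr_ev)
  also have "(\<Sum>j\<in>J. pr nv n v (b j i \<bullet> ev j)) = (\<Sum>j\<in>J. v j \<odot> b j i)"
    using J v by (intro sum.cong) (auto simp: pr_smul_right pr_ev emul_comm evec_inE)
  finally show ?thesis using v evec_cofun[OF N b i]
    by (simp add: pr_comm eproj_def comb_apply lau_fold)
qed

definition eann :: "nat \<Rightarrow> 'k vec set \<Rightarrow> 'k vec set" where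
  "eann n N = {x. evec n x \<and> (\<forall>v\<in>N. pr nv n x v = 0)}"

lemma esub_eann: "(\<And>v. v \<in> N \<Longrightarrow> evec n v) \<Longrightarrow> esub n (eann n N)"
  unfolding esub_def eann_def by (auto simp: pr_add_left pr_smul_left)

lemma cofun_in_eann:
  assumes N: "esub n N" and b: "echelon n N J b" "\<And>v. v \<in> N \<Longrightarrow> eproj J b v = v" and i: "i < n"
  shows "cofun J b i \<in> eann n N"
  unfolding eann_def using evec_cofun[OF N b(1) i] pr_cofun[OF N b(1) i] b(2) esub_evec[OF N] by auto

text \<open>The entries of \<open>v - eproj J b v\<close> are values of the functionals
  \<open>cofun J b i\<close>, which annihilate N. An element of the double annihilator therefore
  equals its projection.\<close>

lemma eann_eann: assumes N: "esub n N" shows "eann n (eann n N) = N"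
proof
  show "N \<subseteq> eann n (eann n N)"
    using esub_evec[OF N] by (auto simp: eann_def pr_comm)
  obtain J b where b: "echelon n N J b" "\<And>v. v \<in> N \<Longrightarrow> eproj J b v = v"
    using echelon_exists[OF N] by blast
  show "eann n (eann n N) \<subseteq> N"
  proof
    fix v assume v: "v \<in> eann n (eann n N)"
    hence vE: "evec n v" by (simp add: eann_def)
    have "(v - eproj J b v) i = 0" for i
    proof (cases "i < n")
      case True
      have c: "cofun J b i \<in> eann n N" by (rule cofun_in_eann[OF N b True])
      hence "pr nv n v (cofun J b i) = 0" using v by (simp add: eann_def)
      thus ?thesis using pr_cofun[OF N b(1) True vE] evec_cofun[OF N b(1) True] vE by (simp add: pr_comm)
    next
      case False
      thus ?thesis using vE esub_evec[OF N eproj_in[OF N b(1) vE]] by (simp add: inEvec_def lau_fold)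
    qed
    hence "v = eproj J b v" by (simp add: fun_eq_iff)
    thus "v \<in> N" using eproj_in[OF N b(1) vE] by simp
  qed
qed

text \<open>Gaussian elimination: \<open>J\<close> indexes equations and \<open>I\<close> unknowns.
  The equation \<open>j0\<close> is solved for an unknown \<open>i0\<close> with nonzero coefficient
  and substituted in the others, which removes one of each.\<close>

lemma homogeneous_system:
  fixes c :: "'i \<Rightarrow> 'j \<Rightarrow> 'k lau"
  assumes "finite J" "finite I" "card J < card I" "\<And>i j. i \<in> I \<Longrightarrow> j \<in> J \<Longrightarrow> inE nv (c i j)"
  shows "\<exists>d. (\<forall>i\<in>I. inE nv (d i)) \<and> (\<exists>i\<in>I. d i \<noteq> 0) \<and> (\<forall>j\<in>J. (\<Sum>i\<in>I. d i \<odot> c i j) = 0)"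
  using assms
proof (induction J arbitrary: I c rule: finite_induct)
  case empty
  hence "I \<noteq> {}" by auto
  thus ?case by (intro exI[of _ "\<lambda>_. eone"]) (auto simp: lau_fold)
next
  case (insert j0 J)
  show ?case
  proof (cases "\<forall>i\<in>I. c i j0 = 0")
    case True
    have "card J < card I" using insert by auto
    hence "\<exists>d. (\<forall>i\<in>I. inE nv (d i)) \<and> (\<exists>i\<in>I. d i \<noteq> 0) \<and> (\<forall>j\<in>J. (\<Sum>i\<in>I. d i \<odot> c i j) = 0)"
      using insert.prems by (intro insert.IH) auto
    then obtain d where "\<forall>i\<in>I. inE nv (d i)" "\<exists>i\<in>I. d i \<noteq> 0" "\<forall>j\<in>J. (\<Sum>i\<in>I. d i \<odot> c i j) = 0"
      by blast
    moreover have "(\<Sum>i\<in>I. d i \<odot> c i j0) = 0" using True by simp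
    ultimately show ?thesis by blast
  next
    case False
    then obtain i0 where i0: "i0 \<in> I" "c i0 j0 \<noteq> 0" by blast
    have cE: "inE nv (c i j)" if "i \<in> I" "j \<in> insert j0 J" for i j using insert.prems that by auto
    obtain e where e: "inE nv e" "c i0 j0 \<odot> e = eone" using E_inverse[OF cE[OF i0(1)] i0(2)] by auto
    define I' where "I' = I - {i0}"
    have I': "finite I'" "i0 \<notin> I'" "I = insert i0 I'" "card J < card I'"
      using insert i0 by (auto simp: I'_def)
    define c' where "c' i j = c i j - (c i j0 \<odot> e) \<odot> c i0 j" for i j
    have "inE nv (c' i j)" if "i \<in> I'" "j \<in> J" for i j
      using that I' cE e i0 by (simp add: c'_def)
    from insert.IH[OF I'(1,4), of c', OF this]
    obtain d where d: "\<And>i. i \<in> I' \<Longrightarrow> inE nv (d i)" "\<exists>i\<in>I'. d i \<noteq> 0"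
      "\<And>j. j \<in> J \<Longrightarrow> (\<Sum>i\<in>I'. d i \<odot> c' i j) = 0" by blast
    define d0 where "d0 = - (\<Sum>i\<in>I'. d i \<odot> (c i j0 \<odot> e))"
    have d0E: "inE nv d0" unfolding d0_def using d cE e I' by auto
    define d' where "d' = d(i0 := d0)"
    have sum: "(\<Sum>i\<in>I. d' i \<odot> c i j) = (\<Sum>i\<in>I'. d i \<odot> c' i j)" if j: "j \<in> insert j0 J" for j
    proof -
      have "(\<Sum>i\<in>I'. d' i \<odot> c i j) = (\<Sum>i\<in>I'. d i \<odot> c i j)"
        using I'(2) by (intro sum.cong) (auto simp: d'_def)
      moreover have "d0 \<odot> c i0 j = - (\<Sum>i\<in>I'. d i \<odot> ((c i j0 \<odot> e) \<odot> c i0 j))"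
        unfolding d0_def using d cE e I' j
        by (simp add: emul_minus_left emul_sum_left emul_assoc)
      ultimately have "(\<Sum>i\<in>I. d' i \<odot> c i j)
          = (\<Sum>i\<in>I'. d i \<odot> c i j) - (\<Sum>i\<in>I'. d i \<odot> ((c i j0 \<odot> e) \<odot> c i0 j))"
        using I' by (simp add: d'_def)
      also have "\<dots> = (\<Sum>i\<in>I'. d i \<odot> c' i j)"
        unfolding sum_subtractf[symmetric] c'_def
        by (intro sum.cong refl emul_diff_right[symmetric]) (use d cE e I' j in auto)
      finally show ?thesis .
    qed
    have "c' i j0 = 0" if "i \<in> I'" for i
      using that cE e I' by (simp add: c'_def emul_assoc emul_comm[of e])
    hence "(\<Sum>i\<in>I'. d i \<odot> c' i j0) = 0" by simp
    hence "\<forall>j\<in>insert j0 J. (\<Sum>i\<in>I. d' i \<odot> c i j) = 0" using sum d(3) by auto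
    moreover have "\<forall>i\<in>I. inE nv (d' i)" using d(1) d0E I'(3) by (auto simp: d'_def)
    moreover have "\<exists>i\<in>I. d' i \<noteq> 0" using d(2) I' by (auto simp: d'_def)
    ultimately show ?thesis by blast
  qed
qed

section \<open>Dimension and independent families\<close>

lemma indep_card_le:
  assumes "finite S" "\<And>v. v \<in> S \<Longrightarrow> evec n v" "e_indep nv S" shows "card S \<le> n"
proof (rule ccontr)
  assume "\<not> card S \<le> n"
  hence "card {..<n} < card S" by simp
  hence "\<exists>d. (\<forall>v\<in>S. inE nv (d v)) \<and> (\<exists>v\<in>S. d v \<noteq> 0)
      \<and> (\<forall>j\<in>{..<n}. (\<Sum>v\<in>S. d v \<odot> v j) = 0)"
    by (intro homogeneous_system) (auto simp: assms(1) intro: evec_inE[OF assms(2)])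
  then obtain d where d: "\<forall>v\<in>S. inE nv (d v)" "\<exists>v\<in>S. d v \<noteq> 0" "\<forall>j<n. (\<Sum>v\<in>S. d v \<odot> v j) = 0"
    by blast
  have "(\<Sum>v\<in>S. d v \<bullet> v) i = 0" for i
  proof (cases "i < n")
    case False
    thus ?thesis using assms(2) by (simp add: fun_sum_apply smul_apply inEvec_def lau_fold)
  qed (use d in \<open>simp add: fun_sum_apply smul_apply\<close>)
  hence "(\<Sum>v\<in>S. d v \<bullet> v) = 0" by (simp add: fun_eq_iff)
  thus False using assms(3) d unfolding e_indep_def by blast
qed

lemma dimE_set_finite:
  assumes "\<And>v. v \<in> N \<Longrightarrow> evec n v"
  shows "finite {card S | S. finite S \<and> S \<subseteq> N \<and> e_indep nv S}"
    and "{card S | S. finite S \<and> S \<subseteq> N \<and> e_indep nv S} \<noteq> {}"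
proof -
  have "{card S | S. finite S \<and> S \<subseteq> N \<and> e_indep nv S} \<subseteq> {..n}"
    using indep_card_le assms by blast
  thus "finite {card S | S. finite S \<and> S \<subseteq> N \<and> e_indep nv S}" by (rule finite_subset) simp
  have "e_indep nv {}" by (simp add: e_indep_def)
  thus "{card S | S. finite S \<and> S \<subseteq> N \<and> e_indep nv S} \<noteq> {}" by blast
qed

lemma dimE_witness:
  assumes "\<And>v. v \<in> N \<Longrightarrow> evec n v"
  obtains S where "finite S" "S \<subseteq> N" "e_indep nv S" "dimE nv N = card S"
proof -
  have "dimE nv N \<in> {card S | S. finite S \<and> S \<subseteq> N \<and> e_indep nv S}"
    unfolding dimE_def by (rule Max_in; rule dimE_set_finite[of N n]; rule assms)
  thus ?thesis using that by blast
qed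

lemma dimE_le: assumes "\<And>v. v \<in> N \<Longrightarrow> evec n v" shows "dimE nv N \<le> n"
proof -
  obtain S where "finite S" "S \<subseteq> N" "e_indep nv S" "dimE nv N = card S"
    using dimE_witness[of N n] assms by blast
  thus ?thesis using indep_card_le[of S n] assms by auto
qed

lemma dimE_mono:
  assumes "\<And>v. v \<in> N' \<Longrightarrow> evec n v" "N \<subseteq> N'" shows "dimE nv N \<le> dimE nv N'"
  unfolding dimE_def
proof (rule Max_mono)
  show "{card S | S. finite S \<and> S \<subseteq> N \<and> e_indep nv S} \<noteq> {}"
    by (rule dimE_set_finite(2)[of N n]) (use assms in blast)
  show "finite {card S | S. finite S \<and> S \<subseteq> N' \<and> e_indep nv S}"
    by (rule dimE_set_finite(1)) (rule assms(1))
qed (use assms(2) in blast)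

lemma dimE_eq_imp_eq:
  assumes N: "esub n N" and N': "\<And>v. v \<in> N' \<Longrightarrow> evec n v" "N \<subseteq> N'"
    and d: "dimE nv N = dimE nv N'"
  shows "N = N'"
proof (rule ccontr)
  assume "N \<noteq> N'"
  then obtain v where v: "v \<in> N'" "v \<notin> N" using N'(2) by blast
  obtain S where S: "finite S" "S \<subseteq> N" "e_indep nv S" "dimE nv N = card S"
    using dimE_witness[of N n] esub_evec[OF N] by blast
  have "e_indep nv (insert v S)"
    unfolding e_indep_def
  proof (intro allI impI, elim conjE)
    fix c assume c: "\<forall>w\<in>insert v S. inE nv (c w)" "(\<Sum>w\<in>insert v S. c w \<bullet> w) = 0"
    have vS: "v \<notin> S" using v S by auto
    hence sum: "c v \<bullet> v + (\<Sum>w\<in>S. c w \<bullet> w) = 0" using c(2) S(1) by simp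
    have cv: "c v = 0"
    proof (rule ccontr)
      assume "c v \<noteq> 0"
      then obtain e where e: "inE nv e" "c v \<odot> e = eone" using E_inverse c(1) by (metis insertI1)
      have "(\<Sum>w\<in>S. c w \<bullet> w) \<in> N" using c S by (intro esub_sum[OF N] esub_smul[OF N]) auto
      moreover have "c v \<bullet> v = - (\<Sum>w\<in>S. c w \<bullet> w)" using sum by (simp add: eq_neg_iff_add_eq_0)
      ultimately have "c v \<bullet> v \<in> N" using esub_minus[OF N] by simp
      hence "e \<bullet> (c v \<bullet> v) \<in> N" using esub_smul[OF N e(1)] by simp
      moreover have "e \<bullet> (c v \<bullet> v) = v"
        using e c(1) N'(1)[OF v(1)] by (simp add: smul_smul emul_comm)
      ultimately show False using v by simp
    qed
    have "(\<Sum>w\<in>S. c w \<bullet> w) = 0" using sum cv by simp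
    hence "\<forall>w\<in>S. c w = 0" using S(3) c(1) unfolding e_indep_def by blast
    thus "\<forall>w\<in>insert v S. c w = 0" using cv by simp
  qed
  moreover have "card (insert v S) = Suc (card S)" using v S by (subst card_insert_disjoint) auto
  moreover have "insert v S \<subseteq> N'" using v S N'(2) by auto
  ultimately have "Suc (card S) \<in> {card S | S. finite S \<and> S \<subseteq> N' \<and> e_indep nv S}"
    using S(1) by (metis (mono_tags, lifting) finite_insert mem_Collect_eq)
  hence "Suc (card S) \<le> dimE nv N'"
    unfolding dimE_def by (intro Max_ge dimE_set_finite(1)) (rule N'(1))
  thus False using d S(4) by simp
qed

text \<open>The \<open>u j\<close> together with v are one more than the pivots, so a nontrivial
  combination vanishes at every pivot; lying in N, it is 0. Independence of the \<open>u j\<close>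
  forces a nonzero coefficient at v.\<close>

lemma independent_spans:
  assumes N: "esub n N" and b: "echelon n N J b" "\<And>v. v \<in> N \<Longrightarrow> eproj J b v = v"
    and u: "\<And>j. j \<in> J \<Longrightarrow> u j \<in> N"
    and ind: "\<And>d. (\<And>j. j \<in> J \<Longrightarrow> inE nv (d j)) \<Longrightarrow> (\<Sum>j\<in>J. d j \<bullet> u j) = 0 \<Longrightarrow> (\<And>j. j \<in> J \<Longrightarrow> d j = 0)"
    and v: "v \<in> N"
  obtains d where "\<And>j. j \<in> J \<Longrightarrow> inE nv (d j)" "v = (\<Sum>j\<in>J. d j \<bullet> u j)"
proof -
  have J: "finite J" by (rule echelon_finite[OF b(1)])
  \<comment> \<open>\<open>None\<close> indexes v, so a coincidence of v with some
    \<open>u j\<close> does no harm.\<close>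
  define I where "I = insert None (Some ` J)"
  define U where "U i = (case i of None \<Rightarrow> v | Some j \<Rightarrow> u j)" for i
  have I: "finite I" "card J < card I"
    unfolding I_def using J by (auto simp: card_image)
  have U: "U i \<in> N" if "i \<in> I" for i using that u v by (auto simp: I_def U_def)
  have UE: "inE nv (U i j)" if "i \<in> I" for i j using evec_inE[OF esub_evec[OF N U[OF that]]] .
  obtain d where d: "\<forall>i\<in>I. inE nv (d i)" "\<exists>i\<in>I. d i \<noteq> 0" "\<forall>j\<in>J. (\<Sum>i\<in>I. d i \<odot> U i j) = 0"
    using homogeneous_system[OF J I, of U] UE by auto
  define w where "w = (\<Sum>i\<in>I. d i \<bullet> U i)"
  have wN: "w \<in> N" unfolding w_def using d U by (intro esub_sum[OF N] esub_smul[OF N]) auto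
  have "w j = 0" if "j \<in> J" for j using d(3) that by (simp add: w_def comb_apply)
  hence "eproj J b w = 0" by (simp add: eproj_def)
  hence "w = 0" using b(2)[OF wN] by simp
  moreover have "w = d None \<bullet> v + (\<Sum>j\<in>J. d (Some j) \<bullet> u j)"
    unfolding w_def I_def using J by (simp add: sum.reindex U_def)
  ultimately have rel: "d None \<bullet> v + (\<Sum>j\<in>J. d (Some j) \<bullet> u j) = 0" by simp
  have dE: "inE nv (d None)" "\<And>j. j \<in> J \<Longrightarrow> inE nv (d (Some j))" using d(1) by (auto simp: I_def)
  have "d None \<noteq> 0"
  proof
    assume z: "d None = 0"
    have "d (Some j) = 0" if "j \<in> J" for j
      using ind[of "\<lambda>j. d (Some j)"] dE rel z that by simp
    thus False using d(2) z by (auto simp: I_def)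
  qed
  then obtain e where e: "inE nv e" "d None \<odot> e = eone" using E_inverse dE by metis
  have uE: "evec n (u j)" if "j \<in> J" for j using u[OF that] esub_evec[OF N] by blast
  have "v = e \<bullet> (d None \<bullet> v)"
    using e dE esub_evec[OF N v] by (simp add: smul_smul emul_comm)
  also have "d None \<bullet> v = - (\<Sum>j\<in>J. d (Some j) \<bullet> u j)" using rel by (simp add: eq_neg_iff_add_eq_0)
  also have "e \<bullet> \<dots> = - (e \<bullet> (\<Sum>j\<in>J. d (Some j) \<bullet> u j))"
    using e dE uE by (intro smul_minus_right[of _ n]) auto
  also have "\<dots> = - (\<Sum>j\<in>J. (e \<odot> d (Some j)) \<bullet> u j)"
    using e dE uE by (simp add: smul_sum_right[of _ _ n] smul_smul[of _ _ n])
  also have "\<dots> = (\<Sum>j\<in>J. (- (e \<odot> d (Some j))) \<bullet> u j)"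
    unfolding sum_negf[symmetric] using e dE uE by (intro sum.cong refl) (simp add: smul_minus_left[of _ n])
  finally show ?thesis using that[of "\<lambda>j. - (e \<odot> d (Some j))"] e dE by simp
qed

section \<open>Modules over the valuation ring of E and a Hahn-Banach theorem\<close>

definition ball_module :: "nat \<Rightarrow> 'k vec set \<Rightarrow> bool" where
  "ball_module n P \<longleftrightarrow> (\<forall>v\<in>P. evec n v) \<and> 0 \<in> P \<and> (\<forall>v\<in>P. \<forall>w\<in>P. v + w \<in> P)
     \<and> (\<forall>c v. inE nv c \<longrightarrow> gn c \<le> 1 \<longrightarrow> v \<in> P \<longrightarrow> c \<bullet> v \<in> P)"

lemma ball_evec: "ball_module n P \<Longrightarrow> v \<in> P \<Longrightarrow> evec n v"
  and ball_0: "ball_module n P \<Longrightarrow> 0 \<in> P"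
  and ball_add: "ball_module n P \<Longrightarrow> v \<in> P \<Longrightarrow> w \<in> P \<Longrightarrow> v + w \<in> P"
  and ball_smul: "ball_module n P \<Longrightarrow> inE nv c \<Longrightarrow> gn c \<le> 1 \<Longrightarrow> v \<in> P \<Longrightarrow> c \<bullet> v \<in> P"
  by (auto simp: ball_module_def)

lemma ball_diff: assumes P: "ball_module n P" and v: "v \<in> P" and w: "w \<in> P" shows "v - w \<in> P"
proof -
  have "(- eone) \<bullet> w \<in> P" using w by (intro ball_smul[OF P]) auto
  moreover have "(- eone) \<bullet> w = - w"
    using smul_minus_left[of eone n w] ball_evec[OF P w] by simp
  ultimately show ?thesis using ball_add[OF P v, of "- w"] by simp
qed

lemma ball_sum: "ball_module n P \<Longrightarrow> (\<And>x. x \<in> A \<Longrightarrow> f x \<in> P) \<Longrightarrow> sum f A \<in> P"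
  using sum_hom(1)[of "\<lambda>v. v \<in> P" id A f] ball_0[of n P] ball_add[of n P] by simp

definition pw :: "nat \<Rightarrow> 'k lau" where "pw k = ksc (of_nat p ^ k) eone"
definition pwi :: "nat \<Rightarrow> 'k lau" where "pwi k = ksc (inverse (of_nat p ^ k)) eone"

lemma p_neq0: "(of_nat p :: 'k) \<noteq> 0"
  using p_prime by (simp add: prime_gt_0_nat)

lemma inE_pw [simp]: "inE nv (pw k)" "inE nv (pwi k)"
  by (simp_all add: pw_def pwi_def)

lemma gn_pw: "gn (pw k) = (1 / real p) ^ k"
  by (simp add: pw_def nv_power nv_p)

lemma pw_pwi: "pw k \<odot> pwi k = eone"
  using p_neq0 by (simp add: pw_def pwi_def emul_ksc_left)

lemma pw_diff: "k \<le> l \<Longrightarrow> pw (l - k) \<odot> pwi l = pwi k"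
  using p_neq0 by (simp add: pw_def pwi_def emul_ksc_left power_diff field_simps)

lemma p_inv_less1: "1 / real p < 1" and p_inv_pos: "0 < 1 / real p"
  using prime_ge_2_nat[OF p_prime] by auto

lemma pw_small: obtains k where "(1 / real p) ^ k * B \<le> 1"
proof (cases "B > 0")
  case True
  then obtain k where "(1 / real p) ^ k < 1 / B"
    using real_arch_pow_inv[of "1 / B"] p_inv_less1 by auto
  hence "(1 / real p) ^ k * B < 1" by (simp only: pos_less_divide_eq[OF True])
  thus ?thesis using that[of k] by simp
next
  case False
  thus ?thesis using that[of 0] by simp
qed

lemma upd_add: "(u::'k vec)(n := c) + v(n := d) = (u + v)(n := c + d)"
  and upd_diff: "u(n := c) - v(n := d) = (u - v)(n := c - d)"
  and smul_upd: "e \<bullet> (u(n := c)) = (e \<bullet> u)(n := e \<odot> c)"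
  by (auto simp: fun_eq_iff smul_apply)

lemma evec_cut: "evec (Suc n) v \<Longrightarrow> evec n (v(n := 0))"
  by (auto simp: inEvec_def lau_fold le_Suc_eq)

text \<open>If P met the last coordinate line in vectors of unbounded size, it would contain the
  whole line, being stable under scalars of norm at most 1. Since P also projects onto the first n
  coordinates, it would contain \<open>w\<close>.\<close>

lemma last_line_bounded:
  assumes P: "ball_module (Suc n) P"
    and proj: "\<And>u. evec n u \<Longrightarrow> \<exists>c. inE nv c \<and> u(n := c) \<in> P"
    and w: "evec (Suc n) w" "w \<notin> P"
  shows "\<exists>C\<ge>1. \<forall>c. inE nv c \<longrightarrow> 0(n := c) \<in> P \<longrightarrow> gn c \<le> C"
proof (rule ccontr)
  assume unb: "\<not> ?thesis"
  have line: "0(n := a) \<in> P" if a: "inE nv a" for a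
  proof -
    have "max 1 (gn a) \<ge> 1" by simp
    then obtain c where c: "inE nv c" "0(n := c) \<in> P" "gn c > max 1 (gn a)"
      using unb by (meson not_le)
    hence "c \<noteq> 0" by force
    then obtain e where e: "inE nv e" "c \<odot> e = eone" "gn e \<le> 1 / gn c" using E_inverse c(1) by metis
    have "gn (a \<odot> e) \<le> gn c * (1 / gn c)" using a e c by (intro gn_emul_bound) auto
    also have "\<dots> = 1" using c(3) by simp
    finally have "(a \<odot> e) \<bullet> (0(n := c)) \<in> P" using a e c by (intro ball_smul[OF P]) auto
    moreover have "(a \<odot> e) \<odot> c = a" using a e c by (simp add: emul_assoc emul_comm[of e])
    ultimately show ?thesis by (simp add: smul_upd)
  qed
  obtain c where c: "inE nv c" "(w(n := 0))(n := c) \<in> P" using proj[OF evec_cut[OF w(1)]] by blast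
  have "0(n := w n - c) \<in> P" using line c w evec_inE by simp
  from ball_add[OF P c(2) this] have "((w(n := 0)) + 0)(n := c + (w n - c)) \<in> P"
    by (simp only: upd_add)
  thus False using w(2) by simp
qed

text \<open>Lift p^-k e_i to P with last coordinate \<open>c i k\<close>. A lift for l \<ge> k,
  scaled down to level k, differs from the one for k by a vector on the last line, of size at most
  C; after multiplication by p^k the last coordinates thus form a Cauchy sequence. With the limits
  \<open>T i\<close>, the functional is v_n - \<Sum> \<open>T i\<close> v_i.\<close>

lemma bounded_functional_from_limits:
  assumes P: "ball_module (Suc n) P"
    and proj: "\<And>u. evec n u \<Longrightarrow> \<exists>c. inE nv c \<and> u(n := c) \<in> P"
    and C1: "C \<ge> 1" and C: "\<And>c. inE nv c \<Longrightarrow> 0(n := c) \<in> P \<Longrightarrow> gn c \<le> C"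
  shows "\<exists>x. evec (Suc n) x \<and> x \<noteq> 0 \<and> (\<exists>C. \<forall>v\<in>P. gn (pr nv (Suc n) x v) \<le> C)"
proof -
  have "\<forall>i k. \<exists>c. i < n \<longrightarrow> inE nv c \<and> (pwi k \<bullet> ev i)(n := c) \<in> P"
    using proj by (meson evec_ev evec_smul inE_pw(2))
  then obtain c where c: "\<And>i k. i < n \<Longrightarrow> inE nv (c i k)"
    "\<And>i k. i < n \<Longrightarrow> (pwi k \<bullet> ev i)(n := c i k) \<in> P" by metis
  define t where "t i k = pw k \<odot> c i k" for i k
  have tE: "inE nv (t i k)" if "i < n" for i k using c(1)[OF that] by (simp add: t_def)
  have le1: "gn (pw k) \<le> 1" for k
    unfolding gn_pw using p_inv_less1 p_inv_pos by (intro power_le_one) auto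
  have step: "gn (t i l - t i k) \<le> (1 / real p) ^ k * C" if i: "i < n" and kl: "k \<le> l" for i k l
  proof -
    define z where "z = pw (l - k) \<odot> c i l - c i k"
    have zE: "inE nv z" unfolding z_def using c(1)[OF i] by simp
    have "pw (l - k) \<bullet> ((pwi l \<bullet> ev i)(n := c i l)) - (pwi k \<bullet> ev i)(n := c i k) \<in> P"
      using c(2)[OF i] le1 by (intro ball_diff[OF P] ball_smul[OF P]) auto
    moreover have "pw (l - k) \<bullet> (pwi l \<bullet> ev i) = pwi k \<bullet> ev i"
      using pw_diff[OF kl] i by (simp add: smul_smul[of _ _ n])
    ultimately have "0(n := z) \<in> P" by (simp add: smul_upd upd_diff z_def)
    hence "gn z \<le> C" using C zE by simp
    moreover have "t i l - t i k = pw k \<odot> z"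
    proof -
      have "pw k \<odot> pw (l - k) = pw l"
        using kl by (simp add: pw_def emul_ksc_left power_add[symmetric])
      thus ?thesis unfolding z_def t_def using c(1)[OF i]
        by (simp add: emul_diff_right emul_assoc[symmetric])
    qed
    ultimately show ?thesis
      using gn_emul_bound[of "pw k" z "(1 / real p) ^ k" C] zE by (simp add: gn_pw)
  qed
  have lim: "\<exists>T. inE nv T \<and> (\<forall>k. gn (T - t i k) \<le> (1 / real p) ^ k * C)" if i: "i < n" for i
  proof -
    have cauchy: "\<exists>N. \<forall>m\<ge>N. \<forall>k\<ge>N. gn (t i m - t i k) \<le> e" if e: "e > 0" for e
    proof -
      obtain N where N: "(1 / real p) ^ N * (C / e) \<le> 1" using pw_small by blast
      hence N: "(1 / real p) ^ N * C \<le> e"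
        using e by (simp only: times_divide_eq_right pos_divide_le_eq mult_1)
      have "gn (t i m - t i k) \<le> e" if "m \<ge> N" "k \<ge> N" for m k
      proof -
        have "gn ((t i m - t i N) - (t i k - t i N)) \<le> (1 / real p) ^ N * C"
          using that i tE by (intro gn_diff[of "t i m - t i N"] step) auto
        thus ?thesis using N by simp
      qed
      thus ?thesis by blast
    qed
    obtain T where T: "inE nv T" "econv (t i) T" using E_complete[of "t i"] tE[OF i] cauchy by metis
    have "gn (T - t i k) \<le> (1 / real p) ^ k * C" for k
    proof -
      have pos: "(1 / real p) ^ k * C > 0" using p_inv_pos C1 by simp
      then obtain N where N: "\<forall>m\<ge>N. gn (t i m - T) \<le> (1 / real p) ^ k * C"
        using T(2) unfolding econv_def by blast
      define m where "m = max N k"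
      have "gn ((t i m - t i k) - (t i m - T)) \<le> (1 / real p) ^ k * C"
        using N i tE T by (intro gn_diff[of "t i m - t i k"] step) (auto simp: m_def)
      thus ?thesis by simp
    qed
    thus ?thesis using T(1) by blast
  qed
  then obtain T where T: "\<And>i. i < n \<Longrightarrow> inE nv (T i)"
    "\<And>i k. i < n \<Longrightarrow> gn (T i - t i k) \<le> (1 / real p) ^ k * C" by metis
  define x where "x i = (if i < n then - T i else if i = n then eone else 0)" for i
  have xE: "evec (Suc n) x" using T(1) by (auto simp: inEvec_def x_def lau_fold)
  have "x n = eone" by (simp add: x_def)
  hence x0: "x \<noteq> 0" by (metis eone_neq0 zero_fun_apply)
  have "gn (pr nv (Suc n) x v) \<le> C" if v: "v \<in> P" for v
  proof -
    have vE: "inE nv (v i)" for i using evec_inE[OF ball_evec[OF P v]] .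
    \<comment> \<open>This k depends on v: it makes every p^k v_i a scalar of norm at most 1,
      admissible as a coefficient of the lifts. The resulting bound C does not depend on k.\<close>
    obtain k where k: "(1 / real p) ^ k * (\<Sum>i<n. gn (v i)) \<le> 1" using pw_small by blast
    have vk: "(1 / real p) ^ k * gn (v i) \<le> 1" if "i < n" for i
    proof -
      have "gn (v i) \<le> (\<Sum>i<n. gn (v i))" using that vE by (intro member_le_sum) auto
      hence "(1 / real p) ^ k * gn (v i) \<le> (1 / real p) ^ k * (\<Sum>i<n. gn (v i))"
        by (intro mult_left_mono) auto
      thus ?thesis using k by linarith
    qed
    define z where "z = v n - (\<Sum>i<n. v i \<odot> t i k)"
    have zE: "inE nv z" unfolding z_def
      by (intro inE_diff inE_sum inE_emul vE tE) auto
    have "v - (\<Sum>i<n. (pw k \<odot> v i) \<bullet> ((pwi k \<bullet> ev i)(n := c i k))) \<in> P"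
    proof (intro ball_diff[OF P v] ball_sum[OF P] ball_smul[OF P] c(2))
      fix i assume "i \<in> {..<n}"
      thus "gn (pw k \<odot> v i) \<le> 1" using vk[of i] vE by (simp add: gn_emul gn_pw)
    qed (use vE in auto)
    moreover have "v - (\<Sum>i<n. (pw k \<odot> v i) \<bullet> ((pwi k \<bullet> ev i)(n := c i k))) = 0(n := z)"
    proof
      fix j
      have *: "((pw k \<odot> v i) \<bullet> ((pwi k \<bullet> ev i)(n := c i k))) j
          = (if j = n then v i \<odot> t i k else v i \<odot> (if i = j then eone else 0))" if "i < n" for i
      proof -
        have "(pw k \<odot> v i) \<odot> c i k = v i \<odot> t i k"
          using vE c(1)[OF that] by (simp add: t_def emul_ac)
        moreover have "(pw k \<odot> v i) \<odot> pwi k = v i"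
          using vE by (simp add: emul_assoc emul_comm[of "v i"] emul_assoc[symmetric] pw_pwi)
        ultimately show ?thesis by (auto simp: smul_apply ev_def)
      qed
      have "(\<Sum>i<n. (pw k \<odot> v i) \<bullet> ((pwi k \<bullet> ev i)(n := c i k))) j
          = (\<Sum>i<n. if j = n then v i \<odot> t i k else v i \<odot> (if i = j then eone else 0))"
        by (subst fun_sum_apply) (intro sum.cong refl *, simp)
      also have "\<dots> = v j - (0(n := z)) j"
      proof -
        consider "j = n" | "j < n" | "j > n" by linarith
        thus ?thesis
        proof cases
          case 1 thus ?thesis by (simp add: z_def)
        next
          case 2 thus ?thesis using sum_delta[of "{..<n}" j v] by simp
        next
          case 3
          moreover have "v j = 0" using ball_evec[OF P v] 3 by (simp add: inEvec_def)
          moreover have "(\<Sum>i<n. v i \<odot> (if i = j then eone else 0)) = 0"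
            using 3 by (intro sum.neutral) auto
          ultimately show ?thesis by simp
        qed
      qed
      finally show "(v - (\<Sum>i<n. (pw k \<odot> v i) \<bullet> ((pwi k \<bullet> ev i)(n := c i k)))) j = (0(n := z)) j"
        by (simp add: lau_fold)
    qed
    ultimately have "gn z \<le> C" using C zE by simp
    moreover have "gn (\<Sum>i<n. v i \<odot> (T i - t i k)) \<le> C"
    proof (rule gn_sum)
      fix i assume i: "i \<in> {..<n}"
      have "gn (v i \<odot> (T i - t i k)) \<le> gn (v i) * ((1 / real p) ^ k * C)"
        using i T tE vE by (intro gn_emul_bound) auto
      also have "\<dots> = ((1 / real p) ^ k * gn (v i)) * C" by simp
      also have "\<dots> \<le> 1 * C" using vk i C1 by (intro mult_right_mono) auto
      finally show "gn (v i \<odot> (T i - t i k)) \<le> C" by simp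
    qed (use C1 T tE vE in auto)
    moreover have "pr nv (Suc n) x v = z - (\<Sum>i<n. v i \<odot> (T i - t i k))"
    proof -
      have "(\<Sum>i<n. x i \<odot> v i) = - (\<Sum>i<n. v i \<odot> T i)"
        unfolding sum_negf[symmetric] using T vE
        by (intro sum.cong) (auto simp: x_def emul_minus_right emul_comm[of _ "v _"])
      moreover have "(\<Sum>i<n. v i \<odot> (T i - t i k)) = (\<Sum>i<n. v i \<odot> T i) - (\<Sum>i<n. v i \<odot> t i k)"
        unfolding sum_subtractf[symmetric] using T tE vE by (intro sum.cong) (auto simp: emul_diff_right)
      ultimately show ?thesis by (simp add: pr_def x_def z_def)
    qed
    ultimately show ?thesis
      by (simp only:) (intro gn_diff zE inE_sum inE_emul inE_diff vE T tE; simp)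
  qed
  thus ?thesis using xE x0 by blast
qed

text \<open>A Hahn-Banach theorem: the coefficients of the functional are limits, by completeness.\<close>
lemma bounded_functional:
  "ball_module n P \<Longrightarrow> evec n w \<Longrightarrow> w \<notin> P \<Longrightarrow>
   \<exists>x. evec n x \<and> x \<noteq> 0 \<and> (\<exists>C. \<forall>v\<in>P. gn (pr nv n x v) \<le> C)"
proof (induction n arbitrary: P w)
  case 0
  hence "w = 0" by (auto simp: inEvec_def fun_eq_iff)
  with ball_0[OF 0(1)] 0(3) show ?case by metis
next
  case (Suc n)
  show ?case
  proof (cases "\<forall>u. evec n u \<longrightarrow> (\<exists>c. inE nv c \<and> u(n := c) \<in> P)")
    case True
    hence proj: "\<And>u. evec n u \<Longrightarrow> \<exists>c. inE nv c \<and> u(n := c) \<in> P" by blast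
    obtain C where "C \<ge> 1" "\<forall>c. inE nv c \<longrightarrow> 0(n := c) \<in> P \<longrightarrow> gn c \<le> C"
      using last_line_bounded[OF Suc.prems(1) proj Suc.prems(2,3)] by blast
    thus ?thesis using bounded_functional_from_limits[OF Suc.prems(1) proj] by blast
  next
    case False
    \<comment> \<open>The projection of P misses a vector, so the induction hypothesis applies to
      the projection; the functional found there is extended by 0 in the last coordinate.\<close>
    then obtain u where u: "evec n u" "\<nexists>c. inE nv c \<and> u(n := c) \<in> P" by blast
    define P2 where "P2 = {u. evec n u \<and> (\<exists>c. inE nv c \<and> u(n := c) \<in> P)}"
    have z: "(0::'k vec)(n := 0) = 0" by (simp add: fun_eq_iff)
    have "ball_module n P2"
      unfolding ball_module_def
    proof (intro conjI ballI allI impI)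
      show "0 \<in> P2" using ball_0[OF Suc.prems(1)] z unfolding P2_def
        by (metis (mono_tags, lifting) evec_0 inE_0 mem_Collect_eq)
      fix v v' assume "v \<in> P2" "v' \<in> P2"
      then obtain c c' where "evec n v" "evec n v'" "inE nv c" "inE nv c'" "v(n := c) \<in> P" "v'(n := c') \<in> P"
        unfolding P2_def by blast
      thus "v + v' \<in> P2"
        using ball_add[OF Suc.prems(1), of "v(n := c)" "v'(n := c')"]
        unfolding P2_def by (auto simp: upd_add intro!: exI[of _ "c + c'"])
    next
      fix e v assume e: "inE nv e" "gn e \<le> 1" and "v \<in> P2"
      then obtain c where "evec n v" "inE nv c" "v(n := c) \<in> P" unfolding P2_def by blast
      thus "e \<bullet> v \<in> P2"
        using ball_smul[OF Suc.prems(1) e, of "v(n := c)"] e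
        unfolding P2_def by (auto simp: smul_upd intro!: exI[of _ "e \<odot> c"])
    qed (auto simp: P2_def)
    moreover have "u \<notin> P2" using u by (simp add: P2_def)
    ultimately obtain x C where x: "evec n x" "x \<noteq> 0" "\<forall>v\<in>P2. gn (pr nv n x v) \<le> C"
      using Suc.IH u(1) by blast
    have "x n = 0" using x(1) by (simp add: inEvec_def)
    have "gn (pr nv (Suc n) x v) \<le> C" if v: "v \<in> P" for v
    proof -
      have vE: "evec (Suc n) v" using ball_evec[OF Suc.prems(1) v] .
      have "(v(n := 0))(n := v n) \<in> P" using v by simp
      hence "v(n := 0) \<in> P2" unfolding P2_def using evec_cut[OF vE] evec_inE[OF vE] by blast
      moreover have "pr nv (Suc n) x v = pr nv n x (v(n := 0))"
        using \<open>x n = 0\<close> by (simp add: pr_def)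
      ultimately show ?thesis using x(3) by simp
    qed
    moreover have "evec (Suc n) x" using x(1) by (simp add: inEvec_def less_Suc_eq)
    ultimately show ?thesis using x(2) by blast
  qed
qed

end

section \<open>Horizontal functionals of a module with Frobenius and connection\<close>

definition vksc :: "'k::field \<Rightarrow> 'k vec \<Rightarrow> 'k vec" where
  "vksc c v = (\<lambda>i. ksc c (v i))"

lemma vksc_simps [simp]:
  "vksc 0 v = 0" "vksc 1 v = v" "vksc c 0 = 0" "vksc c (vksc d v) = vksc (c * d) v"
  by (auto simp: vksc_def fun_eq_iff)

lemma vksc_add: "vksc c (v + w) = vksc c v + vksc c w"
  and vksc_add_left: "vksc (c + d) v = vksc c v + vksc d v"
  by (auto simp: vksc_def fun_eq_iff ksc_add)

lemma vksc_sum: "vksc c (sum f A) = (\<Sum>x\<in>A. vksc c (f x))"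
  using sum_hom(2)[of "\<lambda>_. True" "vksc c" A f] by (simp add: vksc_add)

lemma vksc_cancel: assumes "c \<noteq> 0" "vksc c v = vksc c w" shows "v = w"
proof
  fix i
  have "ksc c (v i) = ksc c (w i)" using fun_cong[OF assms(2), of i] by (simp only: vksc_def)
  thus "v i = w i" by (simp only: ksc_cancel[OF assms(1)])
qed

context complete_dvf
begin

lemma evec_vksc [simp]: "evec n v \<Longrightarrow> evec n (vksc c v)"
  by (auto simp: inEvec_def vksc_def lau_fold)

lemma vksc_smul: "inE nv c \<Longrightarrow> evec n v \<Longrightarrow> vksc k (c \<bullet> v) = (ksc k c) \<bullet> v"
  by (intro ext) (simp add: vksc_def smul_apply emul_ksc_left evec_inE)

lemma smul_vksc: "inE nv c \<Longrightarrow> evec n v \<Longrightarrow> c \<bullet> (vksc k v) = (ksc k c) \<bullet> v"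
  by (intro ext) (simp add: vksc_def smul_apply emul_ksc_left emul_ksc_right evec_inE)

lemma pr_vksc: "evec n x \<Longrightarrow> evec n v \<Longrightarrow> pr nv n x (vksc c v) = ksc c (pr nv n x v)"
  by (simp add: pr_def vksc_def emul_ksc_right evec_inE ksc_sum)

lemma esub_vksc: assumes "esub n N" "v \<in> N" shows "vksc c v \<in> N"
proof -
  have "vksc c v = (ksc c eone) \<bullet> v"
    using vksc_smul[of eone n v c] esub_evec[OF assms] by simp
  thus ?thesis using esub_smul[OF assms(1) _ assms(2), of "ksc c eone"] by simp
qed

end

locale phi_nabla = frobenius_lift nv p q phiK s
  for nv :: "'k::field_char_0 \<Rightarrow> real" and p q phiK s +
  fixes n :: nat and A G :: "nat \<Rightarrow> nat \<Rightarrow> 'k lau"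
  assumes module: "phi_nabla_module nv phiK s n A G"
begin

abbreviation V :: "'k vec \<Rightarrow> bool" where "V \<equiv> evec n"
abbreviation D :: "'k vec \<Rightarrow> 'k vec" where "D \<equiv> DM nv n G"
abbreviation F :: "'k vec \<Rightarrow> 'k vec" where "F \<equiv> phiM nv phiK s n A"
abbreviation pair :: "'k vec \<Rightarrow> 'k vec \<Rightarrow> 'k lau" where "pair \<equiv> pr nv n"

lemma inE_A: "i < n \<Longrightarrow> j < n \<Longrightarrow> inE nv (A i j)" and inE_G: "i < n \<Longrightarrow> j < n \<Longrightarrow> inE nv (G i j)"
  using module unfolding phi_nabla_module_def by auto

subsection \<open>The connection\<close>

lemma V_D [simp]: "V v \<Longrightarrow> V (D v)"
  using inE_G evec_inE[of n v] by (auto simp: inEvec_def DM_def lau_fold)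

lemma D_add: assumes "V v" "V w" shows "D (v + w) = D v + D w"
proof
  fix i show "D (v + w) i = (D v + D w) i"
    using inE_G evec_inE[OF assms(1)] evec_inE[OF assms(2)]
    by (simp add: DM_def ederiv_add emul_add_right sum.distrib)
qed

lemma D_0 [simp]: "D 0 = 0"
  by (auto simp: DM_def fun_eq_iff)

lemma D_vksc: assumes "V v" shows "D (vksc c v) = vksc c (D v)"
proof
  fix i show "D (vksc c v) i = vksc c (D v) i"
    using inE_G evec_inE[OF assms]
    by (simp add: DM_def vksc_def ederiv_ksc emul_ksc_right ksc_add ksc_sum)
qed

lemma D_smul: assumes "inE nv c" "V v" shows "D (c \<bullet> v) = ederiv c \<bullet> v + c \<bullet> D v"
proof
  fix i
  show "D (c \<bullet> v) i = (ederiv c \<bullet> v + c \<bullet> D v) i"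
  proof (cases "i < n")
    case True
    have "(\<Sum>j<n. G i j \<odot> (c \<odot> v j)) = c \<odot> (\<Sum>j<n. G i j \<odot> v j)"
      using assms True evec_inE[OF assms(2)] inE_G
      by (simp add: emul_sum_right_less emul_left_commute[of c])
    moreover have "inE nv (\<Sum>j<n. G i j \<odot> v j)"
      by (intro inE_sum inE_emul inE_G evec_inE[OF assms(2)] True) auto
    ultimately show ?thesis using assms True evec_inE[OF assms(2)]
      by (simp add: DM_def smul_apply ederiv_emul emul_add_right)
  next
    case False
    thus ?thesis using assms by (simp add: DM_def smul_apply inEvec_def)
  qed
qed

lemma D_sum: "(\<And>x. x \<in> S \<Longrightarrow> V (f x)) \<Longrightarrow> D (sum f S) = (\<Sum>x\<in>S. D (f x))"
  using sum_hom(2)[of V D S f] by (simp add: D_add)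

definition dp :: "nat \<Rightarrow> 'k vec \<Rightarrow> 'k vec" where
  "dp m v = vksc (1 / of_nat (fact m)) ((D ^^ m) v)"

lemma V_Dpow: "V v \<Longrightarrow> V ((D ^^ m) v)"
  by (induction m) auto

lemma V_dp [simp]: "V v \<Longrightarrow> V (dp m v)"
  by (simp add: dp_def V_Dpow)

lemma dp_0 [simp]: "dp 0 v = v"
  by (simp add: dp_def)

lemma fact_ratio: "of_nat (Suc m) * (1 / of_nat (fact (Suc m))) = (1 / of_nat (fact m) :: 'k)"
proof -
  have "a \<noteq> 0 \<Longrightarrow> a * (1 / (a * b)) = 1 / b" for a b :: 'k by simp
  from this[OF of_nat_neq_0] show ?thesis by (simp only: fact_Suc of_nat_mult of_nat_id)
qed

lemma D_dp: assumes "V v" shows "D (dp m v) = vksc (of_nat (Suc m)) (dp (Suc m) v)"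
  using D_vksc[OF V_Dpow[OF assms]] fact_ratio[of m]
  by (simp add: dp_def del: of_nat_Suc fact_Suc of_nat_fact)

lemma dp_D: assumes "V v" shows "dp m (D v) = vksc (of_nat (Suc m)) (dp (Suc m) v)"
  using fact_ratio[of m] by (simp add: dp_def funpow_swap1 del: of_nat_Suc fact_Suc of_nat_fact)

lemma Dpow_eq_dp: "(D ^^ m) v = vksc (of_nat (fact m)) (dp m v)"
  by (simp add: dp_def)

lemma dp_add: assumes "V v" "V w" shows "dp m (v + w) = dp m v + dp m w"
proof -
  have step: "(D ^^ Suc m) (v + w) = (D ^^ Suc m) v + (D ^^ Suc m) w"
    if "(D ^^ m) (v + w) = (D ^^ m) v + (D ^^ m) w" for m
    by (simp add: that D_add V_Dpow assms)
  have base: "(D ^^ 0) (v + w) = (D ^^ 0) v + (D ^^ 0) w" by simp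
  have "(D ^^ m) (v + w) = (D ^^ m) v + (D ^^ m) w"
    by (induction m) (fact base, fact step)
  thus ?thesis by (simp add: dp_def vksc_add)
qed

lemma dp_zero [simp]: "dp m 0 = 0"
proof -
  have "(D ^^ m) 0 = 0" by (induction m) (simp, simp only: funpow.simps o_apply D_0)
  thus ?thesis by (simp add: dp_def)
qed

lemma dp_sum: "(\<And>x. x \<in> S \<Longrightarrow> V (f x)) \<Longrightarrow> dp m (sum f S) = (\<Sum>x\<in>S. dp m (f x))"
  using sum_hom(2)[of V "dp m" S f] by (simp add: dp_add)

text \<open>The identity is checked after multiplication by m + 1: the two halves of the product
  rule carry weights k and m + 1 - k, which add up to m + 1 once both sums are completed to k \<le>
  m + 1.\<close>

lemma Leibniz_step:
  assumes c: "inE nv c" and v: "V v"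
    and IH: "dp m (c \<bullet> v) = (\<Sum>k\<le>m. tau c k \<bullet> dp (m - k) v)"
  shows "dp (Suc m) (c \<bullet> v) = (\<Sum>k\<le>Suc m. tau c k \<bullet> dp (Suc m - k) v)"
proof (rule vksc_cancel[of "of_nat (Suc m)"])
  let ?T = "\<lambda>k. tau c k \<bullet> dp (Suc m - k) v"
  have TV: "V (?T k)" for k using c v by simp
  have "vksc (of_nat (Suc m)) (dp (Suc m) (c \<bullet> v)) = D (dp m (c \<bullet> v))"
    using c v by (simp add: D_dp)
  also have "\<dots> = (\<Sum>k\<le>m. ederiv (tau c k) \<bullet> dp (m - k) v + tau c k \<bullet> D (dp (m - k) v))"
    unfolding IH using c v by (simp add: D_sum D_smul)
  also have "\<dots> = (\<Sum>k\<le>m. vksc (of_nat (Suc k)) (?T (Suc k))) + (\<Sum>k\<le>m. vksc (of_nat (Suc m - k)) (?T k))"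
  proof -
    have "ederiv (tau c k) \<bullet> dp (m - k) v = vksc (of_nat (Suc k)) (?T (Suc k))" for k
      using c v by (simp only: ederiv_tau diff_Suc_Suc) (simp add: vksc_smul[of _ n])
    moreover have "tau c k \<bullet> D (dp (m - k) v) = vksc (of_nat (Suc m - k)) (?T k)" if "k \<le> m" for k
      using c v that by (simp only: D_dp) (simp add: Suc_diff_le smul_vksc[of _ n] vksc_smul[of _ n])
    ultimately show ?thesis by (simp add: sum.distrib)
  qed
  also have "(\<Sum>k\<le>m. vksc (of_nat (Suc k)) (?T (Suc k))) = (\<Sum>k\<le>Suc m. vksc (of_nat k) (?T k))"
    by (subst sum.atMost_Suc_shift) simp
  also have "(\<Sum>k\<le>m. vksc (of_nat (Suc m - k)) (?T k)) = (\<Sum>k\<le>Suc m. vksc (of_nat (Suc m - k)) (?T k))"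
    by simp
  also have "(\<Sum>k\<le>Suc m. vksc (of_nat k) (?T k)) + (\<Sum>k\<le>Suc m. vksc (of_nat (Suc m - k)) (?T k))
      = (\<Sum>k\<le>Suc m. vksc (of_nat (Suc m)) (?T k))"
    unfolding sum.distrib[symmetric]
  proof (rule sum.cong[OF refl])
    fix k assume "k \<in> {..Suc m}"
    hence "of_nat (Suc m) = (of_nat k + of_nat (Suc m - k) :: 'k)"
      by (metis atMost_iff le_add_diff_inverse of_nat_add)
    thus "vksc (of_nat k) (?T k) + vksc (of_nat (Suc m - k)) (?T k) = vksc (of_nat (Suc m)) (?T k)"
      by (simp only: vksc_add_left)
  qed
  finally show "vksc (of_nat (Suc m)) (dp (Suc m) (c \<bullet> v))
      = vksc (of_nat (Suc m)) (\<Sum>k\<le>Suc m. ?T k)" by (simp only: vksc_sum)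
qed (rule of_nat_neq_0)

lemma dp_smul:
  assumes "inE nv c" "V v" shows "dp m (c \<bullet> v) = (\<Sum>k\<le>m. tau c k \<bullet> dp (m - k) v)"
proof (induction m)
  case 0 show ?case by simp
next
  case (Suc m) thus ?case by (rule Leibniz_step[OF assms])
qed

lemma pair_dp_comb:
  assumes x: "V x" and c: "\<And>j. j \<in> J \<Longrightarrow> inE nv (c j)" and u: "\<And>j. j \<in> J \<Longrightarrow> V (u j)"
  shows "pair x (dp m (\<Sum>j\<in>J. c j \<bullet> u j)) = (\<Sum>j\<in>J. \<Sum>k\<le>m. tau (c j) k \<odot> pair x (dp (m - k) (u j)))"
proof -
  have "dp m (\<Sum>j\<in>J. c j \<bullet> u j) = (\<Sum>j\<in>J. \<Sum>k\<le>m. tau (c j) k \<bullet> dp (m - k) (u j))"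
    using c u by (simp add: dp_sum dp_smul)
  thus ?thesis using x c u by (simp add: pr_sum_right pr_smul_right)
qed

text \<open>By the Leibniz formula, and because \<open>tau\<close> does not increase norms, growth
  on the \<open>u j\<close> passes to their combinations. Growth may thus be tested on any finite
  spanning family instead of the standard basis.\<close>

lemma growth_comb:
  assumes x: "V x" and c: "\<And>j. j \<in> J \<Longrightarrow> inE nv (c j)" "\<And>j. j \<in> J \<Longrightarrow> gn (c j) \<le> r"
    and u: "\<And>j. j \<in> J \<Longrightarrow> V (u j)"
    and B: "\<And>j m. j \<in> J \<Longrightarrow> gn (pair x (dp m (u j))) \<le> B * real (Suc m) powr lam"
    and nonneg: "0 \<le> B" "0 \<le> r" "0 \<le> lam"
  shows "gn (pair x (dp m (\<Sum>j\<in>J. c j \<bullet> u j))) \<le> r * (B * real (Suc m) powr lam)"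
proof -
  have "pair x (dp m (\<Sum>j\<in>J. c j \<bullet> u j)) = (\<Sum>j\<in>J. \<Sum>k\<le>m. tau (c j) k \<odot> pair x (dp (m - k) (u j)))"
    by (rule pair_dp_comb) (use x c u in auto)
  moreover have "gn (\<Sum>j\<in>J. \<Sum>k\<le>m. tau (c j) k \<odot> pair x (dp (m - k) (u j)))
      \<le> r * (B * real (Suc m) powr lam)"
  proof (intro gn_sum)
    fix j k assume j: "j \<in> J" and k: "k \<in> {..m}"
    have "real (Suc (m - k)) powr lam \<le> real (Suc m) powr lam"
      using nonneg by (intro powr_mono2) auto
    hence "gn (pair x (dp (m - k) (u j))) \<le> B * real (Suc m) powr lam"
      using B[OF j, of "m - k"] mult_left_mono[OF _ nonneg(1)] by (meson order_trans)
    thus "gn (tau (c j) k \<odot> pair x (dp (m - k) (u j))) \<le> r * (B * real (Suc m) powr lam)"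
      using c[OF j] u[OF j] x order_trans[OF gn_tau] by (intro gn_emul_bound) auto
  qed (use x c u nonneg in auto)
  ultimately show ?thesis by simp
qed

subsection \<open>Horizontal maps as functionals\<close>

definition sol :: "'k vec \<Rightarrow> nat \<Rightarrow> 'k eps" where
  "sol x = (\<lambda>j. if j < n then (\<lambda>m. pair x (dp m (ev j))) else 0)"

lemma D_ev: assumes "j < n" shows "D (ev j) = (\<Sum>i<n. G i j \<bullet> ev i)"
proof -
  have "D (ev j) i = G i j" if "i < n" for i
  proof -
    have "ederiv (ev j i) = (0 :: 'k lau)"
      by (simp add: ev_def)
    thus ?thesis using that sum_delta[of "{..<n}" j "G i"] assms by (simp add: DM_def ev_def)
  qed
  thus ?thesis using evec_expand[of n "D (ev j)"] assms by simp
qed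

lemma pair_dp_expand:
  assumes x: "V x" and v: "V v"
  shows "pair x (dp m v) = (\<Sum>j<n. \<Sum>k\<le>m. tau (v j) k \<odot> pair x (dp (m - k) (ev j)))"
proof -
  have "pair x (dp m v) = pair x (dp m (\<Sum>j<n. v j \<bullet> ev j))" using evec_expand[OF v] by simp
  also have "\<dots> = (\<Sum>j<n. \<Sum>k\<le>m. tau (v j) k \<odot> pair x (dp (m - k) (ev j)))"
    by (rule pair_dp_comb[OF x]) (use evec_inE[OF v] in auto)
  finally show ?thesis .
qed

text \<open>The horizontality equation in degree m, since \<open>D (ev j)\<close> is a column of
  \<open>G\<close>. It shows both that \<open>sol x\<close> is horizontal and that a horizontal map
  is determined by its constant coefficients.\<close>

lemma sol_recursion:
  assumes x: "V x" and j: "j < n"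
  shows "ksc (of_nat (Suc m)) (pair x (dp (Suc m) (ev j)))
    = (\<Sum>i<n. \<Sum>k\<le>m. tau (G i j) k \<odot> pair x (dp (m - k) (ev i)))"
proof -
  have "ksc (of_nat (Suc m)) (pair x (dp (Suc m) (ev j))) = pair x (dp m (D (ev j)))"
    using x j by (simp add: dp_D pr_vksc)
  also have "\<dots> = (\<Sum>i<n. \<Sum>k\<le>m. tau (G i j) k \<odot> pair x (dp (m - k) (ev i)))"
    unfolding D_ev[OF j] by (rule pair_dp_comb[OF x]) (use inE_G j in auto)
  finally show ?thesis .
qed

lemma psderiv_ksc: "psderiv f m = ksc (of_nat (Suc m)) (f (Suc m))"
  by (simp add: psderiv_def ksc_def)

lemma horizontal_sol: assumes x: "V x" shows "horizontal nv n G (sol x)"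
  unfolding horizontal_def
proof (intro conjI allI impI)
  fix j assume j: "j < n"
  show "psderiv (sol x j) = (\<Sum>i<n. psmul nv (tau (G i j)) (sol x i))"
  proof
    fix m
    have "(\<Sum>i<n. psmul nv (tau (G i j)) (sol x i)) m = (\<Sum>i<n. psmul nv (tau (G i j)) (sol x i) m)"
      by (rule fun_sum_apply)
    also have "\<dots> = (\<Sum>i<n. \<Sum>k\<le>m. tau (G i j) k \<odot> pair x (dp (m - k) (ev i)))"
      by (intro sum.cong refl) (simp add: psmul_def sol_def)
    also have "\<dots> = psderiv (sol x j) m"
      unfolding psderiv_ksc using sol_recursion[OF x j, of m] j by (simp add: sol_def)
    finally show "psderiv (sol x j) m = (\<Sum>i<n. psmul nv (tau (G i j)) (sol x i)) m" by simp
  qed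
qed (use x in \<open>auto simp: sol_def\<close>)

text \<open>In characteristic 0 the factor m + 1 can be cancelled, so the recursion determines each
  coefficient from the earlier ones.\<close>

lemma horizontal_imp_sol:
  assumes h: "horizontal nv n G y"
  shows "V (\<lambda>j. y j 0) \<and> y = sol (\<lambda>j. y j 0)"
proof
  have yn: "\<And>j. j \<ge> n \<Longrightarrow> y j = 0" and yE: "\<And>j m. j < n \<Longrightarrow> inE nv (y j m)"
    and yd: "\<And>j. j < n \<Longrightarrow> psderiv (y j) = (\<Sum>i<n. psmul nv (tau (G i j)) (y i))"
    using h unfolding horizontal_def by blast+
  define x where "x = (\<lambda>j. y j 0)"
  have xn: "x j = 0" if "j \<ge> n" for j using yn[OF that] by (simp add: x_def)
  show V: "V (\<lambda>j. y j 0)" using yE xn unfolding x_def inEvec_def by blast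
  hence x: "V x" by (simp add: x_def)
  have eq: "\<forall>j<n. y j m = pair x (dp m (ev j))" for m
  proof (induction m rule: less_induct)
    case (less m)
    show ?case
    proof (cases m)
      case 0
      thus ?thesis by (simp add: x_def pr_ev)
    next
      case (Suc l)
      show ?thesis
      proof (intro allI impI)
        fix j assume j: "j < n"
        have "ksc (of_nat (Suc l)) (y j (Suc l)) = (\<Sum>i<n. psmul nv (tau (G i j)) (y i)) l"
          using yd[OF j] psderiv_ksc[of "y j" l] by simp
        also have "\<dots> = (\<Sum>i<n. psmul nv (tau (G i j)) (y i) l)" by (rule fun_sum_apply)
        also have "\<dots> = (\<Sum>i<n. \<Sum>k\<le>l. tau (G i j) k \<odot> pair x (dp (l - k) (ev i)))"
          unfolding psmul_def using less Suc by (intro sum.cong refl) auto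
        also have "\<dots> = ksc (of_nat (Suc l)) (pair x (dp (Suc l) (ev j)))"
          by (rule sol_recursion[OF x j, symmetric])
        finally show "y j m = pair x (dp m (ev j))"
          using ksc_cancel[OF of_nat_neq_0] Suc by blast
      qed
    qed
  qed
  have "y j = sol x j" for j
    using eq yn by (cases "j < n") (auto simp: sol_def fun_eq_iff)
  thus "y = sol (\<lambda>j. y j 0)" unfolding x_def[symmetric] by blast
qed

lemma sol_at_0: assumes "V x" shows "(\<lambda>j. sol x j 0) = x"
proof
  fix j show "sol x j 0 = x j"
    using assms by (cases "j < n") (auto simp: sol_def pr_ev inEvec_def lau_fold)
qed

text \<open>\<open>Suc m\<close> in place of m brings the index 0 under the same bound; for
  nonnegative \<open>lam\<close>, passing back costs at most a factor 2^lam.\<close>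

definition W :: "real \<Rightarrow> 'k vec set" where
  "W lam = {x. V x \<and> (\<exists>C. \<forall>m. \<forall>j<n. gn (pair x (dp m (ev j))) \<le> C * real (Suc m) powr lam)}"

lemma Sol_lam_eq: assumes lam: "lam \<ge> 0" shows "Sol_lam nv n G lam = sol ` W lam"
proof (intro equalityI subsetI)
  fix y assume "y \<in> Sol_lam nv n G lam"
  hence h: "horizontal nv n G y" and g: "\<And>j. j < n \<Longrightarrow> growth nv lam (y j)"
    by (auto simp: Sol_lam_def)
  define x where "x = (\<lambda>j. y j 0)"
  have x: "V x" "y = sol x" using horizontal_imp_sol[OF h] by (auto simp: x_def)
  have "\<exists>C. \<forall>m\<ge>1. gn (pair x (dp m (ev j))) \<le> C * real m powr lam" if "j < n" for j
    using g[OF that] lam that x(2) by (simp add: growth_def sol_def)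
  then obtain C where C: "\<And>j m. j < n \<Longrightarrow> m \<ge> 1 \<Longrightarrow> gn (pair x (dp m (ev j))) \<le> C j * real m powr lam"
    by metis
  define B where "B = (\<Sum>j<n. \<bar>C j\<bar> + gn (x j))"
  have Bge: "\<bar>C j\<bar> + gn (x j) \<le> B" if "j < n" for j
    unfolding B_def using that evec_inE[OF x(1)] by (intro member_le_sum) auto
  have "gn (pair x (dp m (ev j))) \<le> B * real (Suc m) powr lam" if j: "j < n" for m j
  proof (cases m)
    case 0
    thus ?thesis using Bge[OF j] j by (simp add: pr_ev)
  next
    case (Suc l)
    have "gn (pair x (dp m (ev j))) \<le> C j * real m powr lam" using C[OF j, of m] Suc by simp
    also have "\<dots> \<le> \<bar>C j\<bar> * real (Suc m) powr lam"
      using lam by (intro mult_mono powr_mono2) auto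
    also have "\<dots> \<le> B * real (Suc m) powr lam"
      using Bge[OF j] gn_ge0[OF evec_inE[OF x(1)], of j] by (intro mult_right_mono) auto
    finally show ?thesis .
  qed
  hence "x \<in> W lam" unfolding W_def using x by blast
  thus "y \<in> sol ` W lam" using x by blast
next
  fix y assume "y \<in> sol ` W lam"
  then obtain x C where x: "V x" "y = sol x"
    and C: "\<And>m j. j < n \<Longrightarrow> gn (pair x (dp m (ev j))) \<le> C * real (Suc m) powr lam"
    unfolding W_def by blast
  have "gn (sol x j m) \<le> (\<bar>C\<bar> * 2 powr lam) * real m powr lam" if j: "j < n" and m: "m \<ge> 1" for j m
  proof -
    have "gn (sol x j m) \<le> C * real (Suc m) powr lam" using C[OF j] j by (simp add: sol_def)
    also have "\<dots> \<le> \<bar>C\<bar> * (2 * real m) powr lam"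
      using lam m by (intro mult_mono powr_mono2) auto
    finally show ?thesis by (simp add: powr_mult)
  qed
  hence "growth nv lam (sol x j)" if "j < n" for j
    unfolding growth_def using that lam x by (auto simp: sol_def)
  thus "y \<in> Sol_lam nv n G lam"
    unfolding Sol_lam_def using horizontal_sol[OF x(1)] x(2) by blast
qed

text \<open>On a \<open>D\<close>-stable N all coefficients of the induced map are values of the
  functional on N, so the constant coefficients already decide whether the map vanishes
  there.\<close>

lemma Sol_quot_eq:
  assumes N: "esub n N" and DN: "\<And>v. v \<in> N \<Longrightarrow> D v \<in> N"
  shows "Sol_quot nv n G N = sol ` eann n N"
proof -
  have pairing: "(\<Sum>j<n. psmul nv (tau (v j)) (sol x j)) m = pair x (dp m v)" if "V x" "V v" for x v m
  proof -
    have "(\<Sum>j<n. psmul nv (tau (v j)) (sol x j)) m = (\<Sum>j<n. psmul nv (tau (v j)) (sol x j) m)"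
      by (rule fun_sum_apply)
    also have "\<dots> = (\<Sum>j<n. \<Sum>k\<le>m. tau (v j) k \<odot> pair x (dp (m - k) (ev j)))"
      by (intro sum.cong refl) (simp add: psmul_def sol_def)
    finally show ?thesis using pair_dp_expand[OF that] by simp
  qed
  have dpN: "dp m v \<in> N" if "v \<in> N" for m v
  proof -
    have "(D ^^ m) v \<in> N" by (induction m) (auto simp: that DN)
    thus ?thesis unfolding dp_def by (rule esub_vksc[OF N])
  qed
  have iff: "(\<forall>v\<in>N. (\<Sum>j<n. psmul nv (tau (v j)) (sol x j)) = 0) \<longleftrightarrow> x \<in> eann n N" if x: "V x" for x
  proof
    assume l: "\<forall>v\<in>N. (\<Sum>j<n. psmul nv (tau (v j)) (sol x j)) = 0"
    have "pair x v = 0" if v: "v \<in> N" for v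
    proof -
      have "pair x (dp 0 v) = (0 :: 'k eps) 0"
        using pairing[OF x esub_evec[OF N v], of 0] l v by metis
      thus ?thesis by simp
    qed
    thus "x \<in> eann n N" using x by (simp add: eann_def)
  next
    assume r: "x \<in> eann n N"
    show "\<forall>v\<in>N. (\<Sum>j<n. psmul nv (tau (v j)) (sol x j)) = 0"
    proof (intro ballI ext)
      fix v m i assume v: "v \<in> N"
      have "(\<Sum>j<n. psmul nv (tau (v j)) (sol x j)) m = 0"
        using pairing[OF x esub_evec[OF N v], of m] r dpN[OF v, of m] by (simp add: eann_def)
      thus "(\<Sum>j<n. psmul nv (tau (v j)) (sol x j)) m i = (0 :: 'k eps) m i" by simp
    qed
  qed
  show ?thesis
  proof (intro equalityI subsetI)
    fix y assume "y \<in> Sol_quot nv n G N"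
    hence h: "horizontal nv n G y" and z: "\<forall>v\<in>N. (\<Sum>j<n. psmul nv (tau (v j)) (y j)) = 0"
      by (auto simp: Sol_quot_def)
    obtain x where x: "V x" "y = sol x" using horizontal_imp_sol[OF h] by blast
    thus "y \<in> sol ` eann n N" using iff[OF x(1)] z by blast
  next
    fix y assume "y \<in> sol ` eann n N"
    then obtain x where x: "x \<in> eann n N" "y = sol x" by blast
    have "V x" using x(1) by (simp add: eann_def)
    thus "y \<in> Sol_quot nv n G N"
      unfolding Sol_quot_def using x iff horizontal_sol by blast
  qed
qed

lemma inj_sol: "V x \<Longrightarrow> V y \<Longrightarrow> sol x = sol y \<Longrightarrow> x = y"
  using sol_at_0[of x] sol_at_0[of y] by metis

section \<open>The growth spaces and the dual connection\<close>

lemma W_V: "x \<in> W lam \<Longrightarrow> V x"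
  by (simp add: W_def)

lemma W_bound:
  assumes "x \<in> W lam"
  obtains C where "C \<ge> 0" "\<And>m j. j < n \<Longrightarrow> gn (pair x (dp m (ev j))) \<le> C * real (Suc m) powr lam"
proof -
  obtain C where C: "\<And>m j. j < n \<Longrightarrow> gn (pair x (dp m (ev j))) \<le> C * real (Suc m) powr lam"
    using assms unfolding W_def by blast
  have "gn (pair x (dp m (ev j))) \<le> \<bar>C\<bar> * real (Suc m) powr lam" if "j < n" for m j
    by (rule order_trans[OF C[OF that]]) (intro mult_right_mono, auto)
  thus ?thesis using that[of "\<bar>C\<bar>"] by simp
qed

lemma esub_W: "esub n (W lam)"
  unfolding esub_def
proof (intro conjI ballI allI impI)
  show "0 \<in> W lam" unfolding W_def by (auto intro!: exI[of _ 0])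
next
  fix x y assume x: "x \<in> W lam" and y: "y \<in> W lam"
  obtain B C where B: "B \<ge> 0" "\<And>m j. j < n \<Longrightarrow> gn (pair x (dp m (ev j))) \<le> B * real (Suc m) powr lam"
    and C: "C \<ge> 0" "\<And>m j. j < n \<Longrightarrow> gn (pair y (dp m (ev j))) \<le> C * real (Suc m) powr lam"
    using W_bound[OF x] W_bound[OF y] by metis
  have "gn (pair (x + y) (dp m (ev j))) \<le> (B + C) * real (Suc m) powr lam" if j: "j < n" for m j
  proof -
    have "B * real (Suc m) powr lam \<le> (B + C) * real (Suc m) powr lam"
      "C * real (Suc m) powr lam \<le> (B + C) * real (Suc m) powr lam"
      using B(1) C(1) by (auto intro: mult_right_mono)
    hence "gn (pair x (dp m (ev j))) \<le> (B + C) * real (Suc m) powr lam"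
      "gn (pair y (dp m (ev j))) \<le> (B + C) * real (Suc m) powr lam"
      using B(2)[OF j, of m] C(2)[OF j, of m] by linarith+
    thus ?thesis using W_V[OF x] W_V[OF y] j by (simp add: pr_add_left gn_add)
  qed
  thus "x + y \<in> W lam" unfolding W_def using W_V[OF x] W_V[OF y] by auto
next
  fix c x assume c: "inE nv c" and x: "x \<in> W lam"
  obtain B where B: "B \<ge> 0" "\<And>m j. j < n \<Longrightarrow> gn (pair x (dp m (ev j))) \<le> B * real (Suc m) powr lam"
    using W_bound[OF x] by metis
  have "gn (pair (c \<bullet> x) (dp m (ev j))) \<le> (gn c * B) * real (Suc m) powr lam" if j: "j < n" for m j
    using W_V[OF x] c j mult_left_mono[OF B(2)[OF j, of m] gn_ge0[OF c]]
    by (simp add: pr_smul_left gn_emul)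
  thus "c \<bullet> x \<in> W lam" unfolding W_def using W_V[OF x] c by auto
qed (simp add: W_V)

lemma W_mono: assumes "lam \<le> mu" shows "W lam \<subseteq> W mu"
proof
  fix x assume x: "x \<in> W lam"
  obtain B where B: "B \<ge> 0" "\<And>m j. j < n \<Longrightarrow> gn (pair x (dp m (ev j))) \<le> B * real (Suc m) powr lam"
    using W_bound[OF x] by metis
  have "gn (pair x (dp m (ev j))) \<le> B * real (Suc m) powr mu" if j: "j < n" for m j
    using B(2)[OF j, of m] mult_left_mono[OF powr_mono[OF assms, of "real (Suc m)"] B(1)] by simp
  thus "x \<in> W mu" unfolding W_def using W_V[OF x] by auto
qed

definition dual_D :: "'k vec \<Rightarrow> 'k vec" where
  "dual_D x = (\<lambda>j. if j < n then ederiv (x j) - pair x (D (ev j)) else 0)"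

lemma V_dual_D: assumes "V x" shows "V (dual_D x)"
proof -
  have "inE nv (dual_D x j)" if "j < n" for j
    using that assms evec_inE[OF assms] by (simp add: dual_D_def)
  moreover have "dual_D x j = 0" if "j \<ge> n" for j using that by (simp add: dual_D_def)
  ultimately show ?thesis unfolding inEvec_def by blast
qed

lemma pair_dual_D:
  assumes x: "V x" and v: "V v" shows "pair (dual_D x) v = ederiv (pair x v) - pair x (D v)"
proof -
  note xE = evec_inE[OF x] and vE = evec_inE[OF v]
  have "D v = (\<Sum>j<n. ederiv (v j) \<bullet> ev j + v j \<bullet> D (ev j))"
  proof -
    have "D v = D (\<Sum>j<n. v j \<bullet> ev j)" using evec_expand[OF v] by simp
    also have "\<dots> = (\<Sum>j<n. D (v j \<bullet> ev j))" by (rule D_sum) (use vE in auto)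
    also have "\<dots> = (\<Sum>j<n. ederiv (v j) \<bullet> ev j + v j \<bullet> D (ev j))"
      using vE by (intro sum.cong refl D_smul) auto
    finally show ?thesis .
  qed
  hence "pair x (D v) = (\<Sum>j<n. pair x (ederiv (v j) \<bullet> ev j + v j \<bullet> D (ev j)))"
    using x vE by (simp only:) (rule pr_sum_right, auto)
  hence "pair x (D v) = (\<Sum>j<n. ederiv (v j) \<odot> x j + v j \<odot> pair x (D (ev j)))"
    using x vE by (simp add: pr_add_right pr_smul_right pr_ev)
  moreover have "ederiv (pair x v) = (\<Sum>j<n. ederiv (x j) \<odot> v j + x j \<odot> ederiv (v j))"
    using xE vE by (simp add: pr_def ederiv_sum ederiv_emul)
  moreover have "pair (dual_D x) v = (\<Sum>j<n. (ederiv (x j) - pair x (D (ev j))) \<odot> v j)"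
    by (simp add: pr_def dual_D_def)
  moreover have "(ederiv (x j) - pair x (D (ev j))) \<odot> v j
     = (ederiv (x j) \<odot> v j + x j \<odot> ederiv (v j)) - (ederiv (v j) \<odot> x j + v j \<odot> pair x (D (ev j)))"
    if "j < n" for j
    using that x xE vE by (simp add: emul_diff_left emul_comm[of "v j"] emul_comm[of "ederiv (v j)"])
  ultimately show ?thesis by (simp add: sum_subtractf)
qed

text \<open>The dual connection raises the index of the divided power by at most one, at the price
  of a factor 2^lam.\<close>

lemma W_dual_D: assumes x: "x \<in> W lam" and lam: "lam \<ge> 0" shows "dual_D x \<in> W lam"
proof -
  have xV: "V x" using W_V[OF x] .
  obtain B where B: "B \<ge> 0" "\<And>m j. j < n \<Longrightarrow> gn (pair x (dp m (ev j))) \<le> B * real (Suc m) powr lam"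
    using W_bound[OF x] by metis
  have "gn (pair (dual_D x) (dp m (ev j))) \<le> (B * 2 powr lam) * real (Suc m) powr lam" if j: "j < n" for m j
  proof -
    have le: "real (Suc m') powr lam \<le> 2 powr lam * real (Suc m) powr lam" if "m' \<le> Suc m" for m'
    proof -
      have "real (Suc m') powr lam \<le> (2 * real (Suc m)) powr lam"
        using lam that by (intro powr_mono2) auto
      thus ?thesis by (simp add: powr_mult del: of_nat_Suc)
    qed
    have bd: "gn (pair x (dp m' (ev j))) \<le> B * 2 powr lam * real (Suc m) powr lam" if "m' \<le> Suc m" for m'
      using B(2)[OF j, of m'] mult_left_mono[OF le[OF that] B(1)] by simp
    have "pair (dual_D x) (dp m (ev j))
        = ederiv (pair x (dp m (ev j))) - ksc (of_nat (Suc m)) (pair x (dp (Suc m) (ev j)))"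
      using xV j by (simp only: pair_dual_D V_dp evec_ev D_dp pr_vksc)
    moreover have "gn (ederiv (pair x (dp m (ev j)))) \<le> B * 2 powr lam * real (Suc m) powr lam"
      using gn_ederiv[of "pair x (dp m (ev j))"] bd[of m] xV j by simp
    moreover have "gn (ksc (of_nat (Suc m)) (pair x (dp (Suc m) (ev j)))) \<le> B * 2 powr lam * real (Suc m) powr lam"
    proof -
      have "nv (of_nat (Suc m)) * gn (pair x (dp (Suc m) (ev j))) \<le> 1 * gn (pair x (dp (Suc m) (ev j)))"
        using xV j by (intro mult_right_mono nv_of_nat_le1) auto
      thus ?thesis using bd[of "Suc m"] xV j by (simp del: of_nat_Suc)
    qed
    ultimately show ?thesis using xV j by (simp only:) (rule gn_diff, auto)
  qed
  thus ?thesis unfolding W_def using V_dual_D[OF xV] by auto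
qed

lemma eann_W_D:
  assumes lam: "lam \<ge> 0" and v: "v \<in> eann n (W lam)" shows "D v \<in> eann n (W lam)"
proof -
  have vV: "V v" and z: "\<And>x. x \<in> W lam \<Longrightarrow> pair x v = 0"
    using v W_V by (auto simp: eann_def pr_comm)
  have "pair (D v) x = 0" if x: "x \<in> W lam" for x
  proof -
    have "pair (dual_D x) v = ederiv (pair x v) - pair x (D v)"
      by (rule pair_dual_D[OF W_V[OF x] vV])
    thus ?thesis using z[OF x] z[OF W_dual_D[OF x lam]] W_V[OF x] vV by (simp add: pr_comm)
  qed
  thus ?thesis using vV by (simp add: eann_def)
qed

end

context complete_dvf
begin

lemma epow_add: "inE nv a \<Longrightarrow> epow nv a (i + j) = epow nv a i \<odot> epow nv a j"
  by (induction i) (simp_all add: epow_Suc emul_assoc)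

lemma ederiv_epow:
  assumes a: "inE nv a"
  shows "ederiv (epow nv a (Suc i)) = ksc (of_nat (Suc i)) (ederiv a \<odot> epow nv a i)"
proof (induction i)
  case 0 show ?case by (simp add: epow_Suc)
next
  case (Suc i)
  have "ederiv (epow nv a (Suc (Suc i))) = ederiv a \<odot> epow nv a (Suc i) + a \<odot> ederiv (epow nv a (Suc i))"
    using a by (simp only: epow_Suc[of a "Suc i"] ederiv_emul inE_epow)
  also have "a \<odot> ederiv (epow nv a (Suc i)) = ksc (of_nat (Suc i)) (ederiv a \<odot> epow nv a (Suc i))"
    unfolding Suc using a
    by (simp only: emul_ksc_right inE_epow inE_ederiv inE_emul epow_Suc emul_left_commute)
  also have "ederiv a \<odot> epow nv a (Suc i) + ksc (of_nat (Suc i)) (ederiv a \<odot> epow nv a (Suc i))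
      = ksc (1 + of_nat (Suc i)) (ederiv a \<odot> epow nv a (Suc i))"
    by (simp only: ksc_add ksc_simps)
  also have "(1 + of_nat (Suc i) :: 'k) = of_nat (Suc (Suc i))" by simp
  finally show ?case .
qed

end

section \<open>Taylor coefficients of the Frobenius lift\<close>

context frobenius_lift
begin

text \<open>The coefficient of \<open>(X - t)\<^sup>m\<close> in \<open>(s(X) - s(t))\<^sup>k\<close>, expanded by the binomial theorem.\<close>
definition Cc :: "nat \<Rightarrow> nat \<Rightarrow> 'k lau" where
  "Cc m k = (\<Sum>i\<le>k. ksc ((-1) ^ (k - i) * of_nat (k choose i)) (epow nv s (k - i) \<odot> tau (epow nv s i) m))"

lemma inE_Cc [simp]: "inE nv (Cc m k)"
  unfolding Cc_def by simp

lemma gn_Cc: "gn (Cc m k) \<le> 1"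
  unfolding Cc_def
proof (rule gn_sum)
  fix i
  have "gn (epow nv s (k - i) \<odot> tau (epow nv s i) m) \<le> 1 * 1"
    using gn_tau[of "epow nv s i" m] by (intro gn_emul_bound) (auto simp: gn_epow)
  moreover have "nv ((-1) ^ (k - i) * of_nat (k choose i)) \<le> 1"
    using nv_of_nat_le1[of "k choose i"] by (simp add: nv_mult nv_power)
  ultimately show "gn (ksc ((-1) ^ (k - i) * of_nat (k choose i)) (epow nv s (k - i) \<odot> tau (epow nv s i) m)) \<le> 1"
    by (simp add: mult_le_one)
qed auto

text \<open>This is coefficient comparison after differentiating the expansion of (s(X) - s(t))^k in
  powers of X - t with respect to t at fixed X. The proof collects the derivatives of the powers of
  s by the absorption identity for binomial coefficients. For k = 0 the truncated index k - 1 is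
  harmless because of the factor k.\<close>

lemma Cc_rec:
  "ksc (of_nat (Suc m)) (Cc (Suc m) k) = ederiv (Cc m k) + ksc (of_nat k) (ederiv s \<odot> Cc m (k - 1))"
proof -
  define \<kappa> where "\<kappa> k i = ((-1) ^ (k - i) * of_nat (k choose i) :: 'k)" for k i
  define T where "T i m = tau (epow nv s i) m" for i m
  have TE [simp]: "inE nv (T i m)" for i m by (simp add: T_def)
  have Cc: "Cc m k = (\<Sum>i\<le>k. ksc (\<kappa> k i) (epow nv s (k - i) \<odot> T i m))" for m k
    by (simp add: Cc_def \<kappa>_def T_def)
  have "ederiv (Cc m k) = (\<Sum>i\<le>k. ksc (\<kappa> k i) (ederiv (epow nv s (k - i)) \<odot> T i m)
      + ksc (of_nat (Suc m)) (ksc (\<kappa> k i) (epow nv s (k - i) \<odot> T i (Suc m))))"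
    unfolding Cc ederiv_sum
  proof (rule sum.cong[OF refl])
    fix i
    have "ederiv (T i m) = ksc (of_nat (Suc m)) (T i (Suc m))" unfolding T_def by (rule ederiv_tau)
    hence "ederiv (epow nv s (k - i) \<odot> T i m) = ederiv (epow nv s (k - i)) \<odot> T i m
        + ksc (of_nat (Suc m)) (epow nv s (k - i) \<odot> T i (Suc m))"
      by (simp only: ederiv_emul inE_epow inE_s TE emul_ksc_right)
    thus "ederiv (ksc (\<kappa> k i) (epow nv s (k - i) \<odot> T i m))
      = ksc (\<kappa> k i) (ederiv (epow nv s (k - i)) \<odot> T i m)
      + ksc (of_nat (Suc m)) (ksc (\<kappa> k i) (epow nv s (k - i) \<odot> T i (Suc m)))"
      by (simp only: ederiv_ksc ksc_add ksc_simps mult.commute)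
  qed
  hence 1: "ederiv (Cc m k) = (\<Sum>i\<le>k. ksc (\<kappa> k i) (ederiv (epow nv s (k - i)) \<odot> T i m))
      + ksc (of_nat (Suc m)) (Cc (Suc m) k)"
    unfolding sum.distrib Cc[of "Suc m"] ksc_sum .
  have 2: "(\<Sum>i\<le>k. ksc (\<kappa> k i) (ederiv (epow nv s (k - i)) \<odot> T i m))
      = - ksc (of_nat k) (ederiv s \<odot> Cc m (k - 1))"
  proof (cases k)
    case 0
    thus ?thesis by simp
  next
    case (Suc l)
    have "(\<Sum>i\<le>k. ksc (\<kappa> k i) (ederiv (epow nv s (k - i)) \<odot> T i m))
        = (\<Sum>i\<le>l. ksc (\<kappa> k i) (ederiv (epow nv s (k - i)) \<odot> T i m))"
      unfolding Suc by simp
    also have "\<dots> = (\<Sum>i\<le>l. ksc (- of_nat k) (ederiv s \<odot> ksc (\<kappa> l i) (epow nv s (l - i) \<odot> T i m)))"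
    proof (rule sum.cong[OF refl])
      fix i assume "i \<in> {..l}"
      hence i: "k - i = Suc (l - i)" using Suc by auto
      have "Suc (l - i) * (k choose i) = k * (l choose i)"
        using binomial_absorb_comp[of k i] i Suc by simp
      hence h: "of_nat (Suc (l - i)) * of_nat (k choose i) = (of_nat k * of_nat (l choose i) :: 'k)"
        by (metis of_nat_mult)
      have "\<kappa> k i * of_nat (Suc (l - i)) = - ((-1) ^ (l - i) * (of_nat (Suc (l - i)) * of_nat (k choose i)))"
        unfolding \<kappa>_def i power_Suc by (simp del: of_nat_Suc)
      also have "\<dots> = - of_nat k * \<kappa> l i" unfolding h \<kappa>_def by simp
      finally have \<kappa>: "\<kappa> k i * of_nat (Suc (l - i)) = - of_nat k * \<kappa> l i" .
      have "ksc (\<kappa> k i) (ederiv (epow nv s (k - i)) \<odot> T i m)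
          = ksc (\<kappa> k i) (ksc (of_nat (Suc (l - i))) (ederiv s \<odot> epow nv s (l - i)) \<odot> T i m)"
        unfolding i by (simp only: ederiv_epow inE_s)
      also have "\<dots> = ksc (\<kappa> k i * of_nat (Suc (l - i))) (ederiv s \<odot> (epow nv s (l - i) \<odot> T i m))"
        by (simp add: emul_ksc_left emul_assoc del: of_nat_Suc)
      finally show "ksc (\<kappa> k i) (ederiv (epow nv s (k - i)) \<odot> T i m)
          = ksc (- of_nat k) (ederiv s \<odot> ksc (\<kappa> l i) (epow nv s (l - i) \<odot> T i m))"
        unfolding \<kappa> by (simp add: emul_ksc_right)
    qed
    also have "\<dots> = ksc (- of_nat k) (ederiv s \<odot> Cc m l)"
      unfolding Cc by (simp add: ksc_sum emul_sum_right)
    finally show ?thesis using Suc by (simp add: ksc_minus del: of_nat_Suc)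
  qed
  show ?thesis unfolding 1 2 by (simp add: lau_fold)
qed

text \<open>The difference s(X) - s(t) vanishes at X = t; in terms of the definition this is an
  alternating sum of binomial coefficients.\<close>

lemma Cc_0: "Cc 0 k = (if k = 0 then eone else 0)"
proof -
  have "Cc 0 k = (\<Sum>i\<le>k. ksc ((-1) ^ (k - i) * of_nat (k choose i)) (epow nv s k))"
    unfolding Cc_def by (intro sum.cong refl) (simp add: epow_add[symmetric])
  also have "\<dots> = ksc (\<Sum>i\<le>k. (-1) ^ (k - i) * of_nat (k choose i)) (epow nv s k)"
    by (rule sum_hom(2)[of "\<lambda>_. True" "\<lambda>c. ksc c (epow nv s k)", symmetric]) (auto simp: ksc_add)
  finally have eq: "Cc 0 k = ksc (\<Sum>i\<le>k. (-1) ^ (k - i) * of_nat (k choose i)) (epow nv s k)" .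
  show ?thesis
  proof (cases "k = 0")
    case False
    have "(\<Sum>i\<le>k. (-1) ^ (k - i) * of_nat (k choose i)) = (\<Sum>i\<le>k. (-1) ^ i * of_nat (k choose i) :: 'k)"
      by (rule sum.reindex_bij_witness[of _ "\<lambda>i. k - i" "\<lambda>i. k - i"]) (auto simp: binomial_symmetric[symmetric])
    also have "\<dots> = 0" using False by (intro choose_alternating_sum) simp
    finally show ?thesis using eq False by simp
  next
    case True
    thus ?thesis using eq by simp
  qed
qed

text \<open>(s(X) - s(t))^k is divisible by (X - t)^k; the recursion propagates this from m =
  0.\<close>

lemma Cc_gt: "k > m \<Longrightarrow> Cc m k = 0"
proof (induction m arbitrary: k)
  case 0
  thus ?case by (simp add: Cc_0 lau_fold)
next
  case (Suc m)
  have "Cc m k = 0" "Cc m (k - 1) = 0" using Suc.prems by (auto intro!: Suc.IH)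
  hence "ksc (of_nat (Suc m)) (Cc (Suc m) k) = ksc (of_nat (Suc m)) 0"
    using Cc_rec[of m k] by (simp only: ederiv_0 emul_0_right ksc_simps add_0)
  thus ?case by (simp only: ksc_cancel[OF of_nat_neq_0])
qed

lemma phi_ksc: assumes "inE nv a" shows "phi (ksc c a) = ksc (phiK c) (phi a)"
proof
  fix n show "phi (ksc c a) n = ksc (phiK c) (phi a) n"
    unfolding ephi_def ksc_def using kSum_cmult[OF ephi_vanishing[OF assms], of "phiK c" n]
    by (simp add: phiK_mult mult.assoc)
qed

lemma phiK_of_nat: "phiK (of_nat k) = of_nat k"
  by (induction k) (auto simp: phiK_add)

end

context phi_nabla
begin

subsection \<open>The Frobenius structure\<close>

definition phiv :: "'k vec \<Rightarrow> 'k vec" where "phiv v = (\<lambda>j. phi (v j))"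

abbreviation MA :: "'k vec \<Rightarrow> 'k vec" where "MA \<equiv> matvec nv n A"

lemma V_phiv [simp]: "V v \<Longrightarrow> V (phiv v)"
  by (auto simp: inEvec_def phiv_def lau_fold)

lemma V_MA [simp]: assumes "V v" shows "V (MA v)"
proof -
  have "inE nv (\<Sum>j<n. A i j \<odot> v j)" if "i < n" for i
    by (intro inE_sum_less inE_emul inE_A that evec_inE[OF assms])
  thus ?thesis by (simp add: inEvec_def matvec_def)
qed

lemma F_eq: "F v = MA (phiv v)"
  by (simp add: phiM_def phiv_def)

lemma MA_add: assumes "V v" "V w" shows "MA (v + w) = MA v + MA w"
proof
  fix i show "MA (v + w) i = (MA v + MA w) i"
    using inE_A evec_inE[OF assms(1)] evec_inE[OF assms(2)]
    by (simp add: matvec_def emul_add_right sum.distrib)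
qed

lemma MA_smul: assumes c: "inE nv c" and v: "V v" shows "MA (c \<bullet> v) = c \<bullet> MA v"
proof
  fix i show "MA (c \<bullet> v) i = (c \<bullet> MA v) i"
    using inE_A evec_inE[OF v] c
    by (simp add: matvec_def smul_apply emul_sum_right_less emul_left_commute[of c])
qed

lemma MA_0 [simp]: "MA 0 = 0"
  by (auto simp: matvec_def fun_eq_iff)

lemma MA_sum: "(\<And>x. x \<in> S \<Longrightarrow> V (f x)) \<Longrightarrow> MA (sum f S) = (\<Sum>x\<in>S. MA (f x))"
  using sum_hom(2)[of V MA S f] by (simp add: MA_add)

lemma MA_unique: "V w \<Longrightarrow> \<exists>!v. V v \<and> MA v = w"
  using module unfolding phi_nabla_module_def by blast

lemma MA_inj: "V v \<Longrightarrow> V w \<Longrightarrow> MA v = MA w \<Longrightarrow> v = w"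
  using MA_unique[of "MA w"] V_MA[of w] by blast

definition Ainv :: "'k vec \<Rightarrow> 'k vec" where "Ainv w = (THE v. V v \<and> MA v = w)"

lemma Ainv: assumes "V w" shows "V (Ainv w)" "MA (Ainv w) = w"
  using theI'[OF MA_unique[OF assms]] unfolding Ainv_def by auto

lemma Ainv_expand: assumes w: "V w" shows "Ainv w = (\<Sum>i<n. w i \<bullet> Ainv (ev i))"
proof (rule MA_inj)
  show "V (Ainv w)" by (rule Ainv(1)[OF w])
  have V1: "V (w i \<bullet> Ainv (ev i))" if "i \<in> {..<n}" for i
    using that evec_inE[OF w] Ainv(1) by simp
  thus "V (\<Sum>i<n. w i \<bullet> Ainv (ev i))" by (rule evec_sum)
  have "MA (\<Sum>i<n. w i \<bullet> Ainv (ev i)) = (\<Sum>i<n. MA (w i \<bullet> Ainv (ev i)))" by (rule MA_sum[OF V1])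
  also have "\<dots> = (\<Sum>i<n. w i \<bullet> ev i)"
    using evec_inE[OF w] Ainv by (intro sum.cong refl) (simp add: MA_smul)
  finally show "MA (Ainv w) = MA (\<Sum>i<n. w i \<bullet> Ainv (ev i))"
    using evec_expand[OF w] Ainv(2)[OF w] by simp
qed

lemma phiv_add: "V v \<Longrightarrow> V w \<Longrightarrow> phiv (v + w) = phiv v + phiv w"
  by (intro ext) (simp add: phiv_def phi_add evec_inE)

lemma phiv_smul: "inE nv c \<Longrightarrow> V v \<Longrightarrow> phiv (c \<bullet> v) = phi c \<bullet> phiv v"
  by (intro ext) (simp add: phiv_def smul_apply phi_emul evec_inE)

lemma phiv_0 [simp]: "phiv 0 = 0"
  by (auto simp: phiv_def fun_eq_iff)

lemma phiv_ev [simp]: "phiv (ev j) = ev j"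
  by (auto simp: phiv_def ev_def fun_eq_iff)

lemma V_F [simp]: "V v \<Longrightarrow> V (F v)"
  by (simp add: F_eq)

lemma F_0 [simp]: "F 0 = 0"
  by (simp add: F_eq)

lemma F_add: "V v \<Longrightarrow> V w \<Longrightarrow> F (v + w) = F v + F w"
  by (simp add: F_eq phiv_add MA_add)

lemma F_smul: "inE nv c \<Longrightarrow> V v \<Longrightarrow> F (c \<bullet> v) = phi c \<bullet> F v"
  by (simp add: F_eq phiv_smul MA_smul)

lemma F_sum: "(\<And>x. x \<in> S \<Longrightarrow> V (f x)) \<Longrightarrow> F (sum f S) = (\<Sum>x\<in>S. F (f x))"
  using sum_hom(2)[of V F S f] by (simp add: F_add)

lemma F_vksc: assumes "V v" shows "F (vksc c v) = vksc (phiK c) (F v)"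
proof -
  have "vksc c v = (ksc c eone) \<bullet> v" using vksc_smul[of eone n v c] assms by simp
  moreover have "vksc (phiK c) (F v) = (ksc (phiK c) eone) \<bullet> F v"
    using vksc_smul[of eone n "F v" "phiK c"] assms by simp
  ultimately show ?thesis using assms by (simp add: F_smul phi_ksc)
qed

lemma D_F: "V v \<Longrightarrow> D (F v) = ederiv s \<bullet> F (D v)"
  using module unfolding phi_nabla_module_def by blast

text \<open>Commuting \<open>D\<close> past \<open>F\<close> brings out s', and what results is the
  recursion \<open>Cc_rec\<close>. The formula rewrites the Taylor expansion in X - t of a Frobenius
  image through the powers of s(X) - s(t).\<close>

lemma dp_F_step:
  assumes v: "V v" and IH: "dp m (F v) = (\<Sum>k\<le>m. Cc m k \<bullet> F (dp k v))"
  shows "dp (Suc m) (F v) = (\<Sum>k\<le>Suc m. Cc (Suc m) k \<bullet> F (dp k v))"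
proof (rule vksc_cancel[of "of_nat (Suc m)"])
  have "vksc (of_nat (Suc m)) (dp (Suc m) (F v)) = D (dp m (F v))"
    using v by (simp only: D_dp V_F)
  also have "\<dots> = (\<Sum>k\<le>m. ederiv (Cc m k) \<bullet> F (dp k v) + Cc m k \<bullet> D (F (dp k v)))"
    unfolding IH using v by (simp add: D_sum D_smul)
  also have "\<dots> = (\<Sum>k\<le>m. ederiv (Cc m k) \<bullet> F (dp k v))
      + (\<Sum>k\<le>m. ksc (of_nat (Suc k)) (ederiv s \<odot> Cc m (Suc k - 1)) \<bullet> F (dp (Suc k) v))"
    unfolding sum.distrib[symmetric]
  proof (rule sum.cong[OF refl])
    fix k
    have "D (F (dp k v)) = ederiv s \<bullet> vksc (of_nat (Suc k)) (F (dp (Suc k) v))"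
      using v by (simp only: D_F V_dp D_dp F_vksc phiK_of_nat)
    hence "Cc m k \<bullet> D (F (dp k v)) = ksc (of_nat (Suc k)) (ederiv s \<odot> Cc m (Suc k - 1)) \<bullet> F (dp (Suc k) v)"
      using v by (simp add: smul_vksc[of _ n] smul_smul[of _ _ n] emul_ksc_right emul_comm[of "Cc m k"] del: of_nat_Suc)
    thus "ederiv (Cc m k) \<bullet> F (dp k v) + Cc m k \<bullet> D (F (dp k v))
        = ederiv (Cc m k) \<bullet> F (dp k v)
          + ksc (of_nat (Suc k)) (ederiv s \<odot> Cc m (Suc k - 1)) \<bullet> F (dp (Suc k) v)" by simp
  qed
  also have "(\<Sum>k\<le>m. ederiv (Cc m k) \<bullet> F (dp k v)) = (\<Sum>k\<le>Suc m. ederiv (Cc m k) \<bullet> F (dp k v))"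
    by (simp add: Cc_gt)
  also have "(\<Sum>k\<le>m. ksc (of_nat (Suc k)) (ederiv s \<odot> Cc m (Suc k - 1)) \<bullet> F (dp (Suc k) v))
      = (\<Sum>k\<le>Suc m. ksc (of_nat k) (ederiv s \<odot> Cc m (k - 1)) \<bullet> F (dp k v))"
    by (subst sum.atMost_Suc_shift) simp
  also have "(\<Sum>k\<le>Suc m. ederiv (Cc m k) \<bullet> F (dp k v))
      + (\<Sum>k\<le>Suc m. ksc (of_nat k) (ederiv s \<odot> Cc m (k - 1)) \<bullet> F (dp k v))
      = (\<Sum>k\<le>Suc m. vksc (of_nat (Suc m)) (Cc (Suc m) k \<bullet> F (dp k v)))"
    unfolding sum.distrib[symmetric]
  proof (rule sum.cong[OF refl])
    fix k
    show "ederiv (Cc m k) \<bullet> F (dp k v) + ksc (of_nat k) (ederiv s \<odot> Cc m (k - 1)) \<bullet> F (dp k v)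
        = vksc (of_nat (Suc m)) (Cc (Suc m) k \<bullet> F (dp k v))"
      using v smul_add_left[of "ederiv (Cc m k)" "ksc (of_nat k) (ederiv s \<odot> Cc m (k - 1))" n "F (dp k v)"]
      by (simp only: Cc_rec[symmetric] vksc_smul[of _ n] inE_Cc V_F V_dp inE_ederiv inE_ksc inE_emul inE_s)
  qed
  finally show "vksc (of_nat (Suc m)) (dp (Suc m) (F v))
      = vksc (of_nat (Suc m)) (\<Sum>k\<le>Suc m. Cc (Suc m) k \<bullet> F (dp k v))"
    by (simp only: vksc_sum)
qed (rule of_nat_neq_0)

lemma dp_F: assumes "V v" shows "dp m (F v) = (\<Sum>k\<le>m. Cc m k \<bullet> F (dp k v))"
proof (induction m)
  case 0 show ?case by (simp add: Cc_0)
next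
  case (Suc m) thus ?case by (rule dp_F_step[OF assms])
qed

text \<open>The Frobenius of the dual module: its matrix is the transposed inverse of
  \<open>A\<close>, which yields the compatibility \<open>pair_dual_F\<close>.\<close>

definition dual_F :: "'k vec \<Rightarrow> 'k vec" where
  "dual_F x = (\<lambda>i. if i < n then pair (phiv x) (Ainv (ev i)) else 0)"

lemma V_dual_F: assumes "V x" shows "V (dual_F x)"
  using assms Ainv(1) by (simp add: inEvec_def[of nv n "dual_F x"]) (simp add: dual_F_def)

lemma pair_dual_F: assumes x: "V x" and v: "V v" shows "pair (dual_F x) (F v) = phi (pair x v)"
proof -
  have w: "V (F v)" using v by simp
  have "pair (dual_F x) (F v) = (\<Sum>i<n. pair (phiv x) (F v i \<bullet> Ainv (ev i)))"
    unfolding pr_def[of nv n "dual_F x"]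
  proof (rule sum.cong[OF refl])
    fix i assume i: "i \<in> {..<n}"
    hence A: "V (Ainv (ev i))" by (intro Ainv) simp
    show "dual_F x i \<odot> F v i = pair (phiv x) (F v i \<bullet> Ainv (ev i))"
      using i A x evec_inE[OF w] by (simp add: pr_smul_right dual_F_def emul_comm)
  qed
  also have "\<dots> = pair (phiv x) (Ainv (F v))"
    unfolding Ainv_expand[OF w] using x evec_inE[OF w] Ainv(1)
    by (intro pr_sum_right[symmetric]) auto
  also have "Ainv (F v) = phiv v"
    by (rule MA_inj) (use Ainv[OF w] v in \<open>auto simp: F_eq\<close>)
  also have "pair (phiv x) (phiv v) = (\<Sum>i<n. phi (x i \<odot> v i))"
    using evec_inE[OF x] evec_inE[OF v] by (simp add: pr_def phiv_def phi_emul)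
  also have "\<dots> = phi (pair x v)"
    unfolding pr_def using evec_inE[OF x] evec_inE[OF v] by (intro phi_sum[symmetric]) auto
  finally show ?thesis .
qed

lemma ev_comb_F: assumes "j < n" shows "ev j = (\<Sum>i<n. Ainv (ev j) i \<bullet> F (ev i))"
proof -
  have a: "V (Ainv (ev j))" "MA (Ainv (ev j)) = ev j" using Ainv[of "ev j"] assms by auto
  have "ev j = MA (\<Sum>i<n. Ainv (ev j) i \<bullet> ev i)" using evec_expand[OF a(1)] a(2) by simp
  also have "\<dots> = (\<Sum>i<n. MA (Ainv (ev j) i \<bullet> ev i))"
    by (rule MA_sum) (use evec_inE[OF a(1)] in auto)
  also have "\<dots> = (\<Sum>i<n. Ainv (ev j) i \<bullet> F (ev i))"
    using evec_inE[OF a(1)] by (intro sum.cong refl) (simp add: MA_smul F_eq)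
  finally show ?thesis .
qed

text \<open>On the vectors \<open>F (ev i)\<close> the bound is inherited from x, because the
  \<open>Cc\<close> have norm at most 1 and \<open>phi\<close> does not increase norms. These
  vectors span M, so \<open>growth_comb\<close> transfers the bound to the standard basis.\<close>

lemma W_dual_F: assumes x: "x \<in> W lam" and lam: "lam \<ge> 0" shows "dual_F x \<in> W lam"
proof -
  have xV: "V x" using W_V[OF x] .
  obtain B where B: "B \<ge> 0" "\<And>m j. j < n \<Longrightarrow> gn (pair x (dp m (ev j))) \<le> B * real (Suc m) powr lam"
    using W_bound[OF x] by metis
  have FB: "gn (pair (dual_F x) (dp m (F (ev i)))) \<le> B * real (Suc m) powr lam" if i: "i \<in> {..<n}" for i m
  proof -
    have iV: "V (ev i)" using i by simp
    have eq: "pair (dual_F x) (dp m (F (ev i))) = (\<Sum>k\<le>m. Cc m k \<odot> phi (pair x (dp k (ev i))))"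
      using iV xV V_dual_F[OF xV] by (simp add: dp_F pr_sum_right pr_smul_right pair_dual_F)
    show ?thesis unfolding eq
    proof (rule gn_sum)
      fix k assume k: "k \<in> {..m}"
      have "real (Suc k) powr lam \<le> real (Suc m) powr lam" using k lam by (intro powr_mono2) auto
      hence "gn (pair x (dp k (ev i))) \<le> B * real (Suc m) powr lam"
        using B(2)[of i k] i mult_left_mono[OF _ B(1)] by (meson lessThan_iff order_trans)
      hence "gn (phi (pair x (dp k (ev i)))) \<le> B * real (Suc m) powr lam"
        using gn_phi[of "pair x (dp k (ev i))"] xV iV by simp
      hence "gn (Cc m k \<odot> phi (pair x (dp k (ev i)))) \<le> 1 * (B * real (Suc m) powr lam)"
        using xV iV by (intro gn_emul_bound gn_Cc) auto
      thus "gn (Cc m k \<odot> phi (pair x (dp k (ev i)))) \<le> B * real (Suc m) powr lam" by simp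
    qed (use B xV iV in auto)
  qed
  define R where "R = (\<Sum>j<n. \<Sum>i<n. gn (Ainv (ev j) i))"
  have AE: "inE nv (Ainv (ev j) i)" if "j < n" for i j using evec_inE[OF Ainv(1)] that by simp
  have R: "gn (Ainv (ev j) i) \<le> R" if "i < n" "j < n" for i j
  proof -
    have "gn (Ainv (ev j) i) \<le> (\<Sum>i<n. gn (Ainv (ev j) i))"
      using that AE by (intro member_le_sum) auto
    also have "\<dots> \<le> R" unfolding R_def using that AE
      by (intro member_le_sum[of j "{..<n}" "\<lambda>j. \<Sum>i<n. gn (Ainv (ev j) i)"]) (auto intro!: sum_nonneg)
    finally show ?thesis .
  qed
  have R0: "R \<ge> 0" unfolding R_def using AE by (intro sum_nonneg) auto
  have "gn (pair (dual_F x) (dp m (ev j))) \<le> (R * B) * real (Suc m) powr lam" if j: "j < n" for m j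
  proof -
    have "gn (pair (dual_F x) (dp m (\<Sum>i<n. Ainv (ev j) i \<bullet> F (ev i)))) \<le> R * (B * real (Suc m) powr lam)"
      by (rule growth_comb[OF V_dual_F[OF xV]]) (use AE[OF j] R j FB B(1) R0 lam in auto)
    thus ?thesis using ev_comb_F[OF j] by (simp add: mult.assoc)
  qed
  thus ?thesis unfolding W_def using V_dual_F[OF xV] by auto
qed

text \<open>The dual Frobenius maps a basis of \<open>W lam\<close> to independent elements of \<open>W lam\<close>, hence to
  another basis.\<close>
lemma W_spanned_by_dual_F:
  assumes lam: "lam \<ge> 0" and x: "x \<in> W lam"
  obtains J :: "nat set" and b d where "\<And>j. j \<in> J \<Longrightarrow> b j \<in> W lam" "\<And>j. j \<in> J \<Longrightarrow> inE nv (d j)"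
    "x = (\<Sum>j\<in>J. d j \<bullet> dual_F (b j))"
proof -
  obtain J b where b: "echelon n (W lam) J b" "\<And>v. v \<in> W lam \<Longrightarrow> eproj J b v = v"
    using echelon_exists[OF esub_W] by blast
  have fin: "finite J" by (rule echelon_finite[OF b(1)])
  have bW: "b j \<in> W lam" if "j \<in> J" for j using b(1) that by (simp add: echelon_def)
  have J: "j < n" if "j \<in> J" for j using b(1) that by (auto simp: echelon_def)
  have ind: "d i = 0"
    if d: "\<And>j. j \<in> J \<Longrightarrow> inE nv (d j)" and z: "(\<Sum>j\<in>J. d j \<bullet> dual_F (b j)) = 0" and i: "i \<in> J" for d i
  proof -
    \<comment> \<open>Testing on \<open>F (ev i)\<close> isolates \<open>d i\<close>:
      \<open>phi\<close> fixes 0 and 1, so the pivot entries of the basis survive.\<close>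
    have "0 = pair (\<Sum>j\<in>J. d j \<bullet> dual_F (b j)) (F (ev i))" using z by simp
    also have "\<dots> = (\<Sum>j\<in>J. d j \<odot> pair (dual_F (b j)) (F (ev i)))"
      using d W_V[OF bW] J[OF i] V_dual_F by (simp add: pr_sum_left pr_smul_left)
    also have "\<dots> = (\<Sum>j\<in>J. d j \<odot> (if j = i then eone else 0))"
    proof (rule sum.cong[OF refl])
      fix j assume j: "j \<in> J"
      have "pair (dual_F (b j)) (F (ev i)) = phi (b j i)"
        using W_V[OF bW[OF j]] J[OF i] by (simp add: pair_dual_F pr_ev)
      also have "\<dots> = (if j = i then eone else 0)"
        using b(1) i j by (cases "j = i") (simp_all add: echelon_def)
      finally show "d j \<odot> pair (dual_F (b j)) (F (ev i)) = d j \<odot> (if j = i then eone else 0)" by simp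
    qed
    also have "\<dots> = d i" by (rule sum_delta[OF fin i])
    finally show ?thesis by simp
  qed
  have u: "dual_F (b j) \<in> W lam" if "j \<in> J" for j by (rule W_dual_F[OF bW[OF that] lam])
  obtain d where d: "\<And>j. j \<in> J \<Longrightarrow> inE nv (d j)" "x = (\<Sum>j\<in>J. d j \<bullet> dual_F (b j))"
    using independent_spans[OF esub_W b, of "\<lambda>j. dual_F (b j)" x] u ind x by blast
  show ?thesis by (rule that[OF bW d])
qed

text \<open>Stability of \<open>W lam\<close> under the dual Frobenius controls F v only against
  images \<open>dual_F y\<close>. It is the spanning of \<open>W lam\<close> by such images that
  extends this to every x.\<close>

lemma eann_W_F:
  assumes lam: "lam \<ge> 0" and v: "v \<in> eann n (W lam)" shows "F v \<in> eann n (W lam)"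
proof -
  have vV: "V v" and z: "\<And>x. x \<in> W lam \<Longrightarrow> pair x v = 0"
    using v W_V by (auto simp: eann_def pr_comm)
  have "pair (F v) x = 0" if x: "x \<in> W lam" for x
  proof (rule W_spanned_by_dual_F[OF lam x])
    fix J :: "nat set" and b d assume b: "\<And>j. j \<in> J \<Longrightarrow> b j \<in> W lam"
      and d: "\<And>j. j \<in> J \<Longrightarrow> inE nv (d j)" and xd: "x = (\<Sum>j\<in>J. d j \<bullet> dual_F (b j))"
    have bV: "V (b j)" if "j \<in> J" for j by (rule W_V[OF b[OF that]])
    have uV: "V (dual_F (b j))" if "j \<in> J" for j by (rule V_dual_F[OF bV[OF that]])
    have "pair x (F v) = (\<Sum>j\<in>J. pair (d j \<bullet> dual_F (b j)) (F v))"
      unfolding xd by (rule pr_sum_left) (use vV d uV in auto)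
    also have "\<dots> = 0"
    proof (rule sum.neutral, rule ballI)
      fix j assume j: "j \<in> J"
      have "pair (dual_F (b j)) (F v) = phi (pair (b j) v)" by (rule pair_dual_F[OF bV[OF j] vV])
      also have "pair (b j) v = 0" by (rule z[OF b[OF j]])
      finally show "pair (d j \<bullet> dual_F (b j)) (F v) = 0"
        using d j uV[OF j] vV by (simp add: pr_smul_left lau_fold)
    qed
    finally show ?thesis using W_V[OF x] vV by (simp add: pr_comm)
  qed
  thus ?thesis using vV by (simp add: eann_def)
qed

lemma is_submod_iff:
  "is_submod nv phiK s n A G N \<longleftrightarrow> esub n N \<and> (\<forall>v\<in>N. F v \<in> N) \<and> (\<forall>v\<in>N. D v \<in> N)"
  unfolding is_submod_def esub_def by blast

text \<open>Uniqueness in the description holds because \<open>sol\<close> is injective: the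
  solutions determine the annihilator of N, and the double annihilator recovers N.\<close>

lemma Mlam_eq:
  assumes lam: "lam \<ge> 0"
  shows "Mlam nv phiK s n A G lam = eann n (W lam)"
  unfolding Mlam_def
proof (rule the_equality)
  have sub: "esub n (eann n (W lam))" by (rule esub_eann) (rule W_V)
  show "is_submod nv phiK s n A G (eann n (W lam)) \<and> Sol_lam nv n G lam = Sol_quot nv n G (eann n (W lam))"
  proof
    show "is_submod nv phiK s n A G (eann n (W lam))"
      unfolding is_submod_iff using sub eann_W_F[OF lam] eann_W_D[OF lam] by blast
    have "Sol_quot nv n G (eann n (W lam)) = sol ` eann n (eann n (W lam))"
      by (rule Sol_quot_eq[OF sub eann_W_D[OF lam]])
    thus "Sol_lam nv n G lam = Sol_quot nv n G (eann n (W lam))"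
      by (simp add: Sol_lam_eq[OF lam] eann_eann[OF esub_W])
  qed
next
  fix N assume "is_submod nv phiK s n A G N \<and> Sol_lam nv n G lam = Sol_quot nv n G N"
  hence N: "esub n N" and DN: "\<And>v. v \<in> N \<Longrightarrow> D v \<in> N" and eq: "sol ` W lam = sol ` eann n N"
    using Sol_quot_eq[of N] by (auto simp: is_submod_iff Sol_lam_eq[OF lam])
  have "inj_on sol {x. V x}" by (intro inj_onI) (simp add: inj_sol)
  moreover have "W lam \<subseteq> {x. V x}" "eann n N \<subseteq> {x. V x}" by (auto simp: eann_def W_V)
  ultimately have "W lam = eann n N" using eq by (simp add: inj_on_image_eq_iff)
  thus "N = eann n (W lam)" using eann_eann[OF N] by simp
qed

end

section \<open>Bounded functionals on submodules\<close>

context complete_dvf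
begin

lemma eproj_add: "esub n N \<Longrightarrow> echelon n N J b \<Longrightarrow> evec n v \<Longrightarrow> evec n w \<Longrightarrow>
    eproj J b (v + w) = eproj J b v + eproj J b w"
  unfolding eproj_def sum.distrib[symmetric]
  by (intro sum.cong refl) (auto simp: echelon_def evec_inE esub_evec intro!: smul_add_left[of _ _ n])

lemma eproj_smul: assumes "esub n N" "echelon n N J b" "inE nv c" "evec n v"
  shows "eproj J b (c \<bullet> v) = c \<bullet> eproj J b v"
proof -
  have b: "evec n (b j)" if "j \<in> J" for j using assms that by (auto simp: echelon_def esub_evec)
  have "c \<bullet> eproj J b v = (\<Sum>j\<in>J. c \<bullet> (v j \<bullet> b j))"
    unfolding eproj_def by (rule smul_sum_right[OF assms(3), of _ n]) (use b evec_inE[OF assms(4)] in auto)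
  also have "\<dots> = eproj J b (c \<bullet> v)"
    unfolding eproj_def using b evec_inE[OF assms(4)] assms(3)
    by (intro sum.cong refl) (simp add: smul_smul[of _ _ n] smul_apply)
  finally show ?thesis by simp
qed

text \<open>A dependent family could be shortened by one, and all \<open>b i\<close> would be
  combinations over \<open>J'\<close>. With fewer equations than unknowns some nontrivial
  combination of the \<open>b i\<close> would vanish, which their pivot entries exclude.\<close>

lemma spanning_independent:
  assumes N: "esub n N" and b: "echelon n N J b"
    and u: "\<And>j. j \<in> J \<Longrightarrow> u j \<in> N"
    and span: "\<And>v. v \<in> N \<Longrightarrow> \<exists>c. (\<forall>j\<in>J. inE nv (c j)) \<and> v = (\<Sum>j\<in>J. c j \<bullet> u j)"
    and d: "\<And>j. j \<in> J \<Longrightarrow> inE nv (d j)" and z: "(\<Sum>j\<in>J. d j \<bullet> u j) = 0" and j0: "j0 \<in> J"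
  shows "d j0 = 0"
proof (rule ccontr)
  assume "d j0 \<noteq> 0"
  then obtain e where e: "inE nv e" "d j0 \<odot> e = eone" using E_inverse d[OF j0] by metis
  have fin: "finite J" by (rule echelon_finite[OF b])
  have uV: "evec n (u j)" if "j \<in> J" for j by (rule esub_evec[OF N u[OF that]])
  define J' where "J' = J - {j0}"
  have J': "finite J'" "J = insert j0 J'" "j0 \<notin> J'" "card J' < card J"
    using fin j0 card_Diff1_less[OF fin j0] unfolding J'_def by auto
  define g where "g j = - (e \<odot> d j)" for j
  have gE: "inE nv (g j)" if "j \<in> J" for j using e d[OF that] by (simp add: g_def)
  have u0: "u j0 = (\<Sum>j\<in>J'. g j \<bullet> u j)"
  proof -
    have "d j0 \<bullet> u j0 = - (\<Sum>j\<in>J'. d j \<bullet> u j)"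
      using z J' by (simp add: eq_neg_iff_add_eq_0)
    hence "e \<bullet> (d j0 \<bullet> u j0) = - (e \<bullet> (\<Sum>j\<in>J'. d j \<bullet> u j))"
      using e d uV J' by (simp only:) (rule smul_minus_right[of _ n], auto)
    also have "e \<bullet> (\<Sum>j\<in>J'. d j \<bullet> u j) = (\<Sum>j\<in>J'. e \<bullet> (d j \<bullet> u j))"
      by (rule smul_sum_right[OF e(1), of _ n]) (use d uV J' in auto)
    also have "- \<dots> = (\<Sum>j\<in>J'. g j \<bullet> u j)"
      unfolding sum_negf[symmetric] g_def using e d uV J'
      by (intro sum.cong refl) (simp add: smul_smul[of _ _ n] smul_minus_left[of _ n])
    finally show ?thesis using e d[OF j0] uV[OF j0] by (simp add: smul_smul[of _ _ n] emul_comm)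
  qed
  have "\<exists>c. (\<forall>j\<in>J. inE nv (c j)) \<and> b i = (\<Sum>j\<in>J. c j \<bullet> u j)" if "i \<in> J" for i
    using span b that by (simp add: echelon_def)
  then obtain c where c: "\<And>i j. i \<in> J \<Longrightarrow> j \<in> J \<Longrightarrow> inE nv (c i j)"
    "\<And>i. i \<in> J \<Longrightarrow> b i = (\<Sum>j\<in>J. c i j \<bullet> u j)" by metis
  define c' where "c' i j = c i j + c i j0 \<odot> g j" for i j
  have c'E: "inE nv (c' i j)" if "i \<in> J" "j \<in> J'" for i j
    using that c gE J' j0 by (simp add: c'_def)
  have bc': "b i = (\<Sum>j\<in>J'. c' i j \<bullet> u j)" if i: "i \<in> J" for i
  proof -
    have "b i = c i j0 \<bullet> u j0 + (\<Sum>j\<in>J'. c i j \<bullet> u j)" using c(2)[OF i] J' by simp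
    also have "c i j0 \<bullet> u j0 = (\<Sum>j\<in>J'. c i j0 \<bullet> (g j \<bullet> u j))"
      unfolding u0 by (rule smul_sum_right[of _ _ n]) (use c i j0 gE uV J' in auto)
    also have "\<dots> + (\<Sum>j\<in>J'. c i j \<bullet> u j) = (\<Sum>j\<in>J'. c' i j \<bullet> u j)"
      unfolding sum.distrib[symmetric]
    proof (rule sum.cong[OF refl])
      fix j assume "j \<in> J'"
      hence "j \<in> J" using J' by simp
      thus "c i j0 \<bullet> g j \<bullet> u j + c i j \<bullet> u j = c' i j \<bullet> u j"
        unfolding c'_def using c i j0 gE uV
        by (simp add: smul_smul[of _ _ n] smul_add_left[of _ _ n] add.commute)
    qed
    finally show ?thesis .
  qed
  obtain f where f: "\<forall>i\<in>J. inE nv (f i)" "\<exists>i\<in>J. f i \<noteq> 0" "\<forall>j\<in>J'. (\<Sum>i\<in>J. f i \<odot> c' i j) = 0"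
    using homogeneous_system[OF J'(1) fin J'(4), of c', OF c'E] by blast
  have "(\<Sum>i\<in>J. f i \<bullet> b i) = (\<Sum>i\<in>J. \<Sum>j\<in>J'. (f i \<odot> c' i j) \<bullet> u j)"
  proof (rule sum.cong[OF refl])
    fix i assume i: "i \<in> J"
    have "f i \<bullet> b i = (\<Sum>j\<in>J'. f i \<bullet> (c' i j \<bullet> u j))"
      unfolding bc'[OF i] by (rule smul_sum_right[of _ _ n]) (use f i c'E uV J' in auto)
    also have "\<dots> = (\<Sum>j\<in>J'. (f i \<odot> c' i j) \<bullet> u j)"
      using f i c'E uV J' by (intro sum.cong refl smul_smul[of _ _ n]) auto
    finally show "f i \<bullet> b i = (\<Sum>j\<in>J'. (f i \<odot> c' i j) \<bullet> u j)" .
  qed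
  also have "\<dots> = (\<Sum>j\<in>J'. \<Sum>i\<in>J. (f i \<odot> c' i j) \<bullet> u j)" by (rule sum.swap)
  also have "\<dots> = (\<Sum>j\<in>J'. (\<Sum>i\<in>J. f i \<odot> c' i j) \<bullet> u j)"
    using f c'E uV J' by (intro sum.cong refl smul_sum_left[symmetric, of n]) auto
  also have "\<dots> = 0" using f(3) by simp
  finally have fb: "(\<Sum>i\<in>J. f i \<bullet> b i) = 0" .
  have "f k = 0" if k: "k \<in> J" for k
  proof -
    have "(\<Sum>i\<in>J. f i \<bullet> b i) k = (\<Sum>i\<in>J. f i \<odot> (if i = k then eone else 0))"
      unfolding comb_apply using b k by (intro sum.cong refl) (simp add: echelon_def)
    also have "\<dots> = f k" by (rule sum_delta[OF fin k])
    finally show ?thesis unfolding fb by simp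
  qed
  thus False using f(2) by blast
qed

end

locale phi_nabla_sub = phi_nabla nv p q phiK s n A G
  for nv :: "'k::field_char_0 \<Rightarrow> real" and p q phiK s n A G +
  fixes N :: "'k vec set" and J :: "nat set" and b :: "nat \<Rightarrow> 'k vec"
  assumes N: "esub n N" and FN: "\<And>v. v \<in> N \<Longrightarrow> F v \<in> N" and DN: "\<And>v. v \<in> N \<Longrightarrow> D v \<in> N"
    and ech: "echelon n N J b" and proj: "\<And>v. v \<in> N \<Longrightarrow> eproj J b v = v"
    and nonempty: "J \<noteq> {}"
begin

lemma NV: "v \<in> N \<Longrightarrow> V v"
  by (rule esub_evec[OF N])

lemma bN: "j \<in> J \<Longrightarrow> b j \<in> N"
  using ech by (simp add: echelon_def)

lemma bV [simp]: "j \<in> J \<Longrightarrow> V (b j)"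
  by (rule NV[OF bN])

lemma finJ [simp]: "finite J"
  by (rule echelon_finite[OF ech])

lemma b_diag: "i \<in> J \<Longrightarrow> j \<in> J \<Longrightarrow> b j i = (if j = i then eone else 0)"
  using ech by (simp add: echelon_def)

lemma dpN: "v \<in> N \<Longrightarrow> dp m v \<in> N"
proof -
  assume v: "v \<in> N"
  have "(D ^^ m) v \<in> N" by (induction m) (auto simp: v DN)
  thus ?thesis unfolding dp_def by (rule esub_vksc[OF N])
qed

lemma V_Fpow [simp]: "V v \<Longrightarrow> V ((F ^^ t) v)"
  by (induction t) auto

lemma Fpow_N: "v \<in> N \<Longrightarrow> (F ^^ t) v \<in> N"
  by (induction t) (auto intro: FN)

lemma inE_phipow [simp]: "inE nv c \<Longrightarrow> inE nv ((phi ^^ t) c)"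
  by (induction t) auto

lemma gn_phipow: "inE nv c \<Longrightarrow> gn ((phi ^^ t) c) \<le> gn c"
  by (induction t) (auto intro: order_trans[OF gn_phi])

lemma Fpow_smul: assumes "inE nv c" "V v" shows "(F ^^ t) (c \<bullet> v) = (phi ^^ t) c \<bullet> (F ^^ t) v"
proof -
  have step: "(F ^^ Suc t) (c \<bullet> v) = (phi ^^ Suc t) c \<bullet> (F ^^ Suc t) v"
    if "(F ^^ t) (c \<bullet> v) = (phi ^^ t) c \<bullet> (F ^^ t) v" for t
    using that assms by (simp add: F_smul)
  have base: "(F ^^ 0) (c \<bullet> v) = (phi ^^ 0) c \<bullet> (F ^^ 0) v" by simp
  show ?thesis by (induction t) (fact base, fact step)
qed

lemma Fpow_add: assumes "V v" "V w" shows "(F ^^ t) (v + w) = (F ^^ t) v + (F ^^ t) w"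
proof -
  have step: "(F ^^ Suc t) (v + w) = (F ^^ Suc t) v + (F ^^ Suc t) w"
    if "(F ^^ t) (v + w) = (F ^^ t) v + (F ^^ t) w" for t
    using that assms by (simp add: F_add)
  have base: "(F ^^ 0) (v + w) = (F ^^ 0) v + (F ^^ 0) w" by simp
  show ?thesis by (induction t) (fact base, fact step)
qed

lemma Fpow_0: "(F ^^ t) 0 = 0"
  by (induction t) (simp, simp only: funpow.simps o_apply F_0)

lemma Fpow_sum: "(\<And>x. x \<in> S \<Longrightarrow> V (f x)) \<Longrightarrow> (F ^^ t) (sum f S) = (\<Sum>x\<in>S. (F ^^ t) (f x))"
  using sum_hom(2)[of V "F ^^ t" S f] by (simp add: Fpow_add Fpow_0)

section \<open>Lattices spanned by Frobenius iterates of a basis\<close>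

definition ub :: "nat \<Rightarrow> nat \<Rightarrow> 'k vec" where "ub t j = (F ^^ t) (b j)"

lemma V_ub [simp]: "j \<in> J \<Longrightarrow> V (ub t j)"
  by (simp add: ub_def)

text \<open>The ball of radius \<open>r\<close> for the maximum norm in coordinates along the t-th
  Frobenius images. Membership is existential, so it is usable before these images are known to be
  independent.\<close>

definition lat :: "nat \<Rightarrow> real \<Rightarrow> 'k vec \<Rightarrow> bool" where
  "lat t r v \<longleftrightarrow> (\<exists>d. (\<forall>j\<in>J. inE nv (d j) \<and> gn (d j) \<le> r) \<and> v = (\<Sum>j\<in>J. d j \<bullet> ub t j))"

lemma latI: "(\<And>j. j \<in> J \<Longrightarrow> inE nv (d j)) \<Longrightarrow> (\<And>j. j \<in> J \<Longrightarrow> gn (d j) \<le> r) \<Longrightarrow> lat t r (\<Sum>j\<in>J. d j \<bullet> ub t j)"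
  unfolding lat_def by blast

lemma latE:
  assumes "lat t r v"
  obtains d where "\<And>j. j \<in> J \<Longrightarrow> inE nv (d j)" "\<And>j. j \<in> J \<Longrightarrow> gn (d j) \<le> r" "v = (\<Sum>j\<in>J. d j \<bullet> ub t j)"
  using assms unfolding lat_def by blast

lemma lat_ge0: assumes "lat t r v" shows "0 \<le> r"
proof -
  obtain d where d: "\<And>j. j \<in> J \<Longrightarrow> inE nv (d j)" "\<And>j. j \<in> J \<Longrightarrow> gn (d j) \<le> r"
    using latE[OF assms] by blast
  obtain j where "j \<in> J" using nonempty by blast
  thus ?thesis using d gn_ge0 order_trans by blast
qed

lemma lat_0: "0 \<le> r \<Longrightarrow> lat t r 0"
  unfolding lat_def by (intro exI[of _ "\<lambda>_. 0"]) (simp add: lau_fold)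

lemma lat_mono: assumes "lat t r v" "r \<le> r'" shows "lat t r' v"
proof -
  obtain d where d: "\<And>j. j \<in> J \<Longrightarrow> inE nv (d j)" "\<And>j. j \<in> J \<Longrightarrow> gn (d j) \<le> r" "v = (\<Sum>j\<in>J. d j \<bullet> ub t j)"
    using latE[OF assms(1)] by blast
  show ?thesis unfolding d(3) using d(1) order_trans[OF d(2) assms(2)] by (rule latI)
qed

lemma lat_add: assumes "lat t r v" "lat t r w" shows "lat t r (v + w)"
proof -
  obtain d where d: "\<And>j. j \<in> J \<Longrightarrow> inE nv (d j)" "\<And>j. j \<in> J \<Longrightarrow> gn (d j) \<le> r" "v = (\<Sum>j\<in>J. d j \<bullet> ub t j)"
    using latE[OF assms(1)] by blast
  obtain e where e: "\<And>j. j \<in> J \<Longrightarrow> inE nv (e j)" "\<And>j. j \<in> J \<Longrightarrow> gn (e j) \<le> r" "w = (\<Sum>j\<in>J. e j \<bullet> ub t j)"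
    using latE[OF assms(2)] by blast
  have "v + w = (\<Sum>j\<in>J. (d j + e j) \<bullet> ub t j)"
    unfolding d(3) e(3) sum.distrib[symmetric] using d e
    by (intro sum.cong refl smul_add_left[symmetric, of _ _ n]) auto
  moreover have "lat t r (\<Sum>j\<in>J. (d j + e j) \<bullet> ub t j)"
    using d e by (intro latI) (auto intro: gn_add)
  ultimately show ?thesis by simp
qed

lemma lat_smul: assumes "lat t r v" "inE nv c" "gn c \<le> \<rho>" shows "lat t (\<rho> * r) (c \<bullet> v)"
proof -
  obtain d where d: "\<And>j. j \<in> J \<Longrightarrow> inE nv (d j)" "\<And>j. j \<in> J \<Longrightarrow> gn (d j) \<le> r" "v = (\<Sum>j\<in>J. d j \<bullet> ub t j)"
    using latE[OF assms(1)] by blast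
  have "c \<bullet> v = (\<Sum>j\<in>J. c \<bullet> (d j \<bullet> ub t j))"
    unfolding d(3) by (rule smul_sum_right[of _ _ n]) (use d assms in auto)
  also have "\<dots> = (\<Sum>j\<in>J. (c \<odot> d j) \<bullet> ub t j)"
    using d assms by (intro sum.cong refl smul_smul[of _ _ n]) auto
  finally have "c \<bullet> v = (\<Sum>j\<in>J. (c \<odot> d j) \<bullet> ub t j)" .
  moreover have "lat t (\<rho> * r) (\<Sum>j\<in>J. (c \<odot> d j) \<bullet> ub t j)"
    using d assms by (intro latI) (auto intro: gn_emul_bound)
  ultimately show ?thesis by simp
qed

lemma lat_smul_le1: "lat t r v \<Longrightarrow> inE nv c \<Longrightarrow> gn c \<le> 1 \<Longrightarrow> lat t r (c \<bullet> v)"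
  using lat_smul[of t r v c 1] by simp

lemma lat_sum: "0 \<le> r \<Longrightarrow> (\<And>x. x \<in> S \<Longrightarrow> lat t r (f x)) \<Longrightarrow> lat t r (sum f S)"
  using sum_hom(1)[of "lat t r" id S f] lat_0 lat_add by simp

lemma lat_V: "lat t r v \<Longrightarrow> V v"
  by (elim latE) auto

lemma lat_vksc: assumes "lat t r v" shows "lat t (nv c * r) (vksc c v)"
proof -
  have "vksc c v = ksc c eone \<bullet> v" using vksc_smul[of eone n v c] lat_V[OF assms] by simp
  thus ?thesis using lat_smul[OF assms, of "ksc c eone" "nv c"] by simp
qed

lemma lat_ub: "j \<in> J \<Longrightarrow> lat t 1 (ub t j)"
proof -
  assume j: "j \<in> J"
  have "(\<Sum>i\<in>J. (if i = j then eone else 0) \<bullet> ub t i) = (\<Sum>i\<in>J. if i = j then ub t i else 0)"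
    by (intro sum.cong refl) auto
  also have "\<dots> = ub t j" using j by simp
  finally have "ub t j = (\<Sum>i\<in>J. (if i = j then eone else 0) \<bullet> ub t i)" by simp
  moreover have "lat t 1 (\<Sum>i\<in>J. (if i = j then eone else 0) \<bullet> ub t i)" by (intro latI) auto
  ultimately show ?thesis by simp
qed

lemma lat_Fpow:
  assumes w: "w \<in> N" and r: "\<And>i. i \<in> J \<Longrightarrow> gn (w i) \<le> r" shows "lat t r ((F ^^ t) w)"
proof -
  note wE = evec_inE[OF NV[OF w]]
  have "(F ^^ t) w = (F ^^ t) (\<Sum>i\<in>J. w i \<bullet> b i)" using proj[OF w] by (simp add: eproj_def)
  also have "\<dots> = (\<Sum>i\<in>J. (F ^^ t) (w i \<bullet> b i))" by (rule Fpow_sum) (use wE in auto)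
  also have "\<dots> = (\<Sum>i\<in>J. (phi ^^ t) (w i) \<bullet> ub t i)"
    using wE by (intro sum.cong refl) (simp add: Fpow_smul ub_def)
  finally show ?thesis using latI[of "\<lambda>i. (phi ^^ t) (w i)" r t] wE r gn_phipow order_trans by (metis inE_phipow)
qed

text \<open>\<open>phi\<close> fixes 0 and 1, so the \<open>phiv (b j)\<close> keep the pivot
  entries of the \<open>b j\<close> and are independent; \<open>MA\<close> is injective, so the
  \<open>F (b j)\<close> are independent too. Being as many as the pivots, they span N.\<close>

lemma spans_1: assumes v: "v \<in> N" shows "\<exists>r. lat 1 r v"
proof -
  have "d i = 0"
    if d: "\<And>j. j \<in> J \<Longrightarrow> inE nv (d j)" and z: "(\<Sum>j\<in>J. d j \<bullet> F (b j)) = 0" and i: "i \<in> J" for d i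
  proof -
    have "MA (\<Sum>j\<in>J. d j \<bullet> phiv (b j)) = (\<Sum>j\<in>J. MA (d j \<bullet> phiv (b j)))"
      by (rule MA_sum) (use d in auto)
    also have "\<dots> = (\<Sum>j\<in>J. d j \<bullet> F (b j))"
      using d by (intro sum.cong refl) (simp add: MA_smul F_eq)
    finally have "MA (\<Sum>j\<in>J. d j \<bullet> phiv (b j)) = MA 0" using z by simp
    hence "(\<Sum>j\<in>J. d j \<bullet> phiv (b j)) = 0" by (rule MA_inj[rotated 2]) (use d in auto)
    hence "(\<Sum>j\<in>J. d j \<bullet> phiv (b j)) i = 0" by simp
    moreover have "(\<Sum>j\<in>J. d j \<bullet> phiv (b j)) i = (\<Sum>j\<in>J. d j \<odot> (if j = i then eone else 0))"
      unfolding comb_apply phiv_def using b_diag[OF i] by (intro sum.cong refl) simp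
    ultimately show ?thesis using sum_delta[OF finJ i, of d] by simp
  qed
  then obtain d where d: "\<And>j. j \<in> J \<Longrightarrow> inE nv (d j)" "v = (\<Sum>j\<in>J. d j \<bullet> F (b j))"
    using independent_spans[OF N ech proj, of "\<lambda>j. F (b j)" v] FN bN v by blast
  have "v = (\<Sum>j\<in>J. d j \<bullet> ub 1 j)" using d(2) by (simp add: ub_def)
  moreover have "lat 1 (\<Sum>j\<in>J. gn (d j)) (\<Sum>j\<in>J. d j \<bullet> ub 1 j)"
    by (rule latI) (use d in \<open>auto intro!: member_le_sum\<close>)
  ultimately show ?thesis by metis
qed

lemma lat_finite_family:
  assumes "\<And>i. i \<in> J \<Longrightarrow> \<exists>r. lat t r (f i)" shows "\<exists>r. \<forall>i\<in>J. lat t r (f i)"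
proof -
  obtain r where r: "\<And>i. i \<in> J \<Longrightarrow> lat t (r i) (f i)" using assms by metis
  have "lat t (\<Sum>i\<in>J. r i) (f i)" if "i \<in> J" for i
    using r[OF that] lat_mono member_le_sum[OF that, of r] lat_ge0[OF r] by auto
  thus ?thesis by blast
qed

text \<open>Write v through the \<open>F (b j)\<close> and each \<open>b j\<close> through the t-th
  images; applying \<open>F\<close> to the latter raises t by one. The radius may vary with
  t.\<close>

lemma spans: "v \<in> N \<Longrightarrow> \<exists>r. lat t r v"
proof (induction t arbitrary: v)
  case 0
  have "lat 0 (\<Sum>j\<in>J. gn (v j)) ((F ^^ 0) v)"
    by (rule lat_Fpow[OF 0]) (use evec_inE[OF NV[OF 0]] in \<open>auto intro!: member_le_sum\<close>)
  thus ?case by auto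
next
  case (Suc t)
  obtain r where r: "\<forall>i\<in>J. lat t r (b i)" using lat_finite_family[of t b] Suc.IH bN by blast
  have lift: "lat (Suc t) r (F w)" if w: "lat t r w" for w
  proof -
    obtain d where d: "\<And>j. j \<in> J \<Longrightarrow> inE nv (d j)" "\<And>j. j \<in> J \<Longrightarrow> gn (d j) \<le> r" "w = (\<Sum>j\<in>J. d j \<bullet> ub t j)"
      using latE[OF w] by blast
    have "F w = (\<Sum>j\<in>J. F (d j \<bullet> ub t j))" unfolding d(3) by (rule F_sum) (use d in auto)
    also have "\<dots> = (\<Sum>j\<in>J. phi (d j) \<bullet> ub (Suc t) j)"
      using d by (intro sum.cong refl) (simp add: F_smul, simp add: ub_def)
    finally have "F w = (\<Sum>j\<in>J. phi (d j) \<bullet> ub (Suc t) j)" .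
    moreover have "lat (Suc t) r (\<Sum>j\<in>J. phi (d j) \<bullet> ub (Suc t) j)"
      using d by (intro latI) (auto intro: order_trans[OF gn_phi])
    ultimately show ?thesis by simp
  qed
  obtain r1 where "lat 1 r1 v" using spans_1[OF Suc.prems] by blast
  then obtain d where d: "\<And>j. j \<in> J \<Longrightarrow> inE nv (d j)" "\<And>j. j \<in> J \<Longrightarrow> gn (d j) \<le> r1" "v = (\<Sum>j\<in>J. d j \<bullet> ub 1 j)"
    using latE by blast
  have "lat (Suc t) (r1 * r) (\<Sum>j\<in>J. d j \<bullet> ub 1 j)"
  proof (rule lat_sum)
    obtain j where j: "j \<in> J" using nonempty by blast
    have "0 \<le> r1" using gn_ge0[OF d(1)[OF j]] d(2)[OF j] by linarith
    thus "0 \<le> r1 * r" using lat_ge0[of t r "b j"] r j by simp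
    fix j assume j: "j \<in> J"
    have "lat (Suc t) r (ub 1 j)" using lift[of "b j"] r j by (simp add: ub_def)
    thus "lat (Suc t) (r1 * r) (d j \<bullet> ub 1 j)" using d j by (intro lat_smul) auto
  qed
  thus ?case using d(3) by blast
qed

lemma ub_independent:
  assumes d: "\<And>j. j \<in> J \<Longrightarrow> inE nv (d j)" and z: "(\<Sum>j\<in>J. d j \<bullet> ub t j) = 0" and j: "j \<in> J"
  shows "d j = 0"
proof (rule spanning_independent[OF N ech, of "ub t" d])
  show "ub t j \<in> N" if "j \<in> J" for j using Fpow_N[OF bN[OF that]] by (simp add: ub_def)
  show "\<exists>c. (\<forall>j\<in>J. inE nv (c j)) \<and> v = (\<Sum>j\<in>J. c j \<bullet> ub t j)" if "v \<in> N" for v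
    using spans[OF that, of t] unfolding lat_def by blast
qed (use assms in auto)

subsection \<open>Divided powers of the connection contract the lattices\<close>

text \<open>By the chain rule, the derivative of the t-fold Frobenius image of the variable.\<close>

primrec st :: "nat \<Rightarrow> 'k lau" where
  "st 0 = eone"
| "st (Suc t) = ederiv s \<odot> phi (st t)"

lemma inE_st [simp]: "inE nv (st t)"
  by (induction t) auto

lemma gn_st: "gn (st t) \<le> gn (ederiv s) ^ t"
proof (induction t)
  case (Suc t)
  have "gn (phi (st t)) \<le> gn (ederiv s) ^ t" using gn_phi[of "st t"] Suc by simp
  hence "gn (ederiv s \<odot> phi (st t)) \<le> gn (ederiv s) * gn (ederiv s) ^ t"
    by (intro gn_emul_bound) auto
  thus ?case by simp
qed simp

lemma D_Fpow: assumes v: "V v" shows "D ((F ^^ t) v) = st t \<bullet> (F ^^ t) (D v)"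
proof -
  have step: "D ((F ^^ Suc t) v) = st (Suc t) \<bullet> (F ^^ Suc t) (D v)"
    if IH: "D ((F ^^ t) v) = st t \<bullet> (F ^^ t) (D v)" for t
  proof -
    have "D ((F ^^ Suc t) v) = ederiv s \<bullet> F (D ((F ^^ t) v))" using v by (simp add: D_F)
    also have "\<dots> = ederiv s \<bullet> (phi (st t) \<bullet> F ((F ^^ t) (D v)))"
      unfolding IH using v by (simp add: F_smul)
    finally show ?thesis using v by (simp add: smul_smul[of _ _ n])
  qed
  have base: "D ((F ^^ 0) v) = st 0 \<bullet> (F ^^ 0) (D v)" by simp
  show ?thesis by (induction t) (fact base, fact step)
qed

definition Kb :: real where "Kb = (\<Sum>j\<in>J. \<Sum>i\<in>J. gn (D (b j) i))"

lemma Kb: assumes "i \<in> J" "j \<in> J" shows "gn (D (b j) i) \<le> Kb" and Kb_ge0: "0 \<le> Kb"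
proof -
  have E: "inE nv (D (b j) i)" if "j \<in> J" for i j using evec_inE[OF V_D[OF bV[OF that]]] .
  show "0 \<le> Kb" unfolding Kb_def using E by (intro sum_nonneg) auto
  have "gn (D (b j) i) \<le> (\<Sum>i\<in>J. gn (D (b j) i))" using assms E by (intro member_le_sum) auto
  also have "\<dots> \<le> Kb" unfolding Kb_def using assms E
    by (intro member_le_sum[of j J "\<lambda>j. \<Sum>i\<in>J. gn (D (b j) i)"]) (auto intro!: sum_nonneg)
  finally show "gn (D (b j) i) \<le> Kb" .
qed

text \<open>Bounds \<open>D\<close> on the t-th Frobenius images in their own coordinates. It tends
  to 0 geometrically, as |s'| < 1.\<close>

definition \<delta> :: "nat \<Rightarrow> real" where "\<delta> t = gn (ederiv s) ^ t * Kb"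

lemma \<delta>_ge0: "0 \<le> \<delta> t"
  using nonempty Kb_ge0 by (auto simp: \<delta>_def)

lemma lat_D_ub: assumes j: "j \<in> J" shows "lat t (\<delta> t) (D (ub t j))"
proof -
  have "lat t Kb ((F ^^ t) (D (b j)))" using Kb[OF _ j] by (intro lat_Fpow DN bN j)
  thus ?thesis unfolding ub_def D_Fpow[OF bV[OF j]] \<delta>_def
    by (rule lat_smul) (auto intro: gn_st)
qed

lemma lat_D: assumes v: "lat t r v" and small: "\<delta> t \<le> 1" shows "lat t r (D v)"
proof -
  obtain d where d: "\<And>j. j \<in> J \<Longrightarrow> inE nv (d j)" "\<And>j. j \<in> J \<Longrightarrow> gn (d j) \<le> r" "v = (\<Sum>j\<in>J. d j \<bullet> ub t j)"
    using latE[OF v] by blast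
  have r0: "0 \<le> r" by (rule lat_ge0[OF v])
  have "D v = (\<Sum>j\<in>J. D (d j \<bullet> ub t j))" unfolding d(3) by (rule D_sum) (use d in auto)
  also have "\<dots> = (\<Sum>j\<in>J. ederiv (d j) \<bullet> ub t j + d j \<bullet> D (ub t j))"
    using d by (intro sum.cong refl D_smul) auto
  finally have eq: "D v = (\<Sum>j\<in>J. ederiv (d j) \<bullet> ub t j + d j \<bullet> D (ub t j))" .
  show ?thesis unfolding eq
  proof (intro lat_sum r0 lat_add)
    fix j assume j: "j \<in> J"
    have "lat t (r * 1) (ederiv (d j) \<bullet> ub t j)"
      using d j by (intro lat_smul lat_ub) (auto intro: order_trans[OF gn_ederiv])
    thus "lat t r (ederiv (d j) \<bullet> ub t j)" by simp
    have "lat t (r * 1) (d j \<bullet> D (ub t j))"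
      using d j small by (intro lat_smul) (auto intro: lat_mono[OF lat_D_ub])
    thus "lat t r (d j \<bullet> D (ub t j))" by simp
  qed
qed

text \<open>The first application of \<open>D\<close> gains the factor \<open>\<delta> t\<close>,
  and the following ones lose nothing. This single gain has to pay for the division by m!, which
  explains the hypothesis on t.\<close>

lemma lat_dp_ub: assumes j: "j \<in> J" and small: "\<delta> t \<le> nv (of_nat (fact m))" shows "lat t 1 (dp m (ub t j))"
proof (cases m)
  case 0
  thus ?thesis using lat_ub[OF j] by simp
next
  case (Suc l)
  have "\<delta> t \<le> 1" using small nv_of_nat_le1 order_trans by blast
  hence "lat t (\<delta> t) ((D ^^ i) (D (ub t j)))" for i
    by (induction i) (auto intro: lat_D lat_D_ub[OF j])
  hence "lat t (\<delta> t) ((D ^^ m) (ub t j))" unfolding Suc by (simp only: funpow_Suc_right o_apply)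
  hence "lat t (nv (1 / of_nat (fact m)) * \<delta> t) (dp m (ub t j))" unfolding dp_def by (rule lat_vksc)
  moreover have "nv (1 / of_nat (fact m)) * \<delta> t \<le> 1"
  proof -
    have "nv (of_nat (fact m)) > 0"
      by (metis fact_nonzero nv_eq0 nv_ge0 of_nat_eq_0_iff order_le_less)
    thus ?thesis using small unfolding nv_divide by (simp add: divide_le_eq)
  qed
  ultimately show ?thesis by (rule lat_mono)
qed

lemma nv_fact_mono: assumes "k \<le> m" shows "nv (of_nat (fact m)) \<le> nv (of_nat (fact k))"
proof -
  obtain c :: nat where "fact m = fact k * c" using fact_dvd[OF assms] by (auto elim: dvdE)
  hence "nv (of_nat (fact m)) = nv (of_nat (fact k)) * nv (of_nat c)" by (simp only: of_nat_mult nv_mult)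
  also have "\<dots> \<le> nv (of_nat (fact k)) * 1" by (intro mult_left_mono nv_of_nat_le1) auto
  finally show ?thesis by simp
qed

lemma lat_dp: assumes v: "lat t r v" and small: "\<delta> t \<le> nv (of_nat (fact m))" shows "lat t r (dp m v)"
proof -
  obtain d where d: "\<And>j. j \<in> J \<Longrightarrow> inE nv (d j)" "\<And>j. j \<in> J \<Longrightarrow> gn (d j) \<le> r" "v = (\<Sum>j\<in>J. d j \<bullet> ub t j)"
    using latE[OF v] by blast
  have r0: "0 \<le> r" by (rule lat_ge0[OF v])
  have "dp m v = (\<Sum>j\<in>J. dp m (d j \<bullet> ub t j))" unfolding d(3) by (rule dp_sum) (use d in auto)
  also have "\<dots> = (\<Sum>j\<in>J. \<Sum>k\<le>m. tau (d j) k \<bullet> dp (m - k) (ub t j))"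
    using d by (intro sum.cong refl dp_smul) auto
  finally have eq: "dp m v = (\<Sum>j\<in>J. \<Sum>k\<le>m. tau (d j) k \<bullet> dp (m - k) (ub t j))" .
  show ?thesis unfolding eq
  proof (intro lat_sum r0)
    fix j k assume j: "j \<in> J"
    have "\<delta> t \<le> nv (of_nat (fact (m - k)))" using small nv_fact_mono[of "m - k" m] by simp
    hence "lat t (r * 1) (tau (d j) k \<bullet> dp (m - k) (ub t j))"
      using d j by (intro lat_smul lat_dp_ub) (auto intro: order_trans[OF gn_tau])
    thus "lat t r (tau (d j) k \<bullet> dp (m - k) (ub t j))" by simp
  qed
qed

lemma eventually_small: "\<forall>\<^sub>F t in sequentially. \<delta> t \<le> nv (of_nat (fact m))"
proof -
  have pos: "nv (of_nat (fact m)) > 0"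
    by (metis fact_nonzero nv_eq0 nv_ge0 of_nat_eq_0_iff order_le_less)
  have "(\<lambda>t. gn (ederiv s) ^ t) \<longlonglongrightarrow> 0" using gn_s_deriv by (intro LIMSEQ_power_zero) simp
  hence "\<delta> \<longlonglongrightarrow> 0" unfolding \<delta>_def by (rule tendsto_mult_left_zero)
  hence "\<forall>\<^sub>F t in sequentially. \<delta> t < nv (of_nat (fact m))" using pos by (rule order_tendstoD(2))
  thus ?thesis by (rule eventually_mono) simp
qed

subsection \<open>A bounded functional\<close>

lemma coords_exist:
  obtains c where "\<And>t i j. i \<in> J \<Longrightarrow> j \<in> J \<Longrightarrow> inE nv (c t i j)"
    "\<And>t i. i \<in> J \<Longrightarrow> b i = (\<Sum>j\<in>J. c t i j \<bullet> ub t j)"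
proof -
  define Q where "Q t i d \<longleftrightarrow> (\<forall>j\<in>J. inE nv (d j)) \<and> b i = (\<Sum>j\<in>J. d j \<bullet> ub t j)" for t i d
  have ex: "\<exists>d. Q t i d" if "i \<in> J" for t i
    using spans[OF bN[OF that], of t] unfolding lat_def Q_def by blast
  have Q: "Q t i (SOME d. Q t i d)" if "i \<in> J" for t i by (rule someI_ex[OF ex[OF that]])
  show ?thesis by (rule that[of "\<lambda>t i. SOME d. Q t i d"]) (use Q in \<open>simp_all add: Q_def\<close>)
qed

text \<open>\<open>M t\<close> is the largest coordinate of the basis of N along the t-th images. P
  contains every \<open>dp m (b i)\<close>, since for fixed m the scaled lattices with large t are
  stable under \<open>dp m\<close>. If P contained p^-1 \<open>b i\<close> for all i, some t would
  give p \<open>M t\<close> \<le> \<open>M t\<close> and hence a vanishing basis vector. So P is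
  proper and admits a nonzero functional bounded on it.\<close>

lemma bounded_functional_exists:
  obtains x C where "V x" "\<exists>v\<in>N. pair x v \<noteq> 0" "0 \<le> C"
    "\<And>i m. i \<in> J \<Longrightarrow> gn (pair x (dp m (b i))) \<le> C"
proof -
  obtain c where cE: "\<And>t i j. i \<in> J \<Longrightarrow> j \<in> J \<Longrightarrow> inE nv (c t i j)"
    and c: "\<And>t i. i \<in> J \<Longrightarrow> b i = (\<Sum>j\<in>J. c t i j \<bullet> ub t j)"
    using coords_exist by blast
  define M where "M t = Max ((\<lambda>(i, j). gn (c t i j)) ` (J \<times> J))" for t
  have Mge: "gn (c t i j) \<le> M t" if "i \<in> J" "j \<in> J" for t i j
    unfolding M_def by (rule Max_ge) (use that in auto)
  have Mattained: "\<exists>i\<in>J. \<exists>j\<in>J. M t = gn (c t i j)" for t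
  proof -
    have "M t \<in> (\<lambda>(i, j). gn (c t i j)) ` (J \<times> J)"
      unfolding M_def by (rule Max_in) (use nonempty in auto)
    thus ?thesis by auto
  qed
  have M0: "0 \<le> M t" for t using Mattained[of t] cE gn_ge0 by metis
  have lat_b: "lat t (M t) (b i)" if i: "i \<in> J" for t i
    unfolding lat_def using cE[OF i] c[OF i, of t] Mge[OF i] by (intro exI[of _ "c t i"]) simp
  \<comment> \<open>Membership is tested on the projection to N, so P contains the whole kernel of
    \<open>eproj J b\<close>. A functional bounded on P must vanish on that subspace; if it is
    nonzero, it is therefore nonzero on N.\<close>
  define P where "P = {u. V u \<and> (\<forall>\<^sub>F t in sequentially. lat t (M t) (eproj J b u))}"
  have P: "ball_module n P"
    unfolding ball_module_def
  proof (intro conjI ballI allI impI)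
    show "0 \<in> P" unfolding P_def using lat_0[OF M0] by (simp add: eproj_def)
    fix v w assume "v \<in> P" "w \<in> P"
    thus "v + w \<in> P"
      unfolding P_def by (auto simp: eproj_add[OF N ech] elim: eventually_elim2 intro: lat_add)
  next
    fix a v assume "inE nv a" "gn a \<le> 1" "v \<in> P"
    thus "a \<bullet> v \<in> P"
      unfolding P_def by (auto simp: eproj_smul[OF N ech] elim: eventually_mono intro: lat_smul_le1)
  qed (simp add: P_def)
  have "\<exists>i\<in>J. pwi 1 \<bullet> b i \<notin> P"
  proof (rule ccontr)
    assume "\<not> ?thesis"
    hence "\<forall>i\<in>J. \<forall>\<^sub>F t in sequentially. lat t (M t) (eproj J b (pwi 1 \<bullet> b i))"
      unfolding P_def by blast
    hence "\<forall>\<^sub>F t in sequentially. \<forall>i\<in>J. lat t (M t) (eproj J b (pwi 1 \<bullet> b i))"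
      by (simp add: eventually_ball_finite_distrib)
    then obtain t where t: "\<And>i. i \<in> J \<Longrightarrow> lat t (M t) (eproj J b (pwi 1 \<bullet> b i))"
      unfolding eventually_sequentially by blast
    obtain i j where ij: "i \<in> J" "j \<in> J" "M t = gn (c t i j)" using Mattained by blast
    have "eproj J b (pwi 1 \<bullet> b i) = pwi 1 \<bullet> b i"
      by (intro proj esub_smul[OF N] bN ij) simp
    then obtain d where d: "\<And>j. j \<in> J \<Longrightarrow> inE nv (d j)" "\<And>j. j \<in> J \<Longrightarrow> gn (d j) \<le> M t"
      "pwi 1 \<bullet> b i = (\<Sum>j\<in>J. d j \<bullet> ub t j)"
      using latE[OF t[OF ij(1)]] by metis
    have "pwi 1 \<bullet> b i = (\<Sum>j\<in>J. pwi 1 \<bullet> (c t i j \<bullet> ub t j))"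
      unfolding c[OF ij(1), of t] by (rule smul_sum_right[of _ _ n]) (use cE ij in auto)
    also have "\<dots> = (\<Sum>j\<in>J. (pwi 1 \<odot> c t i j) \<bullet> ub t j)"
      using cE ij by (intro sum.cong refl smul_smul[of _ _ n]) auto
    finally have e: "pwi 1 \<bullet> b i = (\<Sum>j\<in>J. (pwi 1 \<odot> c t i j) \<bullet> ub t j)" .
    \<comment> \<open>Coordinates along the t-th images are unique: those of p^-1 \<open>b i\<close>
      are p^-1 times those of \<open>b i\<close>, and so inherit the bound
      \<open>M t\<close>.\<close>
    have "(\<Sum>j\<in>J. (d j - pwi 1 \<odot> c t i j) \<bullet> ub t j) = 0"
    proof -
      have "(\<Sum>j\<in>J. (d j - pwi 1 \<odot> c t i j) \<bullet> ub t j)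
          = (\<Sum>j\<in>J. d j \<bullet> ub t j + - ((pwi 1 \<odot> c t i j) \<bullet> ub t j))"
      proof (rule sum.cong[OF refl])
        fix j assume j: "j \<in> J"
        have "(d j + - (pwi 1 \<odot> c t i j)) \<bullet> ub t j = d j \<bullet> ub t j + (- (pwi 1 \<odot> c t i j)) \<bullet> ub t j"
          using d(1) cE ij j by (intro smul_add_left[of _ _ n]) auto
        thus "(d j - pwi 1 \<odot> c t i j) \<bullet> ub t j = d j \<bullet> ub t j + - ((pwi 1 \<odot> c t i j) \<bullet> ub t j)"
          using cE ij j by (simp add: smul_minus_left[of _ n])
      qed
      thus ?thesis using d(3) e by (simp add: sum_subtractf)
    qed
    hence "d j - pwi 1 \<odot> c t i j = 0"
      by (rule ub_independent[rotated, OF _ ij(2)]) (use d cE ij in auto)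
    hence "gn (pwi 1 \<odot> c t i j) \<le> M t" using d(2)[OF ij(2)] by simp
    hence "real p * M t \<le> M t"
      using cE ij by (simp add: gn_emul pwi_def nv_inverse nv_p)
    moreover have "real p \<ge> 2" using prime_ge_2_nat[OF p_prime] by simp
    ultimately have "M t \<le> 0"
      using M0[of t] mult_right_mono[of 2 "real p" "M t"] by linarith
    hence "gn (c t i j) = 0" if "j \<in> J" for j
      using Mge[OF ij(1) that, of t] gn_ge0[OF cE[OF ij(1) that], of t] by linarith
    hence "c t i j = 0" if "j \<in> J" for j using gn_eq0 cE[OF ij(1)] that by blast
    hence "b i = 0" using c[OF ij(1), of t] by simp
    moreover have "b i i = eone" using b_diag[OF ij(1) ij(1)] by simp
    ultimately show False by (metis eone_neq0 zero_fun_apply)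
  qed
  then obtain i where i: "i \<in> J" "pwi 1 \<bullet> b i \<notin> P" by blast
  define w where "w = pwi 1 \<bullet> b i"
  have "V w" unfolding w_def using i(1) by (intro evec_smul inE_pw bV)
  moreover have "w \<notin> P" using i(2) unfolding w_def .
  ultimately obtain x C where x: "V x" "x \<noteq> 0" and C: "\<And>v. v \<in> P \<Longrightarrow> gn (pair x v) \<le> C"
    using bounded_functional[OF P] by blast
  have "\<exists>v\<in>N. pair x v \<noteq> 0"
  proof (rule ccontr)
    assume "\<not> ?thesis"
    hence xN: "\<And>v. v \<in> N \<Longrightarrow> pair x v = 0" by blast
    have "x i = 0" if i: "i < n" for i
    proof -
      have RN: "eproj J b (ev i) \<in> N" using i by (intro eproj_in[OF N ech]) simp
      define w where "w = ev i - eproj J b (ev i)"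
      have wV: "V w" unfolding w_def using i NV[OF RN] by simp
      have "eproj J b (w + eproj J b (ev i)) = eproj J b w + eproj J b (ev i)"
        using eproj_add[OF N ech wV NV[OF RN]] proj[OF RN] by simp
      hence Rw: "eproj J b w = 0" by (simp add: w_def)
      have "pwi k \<bullet> w \<in> P" for k
        unfolding P_def using wV lat_0[OF M0] by (simp add: eproj_smul[OF N ech] Rw)
      hence "gn (pair x (pwi k \<bullet> w)) \<le> C" for k by (rule C)
      hence bd: "real p ^ k * gn (pair x w) \<le> C" for k
        using x(1) wV by (simp add: pr_smul_right gn_emul) (simp add: pwi_def nv_inverse nv_p nv_power power_inverse power_one_over)
      have "pair x w = 0"
      proof (rule small_gn_0)
        show "inE nv (pair x w)" using x(1) wV by simp
        fix e :: real assume e: "e > 0"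
        obtain k where k: "(1 / real p) ^ k * (C / e) \<le> 1" using pw_small by blast
        have pk: "real p ^ k > 0" using prime_gt_0_nat[OF p_prime] by simp
        hence "C \<le> e * real p ^ k" using k e by (simp add: power_one_over field_simps)
        hence "real p ^ k * gn (pair x w) \<le> real p ^ k * e" using bd[of k] by (simp add: mult.commute)
        thus "gn (pair x w) \<le> e" using pk by simp
      qed
      moreover have "pair x (ev i) = pair x w + pair x (eproj J b (ev i))"
        using pr_add_right[OF x(1) wV NV[OF RN]] by (simp add: w_def)
      ultimately show ?thesis using xN[OF RN] i by (simp add: pr_ev)
    qed
    hence "x j = 0" for j using x(1) by (cases "j < n") (auto simp: inEvec_def)
    hence "x = 0" by (intro ext[of x 0]) simp
    thus False using x(2) by simp
  qed
  moreover have "gn (pair x (dp m (b i))) \<le> C" if i: "i \<in> J" for i m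
  proof (rule C)
    have "\<forall>\<^sub>F t in sequentially. lat t (M t) (dp m (b i))"
      using eventually_small[of m] by (rule eventually_mono) (intro lat_dp lat_b i)
    thus "dp m (b i) \<in> P" unfolding P_def using proj[OF dpN[OF bN[OF i]], of m] i by simp
  qed
  moreover have "0 \<le> C"
  proof -
    have "gn (pair x 0) \<le> C" by (intro C ball_0[OF P])
    thus ?thesis by simp
  qed
  ultimately show ?thesis using that x(1) by blast
qed

end

section \<open>Growth of extensions\<close>

context complete_dvf
begin

text \<open>The Beta integral \<open>\<integral> y\<^sup>k (1 - y)\<^sup>l\<close> is an alternating sum of reciprocals of numbers at most
  \<open>k + l + 1\<close>.\<close>
lemma nv_beta_le:
  "nv (of_nat (fact k) * of_nat (fact l) / of_nat (fact (k + l + 1))) \<le> real (k + l + 1)"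
proof (induction l arbitrary: k)
  case 0
  have "of_nat (fact k) * of_nat (fact 0) / of_nat (fact (k + 0 + 1)) = (1 / of_nat (Suc k) :: 'k)"
  proof -
    have "(of_nat (fact (Suc k)) :: 'k) = of_nat (Suc k) * of_nat (fact k)"
      by (simp only: fact_Suc of_nat_mult of_nat_id)
    moreover have "(of_nat (fact k) :: 'k) \<noteq> 0" by (simp del: of_nat_fact)
    ultimately show ?thesis by (simp del: of_nat_Suc of_nat_fact)
  qed
  moreover have "1 / nv (of_nat (Suc k)) \<le> real (Suc k)"
  proof -
    have "1 / real (Suc k) \<le> nv (of_nat (Suc k))" by (rule nv_of_nat_lower) simp
    moreover have "0 < 1 / real (Suc k)" by simp
    ultimately have "0 < nv (of_nat (Suc k))" by (rule less_le_trans[rotated])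
    thus ?thesis using \<open>1 / real (Suc k) \<le> nv (of_nat (Suc k))\<close>
      by (simp add: field_simps del: of_nat_Suc)
  qed
  ultimately show ?case by (simp only: nv_divide nv_1)
next
  case (Suc l)
  define a b where "a = (of_nat (fact k) :: 'k)" and "b = (of_nat (fact l) :: 'k)"
  define c where "c = (of_nat (fact (k + l + 1)) :: 'k)"
  have c: "c \<noteq> 0" 
    by (simp only: c_def of_nat_eq_0_iff fact_nonzero not_False_eq_True)
  have N: "(of_nat (k + l + 2) :: 'k) \<noteq> 0" by (simp only: of_nat_eq_0_iff)
  have fk: "of_nat (fact (Suc k)) = of_nat (Suc k) * a" and fl: "of_nat (fact (Suc l)) = of_nat (Suc l) * b"
    unfolding a_def b_def by (simp_all only: fact_Suc of_nat_mult of_nat_id)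
  have "k + Suc l + 1 = Suc (k + l + 1)" "Suc k + l + 1 = Suc (k + l + 1)" "k + l + 2 = Suc (k + l + 1)"
    by simp_all
  hence fc: "of_nat (fact (k + Suc l + 1)) = of_nat (k + l + 2) * c"
    "of_nat (fact (Suc k + l + 1)) = of_nat (k + l + 2) * c"
    by (simp_all only: c_def fact_Suc of_nat_mult of_nat_id)
  have sum: "(of_nat (k + l + 2) :: 'k) = of_nat (Suc k) + of_nat (Suc l)" by simp
  have gen: "M = x + y \<Longrightarrow> M \<noteq> 0 \<Longrightarrow> a * (y * b) / (M * c) = a * b / c - x * a * b / (M * c)" for M x y :: 'k
    using c by (simp add: divide_simps) (simp add: algebra_simps)
  have "a * (of_nat (Suc l) * b) / (of_nat (k + l + 2) * c)
      = a * b / c - of_nat (Suc k) * a * b / (of_nat (k + l + 2) * c)"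
    by (rule gen[OF sum N])
  \<comment> \<open>This is the integral of y^k (1 - y)^(l+1) = y^k (1 - y)^l - y^(k+1) (1 - y)^l.
    Both terms on the right have second exponent l, where the induction hypothesis applies.\<close>
  hence eq: "of_nat (fact k) * of_nat (fact (Suc l)) / of_nat (fact (k + Suc l + 1))
      = of_nat (fact k) * of_nat (fact l) / of_nat (fact (k + l + 1))
        - of_nat (fact (Suc k)) * of_nat (fact l) / (of_nat (fact (Suc k + l + 1)) :: 'k)"
    unfolding fk fl fc unfolding a_def[symmetric] b_def[symmetric] c_def[symmetric] .
  show ?case unfolding eq
  proof (rule nv_diff)
    show "nv (of_nat (fact k) * of_nat (fact l) / of_nat (fact (k + l + 1))) \<le> real (k + Suc l + 1)"
      using Suc[of k] by simp
    show "nv (of_nat (fact (Suc k)) * of_nat (fact l) / of_nat (fact (Suc k + l + 1))) \<le> real (k + Suc l + 1)"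
      using Suc[of "Suc k"] by simp
  qed
qed

end

context phi_nabla_sub
begin

section \<open>Variation of constants along N\<close>

abbreviation R :: "'k vec \<Rightarrow> 'k vec" where "R \<equiv> eproj J b"

lemma RN: "V v \<Longrightarrow> R v \<in> N"
  by (rule eproj_in[OF N ech])

lemma V_R [simp]: "V v \<Longrightarrow> V (R v)"
  by (rule NV[OF RN])

lemma R_add: "V v \<Longrightarrow> V w \<Longrightarrow> R (v + w) = R v + R w"
  by (rule eproj_add[OF N ech])

lemma R_vksc: "V v \<Longrightarrow> R (vksc c v) = vksc c (R v)"
  using vksc_smul[of eone n v c] vksc_smul[of eone n "R v" c] eproj_smul[OF N ech, of "ksc c eone" v] by simp

text \<open>The source term of the inhomogeneous equation: the failure of \<open>R\<close> to
  commute with \<open>D\<close> at the k-th divided power. It depends only on the component of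
  \<open>dp k v\<close> off N and takes values in N.\<close>

definition h :: "'k vec \<Rightarrow> nat \<Rightarrow> 'k vec" where
  "h v k = R (D (dp k v - R (dp k v)))"

lemma hN: "V v \<Longrightarrow> h v k \<in> N"
  unfolding h_def by (intro RN) simp

text \<open>Duhamel's formula. Since N is stable under \<open>D\<close>, R D y = D (R y) + R D (y -
  R y); each step adds one source term, on which the remaining powers of \<open>D\<close>
  act.\<close>

lemma R_Dpow:
  assumes v: "V v"
  shows "R ((D ^^ m) v) = (D ^^ m) (R v) + (\<Sum>k<m. vksc (of_nat (fact k)) ((D ^^ (m - 1 - k)) (h v k)))"
proof -
  define T where "T m k = vksc (of_nat (fact k)) ((D ^^ (m - 1 - k)) (h v k))" for m k
  have TV: "V (T m k)" for m k unfolding T_def by (intro evec_vksc V_Dpow NV hN v)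
  have step: "R ((D ^^ Suc m) v) = (D ^^ Suc m) (R v) + (\<Sum>k<Suc m. T (Suc m) k)"
    if IH: "R ((D ^^ m) v) = (D ^^ m) (R v) + (\<Sum>k<m. T m k)" for m
  proof -
    define y where "y = (D ^^ m) v"
    have yV: "V y" unfolding y_def by (rule V_Dpow[OF v])
    have "y = (y - R y) + R y" by simp
    hence "D y = D (y - R y) + D (R y)" using D_add[of "y - R y" "R y"] yV by simp
    hence "R (D y) = R (D (y - R y)) + R (D (R y))" using yV by (simp add: R_add)
    also have "R (D (R y)) = D (R y)" by (intro proj DN RN yV)
    also have "D (R y) = (D ^^ Suc m) (R v) + (\<Sum>k<m. T (Suc m) k)"
    proof -
      have "D (R y) = D ((D ^^ m) (R v)) + D (\<Sum>k<m. T m k)"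
        unfolding y_def IH by (intro D_add V_Dpow V_R v evec_sum TV)
      also have "D (\<Sum>k<m. T m k) = (\<Sum>k<m. D (T m k))" by (intro D_sum TV)
      also have "\<dots> = (\<Sum>k<m. T (Suc m) k)"
      proof (rule sum.cong[OF refl])
        fix k assume "k \<in> {..<m}"
        hence "Suc m - 1 - k = Suc (m - 1 - k)" by auto
        thus "D (T m k) = T (Suc m) k"
          unfolding T_def using D_vksc[OF V_Dpow[OF NV[OF hN[OF v]]]] by simp
      qed
      finally show ?thesis by (simp only: funpow.simps o_apply)
    qed
    also have "R (D (y - R y)) = T (Suc m) m"
    proof -
      have "y - R y = vksc (of_nat (fact m)) (dp m v - R (dp m v))"
      proof -
        have y: "y = vksc (of_nat (fact m)) (dp m v)" unfolding y_def by (rule Dpow_eq_dp)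
        have "R y = vksc (of_nat (fact m)) (R (dp m v))" unfolding y by (rule R_vksc) (simp add: v)
        thus ?thesis unfolding y using vksc_add[of "of_nat (fact m)" "dp m v - R (dp m v)" "R (dp m v)"]
          by (metis R_vksc add_diff_cancel_right' diff_add_cancel)
      qed
      thus ?thesis unfolding T_def h_def using v by (simp only: D_vksc evec_diff V_dp V_R R_vksc V_D) simp
    qed
    finally show ?thesis unfolding y_def sum.lessThan_Suc by (simp only: funpow.simps o_apply add_ac)
  qed
  have base: "R ((D ^^ 0) v) = (D ^^ 0) (R v) + (\<Sum>k<0. T 0 k)" by simp
  have "R ((D ^^ m) v) = (D ^^ m) (R v) + (\<Sum>k<m. T m k)"
    by (induction m) (fact base, fact step)
  thus ?thesis unfolding T_def .
qed

text \<open>In divided powers the source terms acquire the beta coefficients k! (m-1-k)! / m!, where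
  k + (m-1-k) + 1 = m. Their size is what raises the growth exponent of the extension.\<close>

lemma R_dp:
  assumes v: "V v"
  shows "R (dp m v) = dp m (R v) + (\<Sum>k<m.
    vksc (of_nat (fact k) * of_nat (fact (m - 1 - k)) / of_nat (fact m)) (dp (m - 1 - k) (h v k)))"
proof -
  define c where "c = (1 / of_nat (fact m) :: 'k)"
  have "R (dp m v) = vksc c (R ((D ^^ m) v))"
    unfolding dp_def c_def by (rule R_vksc[OF V_Dpow[OF v]])
  also have "\<dots> = dp m (R v) + (\<Sum>k<m. vksc c (vksc (of_nat (fact k)) ((D ^^ (m - 1 - k)) (h v k))))"
    unfolding R_Dpow[OF v] vksc_add vksc_sum by (simp only: dp_def c_def)
  also have "(\<Sum>k<m. vksc c (vksc (of_nat (fact k)) ((D ^^ (m - 1 - k)) (h v k))))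
     = (\<Sum>k<m. vksc (of_nat (fact k) * of_nat (fact (m - 1 - k)) / of_nat (fact m)) (dp (m - 1 - k) (h v k)))"
    unfolding Dpow_eq_dp c_def by (simp only: vksc_simps) (simp add: mult_ac)
  finally show ?thesis .
qed

definition KG :: real where "KG = 1 + (\<Sum>i<n. \<Sum>j<n. gn (G i j))"

lemma gn_D: assumes v: "V v" and r: "\<And>i. gn (v i) \<le> r" shows "gn (D v i) \<le> KG * r"
proof -
  have r0: "0 \<le> r" using order_trans[OF gn_ge0 r] evec_inE[OF v] by blast
  have Gs: "0 \<le> (\<Sum>j<n. gn (G i j))" if "i < n" for i using that inE_G by (intro sum_nonneg) auto
  have S0: "0 \<le> (\<Sum>i<n. \<Sum>j<n. gn (G i j))" by (rule sum_nonneg) (use Gs in simp)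
  hence KG1: "1 \<le> KG" by (simp add: KG_def)
  show ?thesis
  proof (cases "i < n")
    case True
    have Gle: "gn (G i j) \<le> KG" if "j < n" for j
    proof -
      have "gn (G i j) \<le> (\<Sum>j<n. gn (G i j))"
        using that True inE_G by (intro member_le_sum) auto
      also have "\<dots> \<le> (\<Sum>i<n. \<Sum>j<n. gn (G i j))"
        using True Gs by (intro member_le_sum[of i "{..<n}" "\<lambda>i. \<Sum>j<n. gn (G i j)"]) auto
      finally show ?thesis by (simp add: KG_def)
    qed
    have GE: "inE nv (\<Sum>j<n. G i j \<odot> v j)"
      by (intro inE_sum_less inE_emul inE_G True evec_inE[OF v])
    have "r \<le> KG * r" using mult_right_mono[OF KG1 r0] by simp
    hence "gn (ederiv (v i)) \<le> KG * r" using gn_ederiv[OF evec_inE[OF v]] r order_trans by meson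
    moreover have "gn (\<Sum>j<n. G i j \<odot> v j) \<le> KG * r"
    proof (rule gn_sum)
      fix j assume "j \<in> {..<n}"
      hence j: "j < n" by simp
      show "inE nv (G i j \<odot> v j)" by (intro inE_emul inE_G True j evec_inE[OF v])
      show "gn (G i j \<odot> v j) \<le> KG * r" by (intro gn_emul_bound inE_G True j evec_inE[OF v] Gle r)
    qed (use KG1 r0 in simp)
    ultimately have "gn (ederiv (v i) + (\<Sum>j<n. G i j \<odot> v j)) \<le> KG * r"
      using evec_inE[OF v] GE by (intro gn_add) auto
    thus ?thesis using True by (simp add: DM_def)
  next
    case False
    hence "D v i = 0" by (simp add: DM_def)
    thus ?thesis using KG1 r0 by simp
  qed
qed

text \<open>Variation of constants: a horizontal functional that is bounded on \<open>N\<close> and arbitrary on a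
  complement grows at most like \<open>m\<close> times the solutions of the quotient by \<open>N\<close>.\<close>
lemma extension_growth:
  assumes lam: "lam \<ge> 0" and W: "eann n N \<subseteq> W lam" and x: "V x" and C: "0 \<le> C"
    "\<And>i m. i \<in> J \<Longrightarrow> gn (pair x (dp m (b i))) \<le> C"
  shows "x \<in> W (lam + 1)"
proof -
  have "cofun J b i \<in> W lam" if "i < n" for i
    using cofun_in_eann[OF N ech proj that] W by blast
  hence "\<exists>B. \<forall>m. \<forall>j<n. gn (pair (cofun J b i) (dp m (ev j))) \<le> B * real (Suc m) powr lam \<and> 0 \<le> B" if "i < n" for i
    using W_bound[of "cofun J b i" lam] that by metis
  then obtain B where B: "\<And>i m j. i < n \<Longrightarrow> j < n \<Longrightarrow>
      gn (pair (cofun J b i) (dp m (ev j))) \<le> B i * real (Suc m) powr lam \<and> 0 \<le> B i" by metis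
  define C1 where "C1 = (\<Sum>i<n. \<bar>B i\<bar>)"
  have C1: "B i \<le> C1" if "i < n" for i
  proof -
    have "\<bar>B i\<bar> \<le> C1" unfolding C1_def using that by (intro member_le_sum) auto
    thus ?thesis by simp
  qed
  have C10: "0 \<le> C1" unfolding C1_def by (intro sum_nonneg) auto
  define X where "X = (\<Sum>i<n. gn (x i))"
  have X0: "0 \<le> X" unfolding X_def using evec_inE[OF x] by (intro sum_nonneg) auto
  have KG0: "0 \<le> KG" unfolding KG_def using inE_G by (intro add_nonneg_nonneg sum_nonneg) auto
  have Nbound: "gn (pair x (dp l v)) \<le> r * C"
    if v: "v \<in> N" and r: "\<And>i. i \<in> J \<Longrightarrow> gn (v i) \<le> r" and r0: "0 \<le> r" for v r l
  proof -
    have "gn (pair x (dp l (\<Sum>i\<in>J. v i \<bullet> b i))) \<le> r * (C * real (Suc l) powr 0)"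
      by (rule growth_comb[OF x]) (use evec_inE[OF NV[OF v]] r r0 C in auto)
    thus ?thesis using proj[OF v] by (simp add: eproj_def)
  qed
  \<comment> \<open>One summand for each part of the decomposition below: the component off N, the
    projection of the basis vector, and the source terms.\<close>
  define K where "K = X * C1 + C + C * KG * C1"
  have "gn (pair x (dp m (ev j))) \<le> K * real (Suc m) powr (lam + 1)" if j: "j < n" for m j
  proof -
    define v where "v = (ev j :: 'k vec)"
    have v: "V v" unfolding v_def using j by simp
    \<comment> \<open>The component off N: its entries are values of functionals annihilating N,
      which have growth \<open>lam\<close> by assumption.\<close>
    define a where "a k = dp k v - R (dp k v)" for k
    have aV: "V (a k)" for k unfolding a_def using v by simp
    have ai: "gn (a k i) \<le> C1 * real (Suc k) powr lam" for k i
    proof (cases "i < n")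
      case True
      have "a k i = pair (cofun J b i) (dp k v)"
        unfolding a_def by (rule pr_cofun[OF N ech True, symmetric]) (simp add: v)
      hence "gn (a k i) \<le> B i * real (Suc k) powr lam" using B[OF True j] by (simp add: v_def)
      also have "\<dots> \<le> C1 * real (Suc k) powr lam" using C1[OF True] by (intro mult_right_mono) auto
      finally show ?thesis .
    next
      case False
      hence "a k i = 0" using aV[of k] by (simp add: inEvec_def)
      thus ?thesis using C10 by simp
    qed
    have mono: "real (Suc k) powr lam \<le> real (Suc m) powr lam" if "k \<le> m" for k
      using lam that by (intro powr_mono2) auto
    have pw1: "real (Suc m) powr lam \<le> real (Suc m) powr (lam + 1)"
      by (intro powr_mono) auto
    have pw2: "real (Suc m) powr (lam + 1) = real (Suc m) * real (Suc m) powr lam"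
      by (simp add: powr_add)
    have one: "1 \<le> real (Suc m) powr (lam + 1)" using lam by (intro ge_one_powr_ge_zero) auto
    define Y where "Y = real (Suc m) powr (lam + 1)"
    have K1: "X * C1 * Y \<le> K * Y" "C * Y \<le> K * Y" "C * KG * C1 * Y \<le> K * Y" "0 \<le> K * Y"
    proof -
      have nn: "0 \<le> X * C1" "0 \<le> C" "0 \<le> C * KG * C1" "0 \<le> Y"
        using X0 C10 C(1) KG0 by (auto simp: Y_def)
      show "X * C1 * Y \<le> K * Y" "C * Y \<le> K * Y" "C * KG * C1 * Y \<le> K * Y" "0 \<le> K * Y"
        unfolding K_def using nn by (auto intro!: mult_right_mono)
    qed
    have part1: "gn (pair x (a m)) \<le> K * Y"
    proof -
      have "gn (pair x (a m)) \<le> X * (C1 * real (Suc m) powr lam)"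
        unfolding pr_def
      proof (rule gn_sum)
        fix i assume i: "i \<in> {..<n}"
        have "gn (x i) \<le> X" unfolding X_def using i evec_inE[OF x] by (intro member_le_sum) auto
        thus "gn (x i \<odot> a m i) \<le> X * (C1 * real (Suc m) powr lam)"
          using ai evec_inE[OF x] evec_inE[OF aV] by (intro gn_emul_bound)
      qed (use X0 C10 evec_inE[OF x] evec_inE[OF aV] in auto)
      also have "\<dots> \<le> X * (C1 * Y)" unfolding Y_def
        using X0 C10 pw1 by (intro mult_left_mono) auto
      finally show ?thesis using K1(1) by (simp add: mult.assoc)
    qed
    have part2: "gn (pair x (dp m (R v))) \<le> K * Y"
    proof -
      have vi: "gn (R v i) \<le> 1" if "i \<in> J" for i
        using eproj_apply[OF ech that, of v] by (simp add: v_def ev_def)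
      have "gn (pair x (dp m (R v))) \<le> 1 * C" by (rule Nbound[OF RN[OF v] vi]) auto
      also have "\<dots> \<le> C * Y" using mult_left_mono[OF one C(1)] by (simp add: Y_def)
      finally show ?thesis using K1(2) by simp
    qed
    have part3: "gn (pair x (vksc (of_nat (fact k) * of_nat (fact (m - 1 - k)) / of_nat (fact m)) (dp (m - 1 - k) (h v k)))) \<le> K * Y"
      if k: "k < m" for k
    proof -
      define \<beta> where "\<beta> = (of_nat (fact k) * of_nat (fact (m - 1 - k)) / of_nat (fact m) :: 'k)"
      \<comment> \<open>Here the beta bound brings in the factor m that turns growth
        \<open>lam\<close> into \<open>lam + 1\<close>.\<close>
      have "k + (m - 1 - k) + 1 = m" using k by simp
      hence \<beta>: "nv \<beta> \<le> real m" unfolding \<beta>_def using nv_beta_le[of k "m - 1 - k"] by simp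
      have hi: "gn (h v k i) \<le> KG * (C1 * real (Suc k) powr lam)" if "i \<in> J" for i
        unfolding h_def a_def[symmetric] eproj_apply[OF ech that]
        by (rule gn_D[OF aV ai])
      have "gn (pair x (dp (m - 1 - k) (h v k))) \<le> KG * (C1 * real (Suc k) powr lam) * C"
        by (rule Nbound[OF hN[OF v] hi]) (use KG0 C10 in auto)
      also have "\<dots> \<le> KG * (C1 * real (Suc m) powr lam) * C"
        using KG0 C10 C(1) mono[of k] k by (intro mult_right_mono mult_left_mono) auto
      finally have le: "gn (pair x (dp (m - 1 - k) (h v k))) \<le> KG * (C1 * real (Suc m) powr lam) * C" .
      have hV: "V (dp (m - 1 - k) (h v k))" by (intro V_dp NV hN v)
      have "gn (pair x (vksc \<beta> (dp (m - 1 - k) (h v k)))) = nv \<beta> * gn (pair x (dp (m - 1 - k) (h v k)))"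
        using x hV by (simp add: pr_vksc)
      also have "\<dots> \<le> real (Suc m) * (KG * (C1 * real (Suc m) powr lam) * C)"
        using \<beta> le x hV by (intro mult_mono) auto
      also have "\<dots> = C * KG * C1 * Y" unfolding Y_def pw2 by (simp add: mult_ac)
      finally show ?thesis using K1(3) unfolding \<beta>_def by linarith
    qed
    define S where "S = (\<Sum>k<m. vksc (of_nat (fact k) * of_nat (fact (m - 1 - k)) / of_nat (fact m)) (dp (m - 1 - k) (h v k)))"
    have TV: "V (vksc c (dp l (h v k)))" for c l k by (intro evec_vksc V_dp NV hN v)
    have SV: "V S" unfolding S_def by (intro evec_sum TV)
    have "gn (pair x S) \<le> K * Y"
    proof -
      have eq: "pair x S = (\<Sum>k<m. pair x (vksc (of_nat (fact k) * of_nat (fact (m - 1 - k)) / of_nat (fact m)) (dp (m - 1 - k) (h v k))))"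
        unfolding S_def by (intro pr_sum_right x TV)
      show ?thesis unfolding eq by (intro gn_sum K1 inE_pr x TV part3) simp
    qed
    moreover have "pair x (dp m v) = pair x (a m) + (pair x (dp m (R v)) + pair x S)"
    proof -
      have "dp m v = a m + R (dp m v)" by (simp add: a_def)
      also have "R (dp m v) = dp m (R v) + S" unfolding S_def by (rule R_dp[OF v])
      finally have "dp m v = a m + (dp m (R v) + S)" .
      hence "pair x (dp m v) = pair x (a m + (dp m (R v) + S))" by (rule arg_cong)
      thus ?thesis using x v aV[of m] SV by (simp only: pr_add_right V_dp V_R evec_add)
    qed
    ultimately have "gn (pair x (dp m v)) \<le> K * Y"
      using part1 part2 x v aV[of m] SV by (simp only:) (intro gn_add inE_add inE_pr V_dp V_R)
    thus ?thesis by (simp only: Y_def v_def)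
  qed
  thus ?thesis unfolding W_def using x by blast
qed

end

section \<open>The slopes\<close>

context phi_nabla
begin

lemma W_step:
  assumes lam: "lam \<ge> 0" and ne: "eann n (W lam) \<noteq> {0}"
  shows "eann n (W (lam + 1)) \<noteq> eann n (W lam)"
proof
  assume eq: "eann n (W (lam + 1)) = eann n (W lam)"
  define N where "N = eann n (W lam)"
  have N: "esub n N" unfolding N_def by (rule esub_eann) (rule W_V)
  obtain J b where b: "echelon n N J b" "\<And>v. v \<in> N \<Longrightarrow> eproj J b v = v"
    using echelon_exists[OF N] by blast
  have "J \<noteq> {}"
  proof
    assume "J = {}"
    hence "v = 0" if "v \<in> N" for v using b(2)[OF that] by (simp add: eproj_def)
    thus False using ne esub_0[OF N] unfolding N_def by blast
  qed
  then interpret phi_nabla_sub nv p q phiK s n A G N J b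
    using N b eann_W_F[OF lam] eann_W_D[OF lam] by unfold_locales (auto simp: N_def)
  obtain x C where x: "V x" "\<exists>v\<in>N. pair x v \<noteq> 0" "0 \<le> C"
    "\<And>i m. i \<in> J \<Longrightarrow> gn (pair x (dp m (b i))) \<le> C"
    using bounded_functional_exists by blast
  have ann: "eann n N = W lam" unfolding N_def by (rule eann_eann[OF esub_W])
  hence "x \<in> W (lam + 1)" by (intro extension_growth[OF lam _ x(1,3,4)]) (auto simp: ann)
  also have "W (lam + 1) = W lam" using eann_eann[OF esub_W] eq by metis
  also have "W lam = eann n N" by (rule ann[symmetric])
  finally show False using x(2) by (simp add: eann_def)
qed

section \<open>Dimensions of the filtration and multiplicities of slopes\<close>

definition dl :: "real \<Rightarrow> nat" where
  "dl lam = dimE nv (Mlam nv phiK s n A G lam)"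

lemma V_eann: "v \<in> eann n X \<Longrightarrow> V v"
  by (simp add: eann_def)

lemma eann_W_antimono: "lam \<le> mu \<Longrightarrow> eann n (W mu) \<subseteq> eann n (W lam)"
  using W_mono[of lam mu] unfolding eann_def by blast

lemma dl_antimono: assumes "0 \<le> lam" "lam \<le> mu" shows "dl mu \<le> dl lam"
proof -
  have "dimE nv (eann n (W mu)) \<le> dimE nv (eann n (W lam))"
    by (rule dimE_mono[OF _ eann_W_antimono[OF assms(2)]]) (rule V_eann)
  thus ?thesis using assms by (simp add: dl_def Mlam_eq)
qed

lemma dl_le: assumes "0 \<le> lam" shows "dl lam \<le> n"
proof -
  have "dimE nv (eann n (W lam)) \<le> n" by (rule dimE_le) (rule V_eann)
  thus ?thesis using assms by (simp add: dl_def Mlam_eq)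
qed

text \<open>For negative exponents the solution spaces coincide, so the two definite descriptions
  are the same term. This constancy excludes negative slopes.\<close>

lemma dl_neg: assumes "lam < 0" "mu < 0" shows "dl lam = dl mu"
proof -
  have "Sol_lam nv n G lam = Sol_lam nv n G mu"
    using assms by (simp add: Sol_lam_def growth_def)
  thus ?thesis by (simp add: dl_def Mlam_def)
qed

lemma Lim_eventually_const:
  fixes g :: "real \<Rightarrow> nat"
  assumes e: "0 < e" and c: "\<And>\<epsilon>. 0 < \<epsilon> \<Longrightarrow> \<epsilon> < e \<Longrightarrow> g \<epsilon> = c"
  shows "Lim (at_right 0) (\<lambda>\<epsilon>. real (g \<epsilon>)) = real c"
proof (rule tendsto_Lim)
  have "\<forall>\<^sub>F \<epsilon> in at_right 0. real (g \<epsilon>) = real c"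
    using eventually_at_right_real[OF e] by (rule eventually_mono) (use c in auto)
  thus "((\<lambda>\<epsilon>. real (g \<epsilon>)) \<longlongrightarrow> real c) (at_right 0)" by (rule tendsto_eventually)
qed simp

lemma lg_mult_neg: assumes "lam < 0" shows "lg_mult nv phiK s n A G lam = 0"
proof -
  have "Lim (at_right 0) (\<lambda>\<epsilon>. real (dl (lam - \<epsilon>))) = real (dl lam)"
    by (rule Lim_eventually_const[of 1]) (use assms in \<open>auto intro!: dl_neg\<close>)
  moreover have "Lim (at_right 0) (\<lambda>\<epsilon>. real (dl (lam + \<epsilon>))) = real (dl lam)"
    by (rule Lim_eventually_const[of "- lam"]) (use assms in \<open>auto intro!: dl_neg\<close>)
  ultimately show ?thesis by (simp add: lg_mult_def dl_def)
qed

text \<open>\<open>dl\<close> is antitone on nonnegative arguments and takes natural values at most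
  n. Where it is least on [0, lam) lies \<open>mu\<close>, and where it is greatest beyond lam lies
  \<open>nu\<close>; between these points and lam it is constant, so the limits in the definition
  become values.\<close>

lemma lg_mult_pos:
  assumes lam: "0 < lam"
  obtains mu nu c d where "0 \<le> mu" "mu < lam" "lam < nu" "\<And>x. mu \<le> x \<Longrightarrow> x < lam \<Longrightarrow> dl x = c"
    "\<And>x. lam < x \<Longrightarrow> x \<le> nu \<Longrightarrow> dl x = d" "lg_mult nv phiK s n A G lam = real c - real d"
proof -
  obtain mu where mu: "0 \<le> mu \<and> mu < lam" "\<And>y. 0 \<le> y \<and> y < lam \<Longrightarrow> dl mu \<le> dl y"
    using ex_has_least_nat[of "\<lambda>y. 0 \<le> y \<and> y < lam" 0 dl] lam by auto
  have "dl y < Suc n" if "lam < y" for y using dl_le[of y] lam that by simp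
  hence bd: "\<forall>y. lam < y \<longrightarrow> dl y < Suc n" by blast
  have "lam < lam + 1" by simp
  hence "\<exists>x. lam < x \<and> (\<forall>y. lam < y \<longrightarrow> dl y \<le> dl x)"
    using bd by (rule ex_has_greatest_nat)
  then obtain nu where nu: "lam < nu" "\<And>y. lam < y \<Longrightarrow> dl y \<le> dl nu" by blast
  have left: "dl x = dl mu" if "mu \<le> x" "x < lam" for x
  proof (rule antisym)
    show "dl x \<le> dl mu" using mu(1) that by (intro dl_antimono) auto
    show "dl mu \<le> dl x" using mu(1) that by (intro mu(2)) auto
  qed
  have right: "dl x = dl nu" if "lam < x" "x \<le> nu" for x
  proof (rule antisym)
    show "dl x \<le> dl nu" using that by (intro nu(2)) auto
    show "dl nu \<le> dl x" using lam that by (intro dl_antimono) auto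
  qed
  have "Lim (at_right 0) (\<lambda>\<epsilon>. real (dl (lam - \<epsilon>))) = real (dl mu)"
    by (rule Lim_eventually_const[of "lam - mu"]) (use mu in \<open>auto intro!: left\<close>)
  moreover have "Lim (at_right 0) (\<lambda>\<epsilon>. real (dl (lam + \<epsilon>))) = real (dl nu)"
    by (rule Lim_eventually_const[of "nu - lam"]) (use nu in \<open>auto intro!: right\<close>)
  ultimately have "lg_mult nv phiK s n A G lam = real (dl mu) - real (dl nu)"
    by (simp add: lg_mult_def dl_def)
  from that[OF conjunct1[OF mu(1)] conjunct2[OF mu(1)] nu(1) left right this] show ?thesis .
qed

text \<open>Multiplicity 0 equates the constant values on the two sides of l, and monotonicity fixes
  the value at l itself; \<open>dl\<close> is thus locally constant on a connected interval.\<close>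

lemma dl_const:
  assumes a: "0 \<le> a" and z: "\<And>l. a < l \<Longrightarrow> l < b \<Longrightarrow> lg_mult nv phiK s n A G l = 0"
    and x: "a < x" "x < b" and y: "a < y" "y < b"
  shows "dl x = dl y"
proof (rule connected_local_const[of "{a<..<b}" x y dl])
  show "\<forall>l\<in>{a<..<b}. \<forall>\<^sub>F u in at l within {a<..<b}. dl l = dl u"
  proof
    fix l assume l: "l \<in> {a<..<b}"
    hence l0: "0 < l" using a by simp
    obtain mu nu c d where mn: "0 \<le> mu" "mu < l" "l < nu"
      and c: "\<And>x. mu \<le> x \<Longrightarrow> x < l \<Longrightarrow> dl x = c" and d: "\<And>x. l < x \<Longrightarrow> x \<le> nu \<Longrightarrow> dl x = d"
      and m: "lg_mult nv phiK s n A G l = real c - real d"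
      using lg_mult_pos[OF l0] by metis
    have eq: "c = d" using z[of l] l m by simp
    have dmu: "dl mu = c" and dnu: "dl nu = d" using mn by (auto intro: c d)
    have "dl l \<le> dl mu" by (rule dl_antimono) (use mn(1,2) in linarith)+
    moreover have "dl nu \<le> dl l" by (rule dl_antimono) (use l0 mn(3) in linarith)+
    ultimately have dl: "dl l = c" using eq dmu dnu by simp
    have near: "dl l = dl u" if u: "u \<in> {mu<..<nu}" for u
    proof (cases u l rule: linorder_cases)
      case less
      thus ?thesis using c[of u] u dl by simp
    next
      case greater
      thus ?thesis using d[of u] u dl eq by simp
    qed simp
    have "\<forall>\<^sub>F u in nhds l. u \<in> {mu<..<nu}"
      by (rule eventually_nhds_in_open) (use mn(2,3) in simp_all)
    hence "\<forall>\<^sub>F u in at l within {a<..<b}. u \<in> {mu<..<nu}"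
      unfolding eventually_at_filter by (rule eventually_mono) simp
    thus "\<forall>\<^sub>F u in at l within {a<..<b}. dl l = dl u"
      by (rule eventually_mono) (rule near)
  qed
qed (use x y connected_Ioo in simp_all)

text \<open>With \<open>lam\<close> and \<open>lam + 1\<close> both inside the gap the two
  submodules have the same dimension, hence agree, and \<open>W_step\<close> makes them 0. From
  \<open>lam\<close> on the dimension is then constant, so b has multiplicity 0.\<close>

lemma slope_gap:
  assumes a: "0 \<le> a" and ab: "1 < b - a"
    and z: "\<And>l. a < l \<Longrightarrow> l < b \<Longrightarrow> lg_mult nv phiK s n A G l = 0"
  shows "lg_mult nv phiK s n A G b = 0"
proof -
  \<comment> \<open>Chosen so that a < \<open>lam\<close> and \<open>lam + 1\<close> < b hold with
    the same margin (b - a - 1) / 2.\<close>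
  define lam where "lam = (a + b - 1) / 2"
  have lam: "a < lam" "lam + 1 < b" "0 \<le> lam" using ab a by (simp_all add: lam_def field_simps)
  have "dl (lam + 1) = dl lam" by (rule dl_const[OF a z]) (use lam in auto)
  hence "dimE nv (eann n (W (lam + 1))) = dimE nv (eann n (W lam))"
    using lam by (simp add: dl_def Mlam_eq)
  hence "eann n (W (lam + 1)) = eann n (W lam)"
    by (intro dimE_eq_imp_eq[of n] esub_eann eann_W_antimono) (auto simp: V_eann W_V)
  hence zero: "eann n (W lam) = {0}" using W_step[OF lam(3)] by blast
  have dl: "dl x = dl lam" if "lam \<le> x" for x
  proof -
    have "0 \<in> eann n (W x)" by (simp add: eann_def)
    moreover have "eann n (W x) \<subseteq> {0}" using eann_W_antimono[OF that] unfolding zero .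
    ultimately have "eann n (W x) = eann n (W lam)" unfolding zero by (intro equalityI) simp_all
    thus ?thesis using lam that by (simp add: dl_def Mlam_eq)
  qed
  have b0: "0 < b" using lam by linarith
  obtain mu nu c d where mn: "0 \<le> mu" "mu < b" "b < nu"
    and c: "\<And>x. mu \<le> x \<Longrightarrow> x < b \<Longrightarrow> dl x = c" and d: "\<And>x. b < x \<Longrightarrow> x \<le> nu \<Longrightarrow> dl x = d"
    and m: "lg_mult nv phiK s n A G b = real c - real d"
    using lg_mult_pos[OF b0] by metis
  have "dl (max mu lam) = c" using mn(2) lam by (intro c) auto
  moreover have "dl (max mu lam) = dl lam" by (rule dl) simp
  moreover have "dl nu = d" using mn(3) by (intro d) auto
  moreover have "dl nu = dl lam" using mn(3) lam by (intro dl) auto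
  ultimately show ?thesis using m by simp
qed

end

theorem theorem17p0p9:
  fixes nv :: "'k::field_char_0 \<Rightarrow> real" and p q :: nat and phiK :: "'k \<Rightarrow> 'k"
    and s :: "'k lau" and n :: nat and A G :: "nat \<Rightarrow> nat \<Rightarrow> 'k lau"
    and L :: "real list"
  assumes "base_field nv p"
    and "\<exists>k\<ge>1. q = p ^ k"
    and "frob_lift nv q phiK"
    and "frob_param nv q s"
    and "phi_nabla_module nv phiK s n A G"
    and "sorted L"
    and "\<forall>l. real (count (mset L) l) = lg_mult nv phiK s n A G l"
  shows "\<forall>i. Suc i < length L \<longrightarrow> L ! Suc i - L ! i \<le> 1"
proof (intro allI impI, rule ccontr)
  interpret phi_nabla nv p q phiK s n A G
    using assms(1-5) by unfold_locales
  fix i assume i: "Suc i < length L" and gap: "\<not> L ! Suc i - L ! i \<le> 1"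
  have mult: "lg_mult nv phiK s n A G l = real (count (mset L) l)" for l
    using assms(7) by simp
  have ne: "lg_mult nv phiK s n A G (L ! k) \<noteq> 0" if "k < length L" for k
    using that unfolding mult by simp
  \<comment> \<open>Entries of \<open>L\<close> have nonzero multiplicity and negative numbers have
    multiplicity 0, so the gap begins in the range where \<open>Mlam_eq\<close> applies.\<close>
  have nonneg: "0 \<le> L ! i" using lg_mult_neg[of "L ! i"] ne[OF Suc_lessD[OF i]] by (meson not_le)
  have zero: "lg_mult nv phiK s n A G l = 0" if l: "L ! i < l" "l < L ! Suc i" for l
  proof -
    have "l \<notin> set L"
    proof
      assume "l \<in> set L"
      then obtain k where k: "k < length L" "L ! k = l" by (auto simp: in_set_conv_nth)
      show False
      proof (cases "k \<le> i")
        case True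
        thus False using sorted_nth_mono[OF assms(6) True] i k l by simp
      next
        case False
        thus False using sorted_nth_mono[OF assms(6), of "Suc i" k] i k l by simp
      qed
    qed
    thus ?thesis unfolding mult by simp
  qed
  have "1 < L ! Suc i - L ! i" using gap by simp
  from slope_gap[OF nonneg this zero] have "lg_mult nv phiK s n A G (L ! Suc i) = 0" .
  thus False using ne[OF i] by simp
qed

end
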